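(* Let $F$ be a field of characteristic zero, $m$ a positive integer, $r=\lfloor m/2\rfloor$, $G=\mathbb{Z}^{r}$, and let $\mathcal{U}=UT_m(F)$ with the finest grading and the reflection involution $\ast$. Then the following polynomials form a basis for the $(G,\ast)$-identities $T_{G,\ast}(\mathcal{U})$: (a) $[x_{1,0},x_{2,0}]$; (b) $x_{1,g}^{\ast}-x_{1,g}$, where $\dim\mathcal{U}_g=1$; (c) if $m=2r+1$: $x_{1,g}x_{2,0}x_{3,h}-x_{1,g}x_{2,0}^{\ast}x_{3,h}$, where $g=e_i$, $h=e_j$, $1\le i,j\le r$; (d) if $m=2r+1$: $x_{1,0}x_{2,g}x_{3,0}-x_{1,0}^{\ast}x_{2,g}x_{3,0}-x_{1,0}x_{2,g}x_{3,0}^{\ast}+x_{1,0}^{\ast}x_{2,g}x_{3,0}^{\ast}$, where $g=e_i$, $1\le i\le r$; (e) if $m=2r+1$: $x_{1,0}x_{2,g}x_{3,h}-x_{1,0}^{\ast}x_{2,g}x_{3,h}$, where $g=e_i$, $2\le i\le r$, $h=e_j-e_i$, $1\le j<i$; (f) the monomials of the form $x_{1,g_1}\cdots x_{n,g_n}$, with $n\le 3$ and $g_i\neq 0$ for all $i$, that are $(G,\ast)$-identities for $\mathcal{U}$. Moreover, the images of the good monomials of degree $n$ under the canonical quotient map form a basis of the vector space $P_n^{G,\ast}/(P_n^{G,\ast}\cap T_{G,\ast}(\mathcal{U}))$.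
   Context: $UT_m(F)$ is the algebra of $m\times m$ upper triangular matrices, with elementary matrices $E_{i,j}$, $i\le j$. For an abelian group $G$ (written additively) the elementary grading induced by $(g_1,\dots,g_m)\in G^m$ is the $G$-grading with $\deg E_{i,j}=g_i-g_j$. The finest grading on $UT_m(F)$ is the elementary $\mathbb{Z}^{\lfloor m/2\rfloor}$-grading induced by $(e_1,\dots,e_r,0,e_r-e_{r-1},\dots,e_r-e_1)$ if $m=2r$ and by $(e_1,\dots,e_r,0,-e_r,\dots,-e_1)$ if $m=2r+1$, where $e_1,\dots,e_r$ is the standard basis of $\mathbb{Z}^r$. The reflection involution is the linear map with $E_{i,j}^\ast=E_{m+1-j,m+1-i}$; it is graded (preserves each homogeneous component $\mathcal{U}_g$). $F_{G,\ast}\langle X\rangle$ is the free associative algebra on indeterminates $x_{i,g},x_{i,g}^\ast$ ($i\in\mathbb{N},g\in G$), graded with both of degree $g$, with involution exchanging $x_{i,g}$ and $x_{i,g}^\ast$. A polynomial is a $(G,\ast)$-identity for $\mathcal{U}$ if it vanishes under all substitutions of each $x_{i,g}$ by an element $a_{i,g}\in\mathcal{U}_g$ and $x_{i,g}^\ast$ by $a_{i,g}^\ast$; $T_{G,\ast}(\mathcal{U})$ is the set of these. A $T_{G,\ast}$-ideal is a two-sided ideal of $F_{G,\ast}\langle X\rangle$ invariant under the involution and under all graded endomorphisms commuting with the involution. A subset $P$ is a basis for $T_{G,\ast}(\mathcal{U})$ if the intersection of all $T_{G,\ast}$-ideals containing $P$ equals $T_{G,\ast}(\mathcal{U})$. $P_n^{G,\ast}$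 is the span of the monomials $x_{\sigma(1),g_1}^{\delta_1}\cdots x_{\sigma(n),g_n}^{\delta_n}$ with $\sigma\in S_n$, $g_i\in G$, $\delta_i\in\{\emptyset,\ast\}$ (here $x^{\emptyset}=x$). Good monomials. Write a monomial of $P_n^{G,\ast}$ as $M=M_1x_{u_1,g_1}^{\delta_1}M_2x_{u_2,g_2}^{\delta_2}\cdots M_kx_{u_k,g_k}^{\delta_k}M_{k+1}$, with $g_1,\dots,g_k\ne 0$ and $M_i=x_{k_{i,1},0}^{\delta_{i,1}}\cdots x_{k_{i,s_i},0}^{\delta_{i,s_i}}$ (with $M_i=1$ if $s_i=0$; $k=0$ is allowed). $M$ is good if it is not a $(G,\ast)$-identity for $\mathcal{U}$ and: (I) $k_{i,1}<\cdots<k_{i,s_i}$ for each $i$; (II) if $\dim\mathcal{U}_{g_i}=1$ then $\delta_i=\emptyset$ and $M_i=1$; (III) if $\dim\mathcal{U}_g=1$ for $g=g_i+g_{i+1}+\cdots+g_j$ with $i<j$, then $M_i=1$ and $u_i<u_j$; (IV) if $m=2r+1$ and $g_i,g_{i+1}\in\{e_1,\dots,e_r\}$ then $\delta_{i+1,1}=\cdots=\delta_{i+1,s_{i+1}}=\emptyset$; (V) if $m=2r+1$, $k\ge 2$, $g_1\in\{e_1,\dots,e_r\}$ and $g_2\notin\{e_1,\dots,e_r\}$ then $\delta_{1,1}=\cdots=\delta_{1,s_1}=\emptyset$; (VI) if $m=2r+1$, $k\ge 2$, $g_{k-1}\notin\{e_1,\dots,e_r\}$ and $g_k\in\{e_1,\dots,e_r\}$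 then $\delta_{k+1,1}=\cdots=\delta_{k+1,s_{k+1}}=\emptyset$; (VII) if $m=2r+1$, $k=1$ and $g_1\in\{e_1,\dots,e_r\}$ then $\delta_{1,1}=\cdots=\delta_{1,s_1}=\emptyset$ or $\delta_{2,1}=\cdots=\delta_{2,s_2}=\emptyset$. *)

theory Defs
  imports
    "HOL-Library.Poly_Mapping"
    "HOL-Combinatorics.Permutations"
    "HOL-Algebra.Ideal"
    "Jordan_Normal_Form.VS_Connect"
begin

section \<open>Free graded algebra with involution\<close>

text \<open>\<open>Indet i g False\<close> is $x_{i,g}$ and \<open>Indet i g True\<close> is $x_{i,g}^*$.\<close>

datatype 'g indet = Indet (vind: nat) (vdeg: 'g) (starred: bool)

text \<open>The free monoid on \<open>'a\<close>, written additively so that \<open>'a fmon \<Rightarrow>\<^sub>0 'f\<close> carries the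
  convolution product of \<^theory>\<open>HOL-Library.Poly_Mapping\<close> and is the free associative algebra.
  A separate type is used because lists have no canonical \<open>+\<close>.\<close>

datatype 'a fmon = FMon (letters: "'a list")

instantiation fmon :: (type) monoid_add
begin

definition zero_fmon :: "'a fmon" where
  "zero_fmon = FMon []"

definition plus_fmon :: "'a fmon \<Rightarrow> 'a fmon \<Rightarrow> 'a fmon" where
  "plus_fmon v w = FMon (letters v @ letters w)"

instance
  by standard (simp_all add: zero_fmon_def plus_fmon_def)

end

type_synonym ('g, 'f) fpoly = "'g indet fmon \<Rightarrow>\<^sub>0 'f"

definition free_alg :: "'g set \<Rightarrow> ('f::field, ('g, 'f) fpoly) module" where
  "free_alg G = \<lparr>
     carrier = {p. \<forall>w \<in> Poly_Mapping.keys p. \<forall>l \<in> set (letters w). vdeg l \<in> G},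
     mult = (*), one = 1, zero = 0, add = (+),
     smult = (\<lambda>c p. Poly_Mapping.map ((*) c) p)\<rparr>"

lemma free_alg_simps:
  "carrier (free_alg G) = {p. \<forall>w \<in> Poly_Mapping.keys p. \<forall>l \<in> set (letters w). vdeg l \<in> G}"
  "mult (free_alg G) = (*)" "one (free_alg G) = 1" "zero (free_alg G) = 0" "add (free_alg G) = (+)"
  "smult (free_alg G) = (\<lambda>c p. Poly_Mapping.single 0 c * p)"
  by (simp_all add: free_alg_def fun_eq_iff mult_map_scale_conv_mult)

lemma free_alg_closed:
  fixes p q :: "('g, 'f::field) fpoly"
  shows "p \<in> carrier (free_alg G) \<Longrightarrow> q \<in> carrier (free_alg G) \<Longrightarrow> p + q \<in> carrier (free_alg G)"
    and "p \<in> carrier (free_alg G) \<Longrightarrow> q \<in> carrier (free_alg G) \<Longrightarrow> p * q \<in> carrier (free_alg G)"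
    and "p \<in> carrier (free_alg G) \<Longrightarrow> - p \<in> carrier (free_alg G)"
    and "Poly_Mapping.single 0 c \<in> carrier (free_alg G)"
proof -
  show "p \<in> carrier (free_alg G) \<Longrightarrow> q \<in> carrier (free_alg G) \<Longrightarrow> p + q \<in> carrier (free_alg G)"
    using Poly_Mapping.keys_add[of p q] by (fastforce simp: free_alg_simps)
  show "p \<in> carrier (free_alg G) \<Longrightarrow> q \<in> carrier (free_alg G) \<Longrightarrow> p * q \<in> carrier (free_alg G)"
    using Poly_Mapping.keys_mult[of p q] by (fastforce simp: free_alg_simps plus_fmon_def)
  show "p \<in> carrier (free_alg G) \<Longrightarrow> - p \<in> carrier (free_alg G)"
    by (simp add: free_alg_simps)
  show "Poly_Mapping.single 0 c \<in> carrier (free_alg G)"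
    by (simp add: free_alg_simps zero_fmon_def)
qed

lemma ring_free_alg: "ring (free_alg G :: ('f::field, ('g, 'f) fpoly) module)"
proof (rule ringI)
  show "abelian_group (free_alg G :: ('f, ('g, 'f) fpoly) module)"
  proof (rule abelian_groupI)
    fix p :: "('g, 'f) fpoly"
    assume "p \<in> carrier (free_alg G)"
    then show "\<exists>q \<in> carrier (free_alg G). q \<oplus>\<^bsub>free_alg G\<^esub> p = \<zero>\<^bsub>free_alg G\<^esub>"
      by (intro bexI[of _ "- p"] free_alg_closed) (simp_all add: free_alg_simps)
  qed (simp_all only: free_alg_closed free_alg_simps(2-), simp_all add: free_alg_simps add.assoc add.commute)
  show "Group.monoid (free_alg G :: ('f, ('g, 'f) fpoly) module)"
    by (rule monoidI)
      (simp_all only: free_alg_closed free_alg_closed(4)[of 1, unfolded single_one]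
        free_alg_simps(2-) mult.assoc mult_1_left mult_1_right)
qed (simp_all only: free_alg_simps(2-) distrib_left distrib_right)

lemma vectorspace_free_alg: "vectorspace class_ring (free_alg G :: ('f::field, ('g, 'f) fpoly) module)"
proof (intro vectorspace.intro Module.module.intro class_field.field_axioms)
  show "cring (class_ring :: 'f ring)" by unfold_locales
  show "abelian_group (free_alg G :: ('f, ('g, 'f) fpoly) module)"
    using ring_free_alg by (rule ring.is_abelian_group)
  show "module_axioms class_ring (free_alg G :: ('f, ('g, 'f) fpoly) module)"
    by (rule module_axioms.intro)
      (simp_all only: free_alg_closed free_alg_simps(2-) single_add distrib_left distrib_right
        mult.assoc[symmetric] mult_single add_0_left single_one mult_1_left class_ring_simps partial_object.simps
         monoid.simps ring.simps)
qed

definition fmonom :: "'g indet list \<Rightarrow> ('g, 'f::field) fpoly" where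
  "fmonom ls = Poly_Mapping.single (FMon ls) 1"

definition mdeg :: "'g::comm_monoid_add indet fmon \<Rightarrow> 'g" where
  "mdeg w = sum_list (map vdeg (letters w))"

definition free_comp :: "'g::comm_monoid_add set \<Rightarrow> 'g \<Rightarrow> ('g, 'f::field) fpoly set" where
  "free_comp G g = {p \<in> carrier (free_alg G). \<forall>w \<in> Poly_Mapping.keys p. mdeg w = g}"

definition indet_star :: "'g indet \<Rightarrow> 'g indet" where
  "indet_star l = Indet (vind l) (vdeg l) (\<not> starred l)"

definition mono_star :: "'g indet fmon \<Rightarrow> 'g indet fmon" where
  "mono_star w = FMon (rev (map indet_star (letters w)))"

definition free_star :: "('g, 'f::field) fpoly \<Rightarrow> ('g, 'f) fpoly" where
  "free_star p = (\<Sum>w \<in> Poly_Mapping.keys p.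
     Poly_Mapping.single (mono_star w) (Poly_Mapping.lookup p w))"

definition graded_star_endo ::
  "'g::comm_monoid_add set \<Rightarrow> (('g, 'f::field) fpoly \<Rightarrow> ('g, 'f) fpoly) \<Rightarrow> bool" where
  "graded_star_endo G \<phi> \<longleftrightarrow>
     \<phi> \<in> Ring.ring_hom (free_alg G) (free_alg G) \<and>
     \<phi> \<in> LinearCombinations.module_hom class_ring (free_alg G) (free_alg G) \<and>
     (\<forall>g \<in> G. \<phi> ` free_comp G g \<subseteq> free_comp G g) \<and>
     (\<forall>p \<in> carrier (free_alg G). \<phi> (free_star p) = free_star (\<phi> p))"

definition T_ideal :: "'g::comm_monoid_add set \<Rightarrow> ('g, 'f::field) fpoly set \<Rightarrow> bool" where
  "T_ideal G I \<longleftrightarrow>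
     ideal I (free_alg G) \<and> free_star ` I \<subseteq> I \<and>
     (\<forall>\<phi>. graded_star_endo G \<phi> \<longrightarrow> \<phi> ` I \<subseteq> I)"

definition T_basis ::
  "'g::comm_monoid_add set \<Rightarrow> ('g, 'f::field) fpoly set \<Rightarrow> ('g, 'f) fpoly set \<Rightarrow> bool" where
  "T_basis G P T \<longleftrightarrow> P \<subseteq> carrier (free_alg G) \<and> \<Inter> {I. T_ideal G I \<and> P \<subseteq> I} = T"

definition multilinear_monos :: "'g set \<Rightarrow> nat \<Rightarrow> 'g indet list set" where
  "multilinear_monos G n =
     {map (\<lambda>i. Indet (\<sigma> i) (g i) (\<delta> i)) [1..<Suc n] | \<sigma> g \<delta>.
        \<sigma> permutes {1..n} \<and> (\<forall>i \<in> {1..n}. g i \<in> G)}"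

definition multilinear_space :: "'g set \<Rightarrow> nat \<Rightarrow> ('g, 'f::field) fpoly set" where
  "multilinear_space G n =
     LinearCombinations.module.span class_ring (free_alg G) (fmonom ` multilinear_monos G n)"


section \<open>Quotient vector spaces\<close>

text \<open>The ring multiplication and unit of the record play no role in a module.\<close>

definition quot_space :: "('f, 'v, 'c) module_scheme \<Rightarrow> 'v set \<Rightarrow> ('f, 'v set) module" where
  "quot_space V W = \<lparr>
     carrier = a_rcosets\<^bsub>V\<^esub> W,
     mult = undefined, one = undefined,
     zero = W, add = set_add V,
     smult = (\<lambda>c X. \<Union>x \<in> X. W +>\<^bsub>V\<^esub> (c \<odot>\<^bsub>V\<^esub> x))\<rparr>"

lemma vectorspace_quot:
  assumes V: "vectorspace K V" and W: "submodule K W V"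
  shows "vectorspace K (quot_space V W)"
proof -
  interpret V: vectorspace K V by fact
  interpret W: submodule K W V by fact
  let ?Q = "quot_space V W"
  have neg: "\<ominus>\<^bsub>V\<^esub> w \<in> W" if "w \<in> W" for w
  proof -
    have "\<ominus>\<^bsub>V\<^esub> w = (\<ominus>\<^bsub>K\<^esub> \<one>\<^bsub>K\<^esub>) \<odot>\<^bsub>V\<^esub> w"
      using that W.subset V.smult_minus_1 by auto
    then show ?thesis using that by simp
  qed
  have "subgroup W (add_monoid V)"
    by (rule subgroup.intro) (use W.subset neg in \<open>auto simp: a_inv_def\<close>)
  then have "additive_subgroup W V" by (rule additive_subgroupI)
  then interpret A: abelian_subgroup W V
    by (intro abelian_subgroupI3 V.abelian_group_axioms)
  have sm: "c \<odot>\<^bsub>?Q\<^esub> (W +>\<^bsub>V\<^esub> x) = W +>\<^bsub>V\<^esub> (c \<odot>\<^bsub>V\<^esub> x)"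
    if "c \<in> carrier K" "x \<in> carrier V" for c x
  proof -
    have "W +>\<^bsub>V\<^esub> (c \<odot>\<^bsub>V\<^esub> y) = W +>\<^bsub>V\<^esub> (c \<odot>\<^bsub>V\<^esub> x)" if y: "y \<in> W +>\<^bsub>V\<^esub> x" for y
    proof -
      obtain w where w: "w \<in> W" "y = w \<oplus>\<^bsub>V\<^esub> x" using y by (auto simp: a_r_coset_def')
      have "c \<odot>\<^bsub>V\<^esub> y = (c \<odot>\<^bsub>V\<^esub> w) \<oplus>\<^bsub>V\<^esub> (c \<odot>\<^bsub>V\<^esub> x)"
        using w \<open>c \<in> carrier K\<close> \<open>x \<in> carrier V\<close> W.subset by (auto simp: V.smult_r_distr)
      then have mem: "c \<odot>\<^bsub>V\<^esub> y \<in> W +>\<^bsub>V\<^esub> (c \<odot>\<^bsub>V\<^esub> x)"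
        using w \<open>c \<in> carrier K\<close> by (auto simp: a_r_coset_def')
      show ?thesis
        by (rule V.a_repr_independence[OF mem _ A.a_subgroup, symmetric])
          (rule V.smult_closed[OF \<open>c \<in> carrier K\<close> \<open>x \<in> carrier V\<close>])
    qed
    moreover have "x \<in> W +>\<^bsub>V\<^esub> x"
      using that by (auto simp: a_r_coset_def' intro!: bexI[of _ "\<zero>\<^bsub>V\<^esub>"])
    moreover have "c \<odot>\<^bsub>?Q\<^esub> (W +>\<^bsub>V\<^esub> x) = (\<Union>y \<in> W +>\<^bsub>V\<^esub> x. W +>\<^bsub>V\<^esub> (c \<odot>\<^bsub>V\<^esub> y))"
      by (simp add: quot_space_def)
    ultimately show ?thesis by blast
  qed
  have rep: "\<exists>x \<in> carrier V. X = W +>\<^bsub>V\<^esub> x" if "X \<in> carrier ?Q" for X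
    using that by (auto simp: quot_space_def A_RCOSETS_def')
  have cl: "W +>\<^bsub>V\<^esub> x \<in> carrier ?Q" if "x \<in> carrier V" for x
    using that by (auto simp: quot_space_def A_RCOSETS_def')
  have ad: "(W +>\<^bsub>V\<^esub> x) \<oplus>\<^bsub>?Q\<^esub> (W +>\<^bsub>V\<^esub> y) = W +>\<^bsub>V\<^esub> (x \<oplus>\<^bsub>V\<^esub> y)"
    if "x \<in> carrier V" "y \<in> carrier V" for x y
    using that by (simp add: quot_space_def A.a_rcos_sum)
  have zr: "\<zero>\<^bsub>?Q\<^esub> = W +>\<^bsub>V\<^esub> \<zero>\<^bsub>V\<^esub>"
    using W.subset by (auto simp: quot_space_def a_r_coset_def')
  have ag: "abelian_group ?Q"
  proof (rule abelian_groupI)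
    fix X assume "X \<in> carrier ?Q"
    then obtain x where x: "x \<in> carrier V" "X = W +>\<^bsub>V\<^esub> x" using rep by blast
    show "\<exists>Y \<in> carrier ?Q. Y \<oplus>\<^bsub>?Q\<^esub> X = \<zero>\<^bsub>?Q\<^esub>"
      by (rule bexI[of _ "W +>\<^bsub>V\<^esub> (\<ominus>\<^bsub>V\<^esub> x)"])
         (use x in \<open>simp_all add: ad cl V.l_neg zr\<close>)
  qed (auto dest!: rep simp: ad cl zr V.add.m_ac)
  have "module_axioms K ?Q"
    by (rule module_axioms.intro)
      (auto dest!: rep simp: sm ad cl V.smult_l_distr V.smult_r_distr V.smult_assoc1)
  then show ?thesis
    by (intro vectorspace.intro Module.module.intro ag V.field_axioms V.R.is_cring)
qed


section \<open>Upper triangular matrices with the finest grading and the reflection involution\<close>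

text \<open>$\mathbb{Z}^r$ with $r = \lfloor m/2 \rfloor$, realised inside the finitely supported functions
  \<open>nat \<Rightarrow>\<^sub>0 int\<close> as those supported on $\{1,\dots,r\}$.\<close>

type_synonym zgrp = "nat \<Rightarrow>\<^sub>0 int"

definition Zr :: "nat \<Rightarrow> zgrp set" where
  "Zr m = {g. Poly_Mapping.keys g \<subseteq> {1..m div 2}}"

definition eb :: "nat \<Rightarrow> zgrp" where
  "eb i = Poly_Mapping.single i 1"

definition basis_elts :: "nat \<Rightarrow> zgrp set" where
  "basis_elts m = eb ` {1..m div 2}"

definition finest_tuple :: "nat \<Rightarrow> zgrp list" where
  "finest_tuple m = (let r = m div 2 in
     if even m
     then map eb [1..<Suc r] @ [0] @ map (\<lambda>i. eb r - eb i) (rev [1..<r])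
     else map eb [1..<Suc r] @ [0] @ map (\<lambda>i. - eb i) (rev [1..<Suc r]))"

text \<open>Matrix indices start at \<open>0\<close>.\<close>

definition UT_comp :: "nat \<Rightarrow> zgrp \<Rightarrow> 'f::field mat set" where
  "UT_comp m g = {A \<in> carrier_mat m m. upper_triangular A \<and>
     (\<forall>i<m. \<forall>j<m. A $$ (i, j) \<noteq> 0 \<longrightarrow> finest_tuple m ! i - finest_tuple m ! j = g)}"

definition dimU :: "'f::field itself \<Rightarrow> nat \<Rightarrow> zgrp \<Rightarrow> nat" where
  "dimU ty m g = vectorspace.dim (class_ring :: 'f ring)
     (module_mat TYPE('f) m m \<lparr>carrier := UT_comp m g\<rparr>)"

definition reflection :: "nat \<Rightarrow> 'f::field mat \<Rightarrow> 'f mat" where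
  "reflection m A = mat m m (\<lambda>(i, j). A $$ (m - 1 - j, m - 1 - i))"

definition eval_indet :: "nat \<Rightarrow> (nat \<Rightarrow> zgrp \<Rightarrow> 'f::field mat) \<Rightarrow> zgrp indet \<Rightarrow> 'f mat" where
  "eval_indet m a l = (if starred l then reflection m (a (vind l) (vdeg l)) else a (vind l) (vdeg l))"

definition eval_mono :: "nat \<Rightarrow> (nat \<Rightarrow> zgrp \<Rightarrow> 'f::field mat) \<Rightarrow> zgrp indet fmon \<Rightarrow> 'f mat" where
  "eval_mono m a w = foldr (\<lambda>l B. eval_indet m a l * B) (letters w) (1\<^sub>m m)"

definition eval_poly :: "nat \<Rightarrow> (nat \<Rightarrow> zgrp \<Rightarrow> 'f::field mat) \<Rightarrow> (zgrp, 'f) fpoly \<Rightarrow> 'f mat" where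
  "eval_poly m a p = (\<Oplus>\<^bsub>module_mat TYPE('f) m m\<^esub> w \<in> Poly_Mapping.keys p.
     Poly_Mapping.lookup p w \<cdot>\<^sub>m eval_mono m a w)"

definition UT_identities :: "nat \<Rightarrow> (zgrp, 'f::field) fpoly set" where
  "UT_identities m = {p \<in> carrier (free_alg (Zr m)).
     \<forall>a. (\<forall>i. \<forall>g \<in> Zr m. a i g \<in> UT_comp m g) \<longrightarrow> eval_poly m a p = 0\<^sub>m m m}"


section \<open>The proposed basis of identities\<close>

definition xvar :: "nat \<Rightarrow> 'g \<Rightarrow> ('g, 'f::field) fpoly" where
  "xvar i g = fmonom [Indet i g False]"

definition xstar :: "nat \<Rightarrow> 'g \<Rightarrow> ('g, 'f::field) fpoly" where
  "xstar i g = fmonom [Indet i g True]"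

definition gens_a :: "(zgrp, 'f::field) fpoly set" where
  "gens_a = {xvar 1 0 * xvar 2 0 - xvar 2 0 * xvar 1 0}"

definition gens_b :: "nat \<Rightarrow> (zgrp, 'f::field) fpoly set" where
  "gens_b m = {xstar 1 g - xvar 1 g | g. g \<in> Zr m \<and> dimU TYPE('f) m g = 1}"

definition gens_c :: "nat \<Rightarrow> (zgrp, 'f::field) fpoly set" where
  "gens_c m = {xvar 1 g * xvar 2 0 * xvar 3 h - xvar 1 g * xstar 2 0 * xvar 3 h | g h.
     g \<in> basis_elts m \<and> h \<in> basis_elts m}"

definition gens_d :: "nat \<Rightarrow> (zgrp, 'f::field) fpoly set" where
  "gens_d m = {xvar 1 0 * xvar 2 g * xvar 3 0 - xstar 1 0 * xvar 2 g * xvar 3 0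
     - xvar 1 0 * xvar 2 g * xstar 3 0 + xstar 1 0 * xvar 2 g * xstar 3 0 | g. g \<in> basis_elts m}"

definition gens_e :: "nat \<Rightarrow> (zgrp, 'f::field) fpoly set" where
  "gens_e m = {xvar 1 0 * xvar 2 (eb i) * xvar 3 (eb j - eb i) - xstar 1 0 * xvar 2 (eb i) * xvar 3 (eb j - eb i) | i j.
     i \<in> {2..m div 2} \<and> j \<in> {1..<i}}"

definition gens_f :: "nat \<Rightarrow> (zgrp, 'f::field) fpoly set" where
  "gens_f m = {fmonom (map (\<lambda>i. Indet i (g i) False) [1..<Suc n]) | n g.
     n \<le> 3 \<and> (\<forall>i \<in> {1..n}. g i \<in> Zr m \<and> g i \<noteq> 0)} \<inter> UT_identities m"

definition gens :: "nat \<Rightarrow> (zgrp, 'f::field) fpoly set" where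
  "gens m = gens_a \<union> gens_b m \<union> (if odd m then gens_c m \<union> gens_d m \<union> gens_e m else {}) \<union> gens_f m"


section \<open>Good monomials\<close>

definition unstarred :: "'g indet list \<Rightarrow> bool" where
  "unstarred ls \<longleftrightarrow> (\<forall>l \<in> set ls. \<not> starred l)"

text \<open>In \<open>good_mono\<close> the word is $M_1 y_1 M_2 y_2 \cdots M_k y_k M_{k+1}$, where
  $y_i = x_{u_i,g_i}^{\delta_i}$ are exactly the letters of nonzero degree. This
  factorisation of the word is unique.\<close>

definition good_mono :: "'f::field itself \<Rightarrow> nat \<Rightarrow> zgrp indet list \<Rightarrow> bool" where
  "good_mono ty m ls \<longleftrightarrow>
     (fmonom ls :: (zgrp, 'f) fpoly) \<notin> UT_identities m \<and>
     (\<exists>k (M :: nat \<Rightarrow> zgrp indet list) (y :: nat \<Rightarrow> zgrp indet).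
       ls = concat (map (\<lambda>i. M i @ [y i]) [1..<Suc k]) @ M (Suc k) \<and>
       (\<forall>i \<in> {1..k}. vdeg (y i) \<noteq> 0) \<and>
       (\<forall>i \<in> {1..Suc k}. \<forall>l \<in> set (M i). vdeg l = 0) \<and>
       (\<forall>i \<in> {1..Suc k}. sorted_wrt (<) (map vind (M i))) \<and>
       (\<forall>i \<in> {1..k}. dimU TYPE('f) m (vdeg (y i)) = 1 \<longrightarrow> \<not> starred (y i) \<and> M i = []) \<and>
       (\<forall>i \<in> {1..k}. \<forall>j \<in> {1..k}. i < j \<and> dimU TYPE('f) m (\<Sum>t = i..j. vdeg (y t)) = 1 \<longrightarrow>
          M i = [] \<and> vind (y i) < vind (y j)) \<and>
       (odd m \<longrightarrow> (\<forall>i \<in> {1..<k}.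
          vdeg (y i) \<in> basis_elts m \<and> vdeg (y (Suc i)) \<in> basis_elts m \<longrightarrow> unstarred (M (Suc i)))) \<and>
       (odd m \<and> 2 \<le> k \<and> vdeg (y 1) \<in> basis_elts m \<and> vdeg (y 2) \<notin> basis_elts m \<longrightarrow>
          unstarred (M 1)) \<and>
       (odd m \<and> 2 \<le> k \<and> vdeg (y (k - 1)) \<notin> basis_elts m \<and> vdeg (y k) \<in> basis_elts m \<longrightarrow>
          unstarred (M (Suc k))) \<and>
       (odd m \<and> k = 1 \<and> vdeg (y 1) \<in> basis_elts m \<longrightarrow> unstarred (M 1) \<or> unstarred (M 2)))"

definition good_monos :: "nat \<Rightarrow> nat \<Rightarrow> (zgrp, 'f::field) fpoly set" where
  "good_monos m n = fmonom ` {ls \<in> multilinear_monos (Zr m) n. good_mono TYPE('f) m ls}"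

definition multilinear_identities :: "nat \<Rightarrow> nat \<Rightarrow> (zgrp, 'f::field) fpoly set" where
  "multilinear_identities m n = multilinear_space (Zr m) n \<inter> UT_identities m"

definition P_space :: "nat \<Rightarrow> nat \<Rightarrow> ('f::field, (zgrp, 'f) fpoly) module" where
  "P_space m n = free_alg (Zr m) \<lparr>carrier := multilinear_space (Zr m) n\<rparr>"

definition P_quot :: "nat \<Rightarrow> nat \<Rightarrow> ('f::field, (zgrp, 'f) fpoly set) module" where
  "P_quot m n = quot_space (P_space m n) (multilinear_identities m n)"

definition quot_map :: "nat \<Rightarrow> nat \<Rightarrow> (zgrp, 'f::field) fpoly \<Rightarrow> (zgrp, 'f) fpoly set" where
  "quot_map m n p = multilinear_identities m n +>\<^bsub>P_space m n\<^esub> p"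

end

theory Submission
  imports Defs
begin

text \<open>A matrix unit of nonzero degree shares its degree with at most its mirror image. A word is
  therefore evaluated along paths in the index set, each path contributing one commutative
  monomial in the entries of generic matrices; a word with at least two letters of nonzero degree has
  at most one path. In characteristic \<open>0\<close> distinct monomials are linearly independent, so it remains
  to show that words with the same monomial are congruent modulo the proposed basis. By induction
  on the length, the first letter of one word is moved to the front of the other: reversing
  segments which run from an index to its mirror image uses (a) and (b), and stars at the center are
  removed by (c), (d) and (e). The good monomials are the lexicographically minimal representatives of
  the classes thus obtained.\<close>

section \<open>The degrees of the matrix units\<close>

text \<open>One elimination argument serves both claims. Suppose that among given words those
  without a path lie in a subspace \<open>I\<close> of the identities and those with a common path
  monomial are congruent modulo \<open>I\<close>; then every identity supported on these words lies
  in \<open>I\<close>. With \<open>I\<close> a T-ideal containing the generators this yields the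
  basis; for good words and \<open>I = {0}\<close>, where congruence is equality, it yields linear
  independence. The conditions match the relations: (I) belongs to (a), (II) and (III) to (b), (IV)
  to (c), (V) and (VI) to (e) and its reverse, (VII) to (d). The obstacle is a word with a single
  letter of nonzero degree, of degree e_i for odd m: the center is an end of each of its two paths,
  and each path misses the stars on that side, so neither monomial fixes the word modulo identities.
  Relation (d) clears the stars of one side; the words with stars left on the other side must then
  be eliminated before the unstarred ones. For m = 1 all stars are invisible, so different good
  words can have the same image, and unstarred representatives are singled out.\<close>

text \<open>Matrix indices are \<open>0, \<dots>, m - 1\<close>, and the reflection involution maps the position
  \<open>(a, c)\<close> to \<open>(mirror m c, mirror m a)\<close>; the center is the fixed point of \<open>mirror m\<close>.\<close>

definition mirror :: "nat \<Rightarrow> nat \<Rightarrow> nat" where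
  "mirror m a = m - 1 - a"

definition vt :: "nat \<Rightarrow> nat \<Rightarrow> zgrp" where
  "vt m p = finest_tuple m ! p"

lemma mirror_mirror [simp]: "a < m \<Longrightarrow> mirror m (mirror m a) = a"
  by (simp add: mirror_def)

lemma mirror_less [simp]: "a < m \<Longrightarrow> mirror m a < m"
  by (simp add: mirror_def)

lemma mirror_mono: "a \<le> c \<Longrightarrow> mirror m c \<le> mirror m a"
  by (simp add: mirror_def)

lemma mirror_inj: "a < m \<Longrightarrow> c < m \<Longrightarrow> mirror m a = mirror m c \<longleftrightarrow> a = c"
  by (auto simp: mirror_def)

text \<open>For even m the middle entry 0 is e_r - e_r and falls under the formula for the second
  half; only for odd m is it a case of its own.\<close>

lemma vt_eq:
  assumes "p < m"
  shows "vt m p = (if p < m div 2 then eb (Suc p) else if odd m \<and> p = m div 2 then 0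
     else (if even m then eb (m div 2) else 0) - eb (m - p))"
proof (cases "p < m div 2")
  case True
  then show ?thesis
    by (auto simp: vt_def finest_tuple_def Let_def nth_append simp del: upt_Suc)
next
  case False
  then show ?thesis
    using assms
    by (cases "even m"; cases "p = m div 2")
      (auto simp: vt_def finest_tuple_def Let_def nth_append rev_nth simp del: upt_Suc
        elim!: evenE oddE intro!: arg_cong[of _ _ eb])
qed

text \<open>Up to an additive constant, \<open>\<psi> m k\<close> is \<open>1\<close> on the \<open>k\<close>-th entry of the tuple, \<open>- 1\<close> on its mirror
  image and \<open>0\<close> on all other entries. So a sum of two entries determines them, unless they are
  mirror images of each other.\<close>

definition \<psi> :: "nat \<Rightarrow> nat \<Rightarrow> zgrp \<Rightarrow> int" where
  "\<psi> m k g = (if even m \<and> k = m div 2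
     then 2 * Poly_Mapping.lookup g k + (\<Sum>i = 1..<k. Poly_Mapping.lookup g i)
     else Poly_Mapping.lookup g k)"

lemma \<psi>_add: "\<psi> m k (g + h) = \<psi> m k g + \<psi> m k h"
  by (simp add: \<psi>_def lookup_add sum.distrib)

lemma \<psi>_diff: "\<psi> m k (g - h) = \<psi> m k g - \<psi> m k h"
  by (simp add: \<psi>_def lookup_minus sum_subtractf)

lemma \<psi>_eb: "1 \<le> k \<Longrightarrow> 1 \<le> i \<Longrightarrow> i \<le> m div 2 \<Longrightarrow> k \<le> m div 2 \<Longrightarrow>
  \<psi> m k (eb i) = of_bool (i = k) + of_bool (even m \<and> k = m div 2)"
  by (auto simp: \<psi>_def eb_def lookup_single when_def)

lemma \<psi>_zero: "\<psi> m k 0 = 0"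
  by (simp add: \<psi>_def)

lemma \<psi>_minus: "\<psi> m k (- g) = - \<psi> m k g"
  using \<psi>_diff[of m k 0 g] by (simp add: \<psi>_zero)

lemma \<psi>_vt:
  assumes "p < m" "1 \<le> k" "k \<le> m div 2"
  shows "\<psi> m k (vt m p) =
    of_bool (Suc p = k) - of_bool (m - p = k) + of_bool (even m \<and> k = m div 2)"
proof -
  consider "p < m div 2" | "odd m" "p = m div 2" | "even m" "m div 2 \<le> p" | "odd m" "m div 2 < p"
    by linarith
  then show ?thesis
  proof cases
    case 1
    then have "m - p \<noteq> k" using assms by linarith
    with 1 assms show ?thesis by (simp add: vt_eq \<psi>_eb)
  next
    case 2
    then have "m - p \<noteq> k" "Suc p \<noteq> k" using assms by (auto elim!: oddE)
    with 2 assms show ?thesis by (simp add: vt_eq \<psi>_zero)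
  next
    case 3
    then have "Suc p \<noteq> k" "1 \<le> m - p" "m - p \<le> m div 2" "1 \<le> m div 2" using assms by (auto elim!: evenE)
    with 3 assms show ?thesis by (simp add: vt_eq \<psi>_eb \<psi>_diff)
  next
    case 4
    then have "Suc p \<noteq> k" "1 \<le> m - p" "m - p \<le> m div 2" "1 \<le> m div 2" using assms by (auto elim!: oddE)
    with 4 assms show ?thesis by (auto simp add: vt_eq \<psi>_eb \<psi>_minus)
  qed
qed

text \<open>The sum does not depend on p, which is why a matrix unit and its mirror image have the
  same degree.\<close>

lemma vt_mirror:
  assumes "p < m"
  shows "vt m p + vt m (mirror m p) = (if even m then eb (m div 2) else 0)"
proof -
  have *: "vt m p + vt m (mirror m p) = (if even m then eb (m div 2) else 0)" if "p < m div 2" for p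
  proof -
    have "m - mirror m p = Suc p" "\<not> mirror m p < m div 2" "odd m \<Longrightarrow> mirror m p \<noteq> m div 2" "mirror m p < m"
      using that by (auto simp: mirror_def elim!: oddE)
    then show ?thesis using that by (simp add: vt_eq)
  qed
  consider "p < m div 2" | "mirror m p < m div 2" | "odd m" "p = m div 2" "mirror m p = m div 2"
  proof -
    have "p < m div 2 \<or> m - 1 - p < m div 2 \<or> odd m \<and> p = m div 2 \<and> m - 1 - p = m div 2"
      using assms by presburger
    then show ?thesis using that by (auto simp: mirror_def)
  qed
  then show ?thesis
  proof cases
    case 2
    then show ?thesis using *[OF 2] assms by (simp add: add.commute)
  qed (use assms * in \<open>auto simp: vt_eq\<close>)
qed

text \<open>A degree is a difference of two entries, hence by \<open>vt_mirror\<close> a sum of two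
  entries up to a constant, so this controls the positions of a given degree. Mirror images x and y
  are excluded because their sum is the same for every x; they stand for the diagonal
  positions.\<close>

lemma vt_sum_eq:
  assumes lt: "x < m" "y < m" "x' < m" "y' < m" and ne: "y \<noteq> mirror m x"
    and eq: "vt m x + vt m y = vt m x' + vt m y'"
  shows "x' = x \<and> y' = y \<or> x' = y \<and> y' = x"
proof -
  \<comment> \<open>The values of \<open>\<psi>\<close> on the tuple without the additive constant,
    which cancels from an equation between sums of two entries.\<close>
  define D :: "nat \<Rightarrow> nat \<Rightarrow> int" where "D k p = of_bool (Suc p = k) - of_bool (m - p = k)" for k p
  \<comment> \<open>For odd m the bound also admits the index of the center, where \<open>D\<close>
    vanishes on all positions, so that below every p < m can be treated alike.\<close>
  have *: "D k x + D k y = D k x' + D k y'" if "1 \<le> k" "k \<le> (m + 1) div 2" for k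
  proof (cases "k \<le> m div 2")
    case True
    then show ?thesis using arg_cong[OF eq, of "\<psi> m k"] lt that by (simp add: \<psi>_add \<psi>_vt D_def)
  next
    case False
    then have "odd m" "k = Suc (m div 2)" using that by presburger+
    then have "D k p = 0" if "p < m" for p using that by (auto simp: D_def elim!: oddE)
    then show ?thesis using lt by simp
  qed
  \<comment> \<open>Up to sign this is \<open>D\<close> at the smaller of the 1-based indices of p
    and of its mirror image.\<close>
  define J :: "nat \<Rightarrow> nat \<Rightarrow> int" where "J p q = of_bool (q = p) - of_bool (q = mirror m p)" for p q
  have DJ: "D (min (Suc p) (m - p)) q = (if Suc p \<le> m - p then 1 else - 1) * J p q" if "p < m" "q < m" for p q
    using that by (auto simp: D_def J_def mirror_def min_def)
  have J: "J p x + J p y = J p x' + J p y'" if "p < m" for p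
  proof -
    have "D (min (Suc p) (m - p)) x + D (min (Suc p) (m - p)) y = D (min (Suc p) (m - p)) x' + D (min (Suc p) (m - p)) y'"
      by (rule *) (use that in auto)
    then show ?thesis unfolding DJ[OF that lt(1)] DJ[OF that lt(2)] DJ[OF that lt(3)] DJ[OF that lt(4)]
      by (auto split: if_splits)
  qed
  have J_inj: "q = q'" if "\<And>p. p < m \<Longrightarrow> J p q = J p q'" "q < m" "q' < m" for q q'
  proof (rule ccontr)
    assume "q \<noteq> q'"
    then have "q = mirror m q" "q' = mirror m q'"
      using that(1)[OF that(2)] that(1)[OF that(3)] by (auto simp: J_def of_bool_def split: if_splits)
    with \<open>q \<noteq> q'\<close> that(2,3) show False by (auto simp: mirror_def)
  qed
  \<comment> \<open>A positive sum needs a positive summand, and \<open>J z\<close> is positive at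
    most at z.\<close>
  have one: "x' = z \<or> y' = z" if "1 \<le> J z x + J z y" "z < m" for z
    using J[OF that(2)] that(1) by (auto simp: J_def of_bool_def split: if_splits)
  \<comment> \<open>If x is the center then \<open>J x\<close> vanishes, but then y is not the
    center and can be located instead.\<close>
  have "x' = x \<or> y' = x \<or> x' = y \<or> y' = y"
  proof (cases "mirror m x = x")
    case True
    then have "1 \<le> J y x + J y y" using ne lt by (auto simp: J_def mirror_def)
    from one[OF this lt(2)] show ?thesis by blast
  next
    case False
    then have "1 \<le> J x x + J x y" using ne lt by (auto simp: J_def)
    from one[OF this lt(1)] show ?thesis by blast
  qed
  then show ?thesis
  proof (elim disjE)
    assume *: "x' = x"
    have "y = y'"
      by (rule J_inj) (use J * lt in auto)
    with * show ?thesis by simp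
  next
    assume *: "y' = x"
    have "y = x'"
      by (rule J_inj) (use J * lt in auto)
    with * show ?thesis by simp
  next
    assume *: "x' = y"
    have "x = y'"
      by (rule J_inj) (use J * lt in auto)
    with * show ?thesis by simp
  next
    assume *: "y' = y"
    have "x = x'"
      by (rule J_inj) (use J * lt in auto)
    with * show ?thesis by simp
  qed
qed

section \<open>Positions of matrix units of a given degree, seen as edges between indices\<close>

definition edge :: "nat \<Rightarrow> nat \<Rightarrow> nat \<Rightarrow> zgrp \<Rightarrow> bool" where
  "edge m a c g \<longleftrightarrow> a \<le> c \<and> c < m \<and> g = vt m a - vt m c"

lemma vt_mirror': "p < m \<Longrightarrow> vt m (mirror m p) = (if even m then eb (m div 2) else 0) - vt m p"
  by (simp only: vt_mirror[symmetric] add_diff_cancel_left')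

lemma vt_mirror_diff: "a < m \<Longrightarrow> c < m \<Longrightarrow> vt m (mirror m c) - vt m (mirror m a) = vt m a - vt m c"
  by (simp add: vt_mirror' del: diff_0)

lemma edge_mirror: "edge m a c g \<Longrightarrow> edge m (mirror m c) (mirror m a) g"
  using vt_mirror_diff[of a m c] by (auto simp: edge_def mirror_mono)

text \<open>Replacing each subtracted entry by a constant minus the entry at the mirror image turns
  equal differences into equal sums, to which \<open>vt_sum_eq\<close> applies; a < c keeps the two
  summands from being mirror images.\<close>

lemma edge_fold:
  assumes "edge m a c g" "edge m a' c' g" "a < c"
  shows "a' = a \<and> c' = c \<or> a' = mirror m c \<and> c' = mirror m a"
proof -
  have lt: "a < m" "c < m" "a' < m" "c' < m" and eq: "vt m a - vt m c = vt m a' - vt m c'"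
    using assms by (auto simp: edge_def)
  have "vt m a + vt m (mirror m c) = vt m a' + vt m (mirror m c')"
    unfolding vt_mirror'[OF lt(2)] vt_mirror'[OF lt(4)] using eq by (simp add: algebra_simps)
  moreover have "mirror m c \<noteq> mirror m a" using lt \<open>a < c\<close> by (simp add: mirror_inj)
  ultimately consider "a' = a" "mirror m c' = mirror m c" | "a' = mirror m c" "mirror m c' = a"
    using vt_sum_eq[of a m "mirror m c" a' "mirror m c'"] lt by auto
  then show ?thesis
  proof cases
    case 1
    then show ?thesis using lt by (simp add: mirror_inj)
  next
    case 2
    then show ?thesis using mirror_mirror[OF lt(4)] by simp
  qed
qed

lemma vt_inj: "a < m \<Longrightarrow> c < m \<Longrightarrow> vt m a = vt m c \<longleftrightarrow> a = c"
proof (rule iffI)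
  assume lt: "a < m" "c < m" and eq: "vt m a = vt m c"
  show "a = c"
  proof (rule ccontr)
    assume "a \<noteq> c"
    then consider "a < c" | "c < a" by linarith
    then show False
    proof cases
      case 1
      with lt eq have "edge m a c 0" "edge m a a 0" by (auto simp: edge_def)
      from edge_fold[OF this 1] \<open>a < c\<close> lt mirror_inj[of a m c] show False by auto
    next
      case 2
      with lt eq have "edge m c a 0" "edge m c c 0" by (auto simp: edge_def)
      from edge_fold[OF this 2] \<open>c < a\<close> lt mirror_inj[of a m c] show False by auto
    qed
  qed
qed simp

lemma edge_less: "edge m a c g \<Longrightarrow> a < m \<and> c < m \<and> a \<le> c"
  by (auto simp: edge_def)

lemma edge_zero: "edge m a c 0 \<longleftrightarrow> a = c \<and> a < m"
  by (auto simp: edge_def vt_inj)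

lemma edge_refl: "edge m a a g \<longleftrightarrow> g = 0 \<and> a < m"
  by (auto simp: edge_def)

lemma edge_less_iff: "edge m a c g \<Longrightarrow> a < c \<longleftrightarrow> g \<noteq> 0"
  by (auto simp: edge_def vt_inj)

lemma edge_det: "edge m a c g \<Longrightarrow> edge m a c' g \<Longrightarrow> c = c'"
  by (auto simp: edge_def vt_inj)

lemma edge_trans: "edge m a c g \<Longrightarrow> edge m c d h \<Longrightarrow> edge m a d (g + h)"
  by (auto simp: edge_def)

text \<open>Were the first edge replaced by a different mirror image, the second would start at
  \<open>mirror m a\<close>. If that is c, the first edge equals its mirror image; if it is
  \<open>mirror m d\<close>, then a = d, against a < c < d.\<close>

lemma edge_unique2:
  assumes "edge m a c g" "edge m c d h" "edge m a' c' g" "edge m c' d' h" "g \<noteq> 0" "h \<noteq> 0"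
  shows "a' = a \<and> c' = c \<and> d' = d"
proof -
  have lt: "a < c" "c < d" "a < m" "c < m" "d < m"
    using assms edge_less_iff[OF assms(1)] edge_less_iff[OF assms(2)] edge_less[OF assms(2)] by auto
  have "a' = a"
  proof (rule ccontr)
    assume "a' \<noteq> a"
    then have 1: "a' = mirror m c" "c' = mirror m a" using edge_fold[OF assms(1,3) lt(1)] by auto
    consider "c' = c" | "c' = mirror m d" using edge_fold[OF assms(2,4) lt(2)] by auto
    then show False
    proof cases
      case 1
      then show False using \<open>a' = mirror m c\<close> \<open>c' = mirror m a\<close> \<open>a' \<noteq> a\<close> lt by auto
    next
      case 2
      then show False using \<open>c' = mirror m a\<close> mirror_inj[of a m d] lt by auto
    qed
  qed
  then show ?thesis using assms edge_det by metis
qed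


section \<open>Words as paths in the index set\<close>

definition wdeg :: "zgrp indet list \<Rightarrow> zgrp" where
  "wdeg w = sum_list (map vdeg w)"

definition nz :: "zgrp indet list \<Rightarrow> nat" where
  "nz w = length (filter (\<lambda>l. vdeg l \<noteq> 0) w)"

definition wstar :: "zgrp indet list \<Rightarrow> zgrp indet list" where
  "wstar w = rev (map indet_star w)"

definition inG :: "nat \<Rightarrow> zgrp indet list \<Rightarrow> bool" where
  "inG m w \<longleftrightarrow> (\<forall>l \<in> set w. vdeg l \<in> Zr m)"

lemma indet_star_simps [simp]:
  "vind (indet_star l) = vind l" "vdeg (indet_star l) = vdeg l" "starred (indet_star l) \<longleftrightarrow> \<not> starred l"
  "indet_star (indet_star l) = l"
  by (simp_all add: indet_star_def)

lemma wdeg_simps [simp]: "wdeg [] = 0" "wdeg (l # w) = vdeg l + wdeg w" "wdeg (v @ w) = wdeg v + wdeg w"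
  by (simp_all add: wdeg_def)

lemma nz_simps [simp]: "nz [] = 0" "nz (l # w) = of_bool (vdeg l \<noteq> 0) + nz w" "nz (v @ w) = nz v + nz w"
  by (simp_all add: nz_def)

lemma inG_simps [simp]: "inG m []" "inG m (l # w) \<longleftrightarrow> vdeg l \<in> Zr m \<and> inG m w"
  "inG m (v @ w) \<longleftrightarrow> inG m v \<and> inG m w"
  by (auto simp: inG_def)

lemma wstar_simps [simp]: "wstar [] = []" "wstar (l # w) = wstar w @ [indet_star l]"
  "wstar (v @ w) = wstar w @ wstar v" "wstar (wstar w) = w" "length (wstar w) = length w"
  by (simp_all add: wstar_def rev_map o_def)

lemma wdeg_wstar [simp]: "wdeg (wstar w) = wdeg w"
  by (induction w) (simp_all add: add.commute)

lemma nz_wstar [simp]: "nz (wstar w) = nz w"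
  by (induction w) simp_all

lemma inG_wstar [simp]: "inG m (wstar w) \<longleftrightarrow> inG m w"
  by (induction w) auto

lemma nz_0_iff: "nz w = 0 \<longleftrightarrow> (\<forall>l \<in> set w. vdeg l = 0)"
  by (induction w) auto

lemma wdeg_nz_0: "nz w = 0 \<Longrightarrow> wdeg w = 0"
  by (induction w) auto

lemma split_first_nz: "nz w \<noteq> 0 \<Longrightarrow> \<exists>u l v. w = u @ l # v \<and> nz u = 0 \<and> vdeg l \<noteq> 0"
proof (induction w)
  case (Cons x w)
  show ?case
  proof (cases "vdeg x = 0")
    case True
    with Cons obtain u l v where "w = u @ l # v \<and> nz u = 0 \<and> vdeg l \<noteq> 0" by auto
    with True show ?thesis by (intro exI[of _ "x # u"]) auto
  qed (intro exI[of _ "[]"], auto)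
qed simp

lemma split_last_nz: "nz w \<noteq> 0 \<Longrightarrow> \<exists>u l v. w = u @ l # v \<and> nz v = 0 \<and> vdeg l \<noteq> 0"
proof (induction w)
  case (Cons x w)
  show ?case
  proof (cases "nz w = 0")
    case True
    with Cons show ?thesis by (intro exI[of _ "[]"]) (auto split: if_splits)
  next
    case False
    with Cons obtain u l v where "w = u @ l # v \<and> nz v = 0 \<and> vdeg l \<noteq> 0" by auto
    then show ?thesis by (intro exI[of _ "x # u"]) auto
  qed
qed simp

lemma Zr_closed: "0 \<in> Zr m" "g \<in> Zr m \<Longrightarrow> h \<in> Zr m \<Longrightarrow> g + h \<in> Zr m"
  "g \<in> Zr m \<Longrightarrow> h \<in> Zr m \<Longrightarrow> g - h \<in> Zr m" "1 \<le> i \<Longrightarrow> i \<le> m div 2 \<Longrightarrow> eb i \<in> Zr m"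
  using keys_add[of g h] keys_diff[of g h] by (auto simp: Zr_def eb_def)

lemma vt_Zr:
  assumes "p < m"
  shows "vt m p \<in> Zr m"
proof -
  have "- eb i \<in> Zr m" if "1 \<le> i" "i \<le> m div 2" for i
    using Zr_closed(3)[OF Zr_closed(1) Zr_closed(4)[OF that]] by simp
  then show ?thesis
    using vt_eq[OF assms] assms by (auto intro!: Zr_closed(1,3,4))
qed

lemma wdeg_Zr: "inG m w \<Longrightarrow> wdeg w \<in> Zr m"
  by (induction w) (auto intro: Zr_closed)

text \<open>\<open>(i, p, q)\<close> stands for the entry \<open>(p, q)\<close> of the generic matrix substituted for the indeterminate
  with index \<open>i\<close>; its degree can be recovered from \<open>(p, q)\<close>.\<close>

definition coord :: "nat \<Rightarrow> zgrp indet \<Rightarrow> nat \<Rightarrow> nat \<Rightarrow> nat \<times> nat \<times> nat" where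
  "coord m l a c = (vind l, if starred l then (mirror m c, mirror m a) else (a, c))"

text \<open>In \<open>path u m a w b X\<close> the multiset \<open>X\<close> is the commutative monomial which a word \<open>w\<close> contributes
  to the entry \<open>(a, b)\<close>. With \<open>u\<close> set, letters of degree \<open>0\<close> read at the center, where stars
  are invisible, must be unstarred.\<close>

primrec path :: "bool \<Rightarrow> nat \<Rightarrow> nat \<Rightarrow> zgrp indet list \<Rightarrow> nat \<Rightarrow> (nat \<times> nat \<times> nat) multiset \<Rightarrow> bool" where
  "path u m a [] b X \<longleftrightarrow> a = b \<and> a < m \<and> X = {#}"
| "path u m a (l # w) b X \<longleftrightarrow> (\<exists>c Y. edge m a c (vdeg l) \<and> path u m c w b Y \<and> X = add_mset (coord m l a c) Y \<and>
     (u \<and> vdeg l = 0 \<and> mirror m a = a \<longrightarrow> \<not> starred l))"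

lemma path_edge: "path u m a w b X \<Longrightarrow> edge m a b (wdeg w)"
  by (induction w arbitrary: a X) (auto simp: edge_refl intro: edge_trans)

lemma path_less: "path u m a w b X \<Longrightarrow> a < m \<and> b < m \<and> a \<le> b"
  using path_edge edge_less by blast

lemma path_append: "path u m a (v @ w) b X \<longleftrightarrow>
    (\<exists>c Y Z. path u m a v c Y \<and> path u m c w b Z \<and> X = Y + Z)"
proof (induction v arbitrary: a X)
  case Nil
  then show ?case using path_less by fastforce
next
  case (Cons l v)
  show ?case
  proof
    assume "path u m a ((l # v) @ w) b X"
    then obtain c Y where *: "edge m a c (vdeg l)" "path u m c (v @ w) b Y" "X = add_mset (coord m l a c) Y"
      "u \<and> vdeg l = 0 \<and> mirror m a = a \<longrightarrow> \<not> starred l" by auto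
    from *(2) obtain d Y1 Z where **: "path u m c v d Y1" "path u m d w b Z" "Y = Y1 + Z"
      unfolding Cons.IH by blast
    have "path u m a (l # v) d (add_mset (coord m l a c) Y1)" using * ** by auto
    moreover have "X = add_mset (coord m l a c) Y1 + Z" using * ** by simp
    ultimately show "\<exists>c Y Z. path u m a (l # v) c Y \<and> path u m c w b Z \<and> X = Y + Z" using **(2) by blast
  next
    assume "\<exists>c Y Z. path u m a (l # v) c Y \<and> path u m c w b Z \<and> X = Y + Z"
    then obtain d Y Z where *: "path u m a (l # v) d Y" "path u m d w b Z" "X = Y + Z" by blast
    then obtain c Y1 where **: "edge m a c (vdeg l)" "path u m c v d Y1" "Y = add_mset (coord m l a c) Y1"
      "u \<and> vdeg l = 0 \<and> mirror m a = a \<longrightarrow> \<not> starred l" by auto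
    have "path u m c (v @ w) b (Y1 + Z)" unfolding Cons.IH using ** * by blast
    with ** * show "path u m a ((l # v) @ w) b X" by auto
  qed
qed

lemma path_weaken: "path u m a w b X \<Longrightarrow> path False m a w b X"
  by (induction w arbitrary: a X) auto

lemma path_det: "path u m a w b X \<Longrightarrow> path u' m a w b' X' \<Longrightarrow> b' = b \<and> X' = X"
proof (induction w arbitrary: a X X')
  case (Cons l w)
  from Cons.prems obtain c Y c' Y' where *: "edge m a c (vdeg l)" "path u m c w b Y" "X = add_mset (coord m l a c) Y"
     "edge m a c' (vdeg l)" "path u' m c' w b' Y'" "X' = add_mset (coord m l a c') Y'" by auto
  then have "c' = c" using edge_det by blast
  with * Cons.IH[of c Y Y'] show ?case by simp
qed simp

lemma path_size: "path u m a w b X \<Longrightarrow> size X = length w"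
  by (induction w arbitrary: a X) auto

lemma coord_star: "a < m \<Longrightarrow> c < m \<Longrightarrow> coord m (indet_star l) (mirror m c) (mirror m a) = coord m l a c"
  by (simp add: coord_def)

text \<open>The mirrored path passes through the same entries of the generic matrices. The flag is
  dropped because the involution stars the unstarred letters read at the center.\<close>

lemma path_star: "path u m a w b X \<Longrightarrow> path False m (mirror m b) (wstar w) (mirror m a) X"
proof (induction w arbitrary: a X)
  case (Cons l w)
  then obtain c Y where *: "edge m a c (vdeg l)" "path u m c w b Y" "X = add_mset (coord m l a c) Y" by auto
  from Cons.IH[OF *(2)] have "path False m (mirror m b) (wstar w) (mirror m c) Y" .
  moreover have "path False m (mirror m c) [indet_star l] (mirror m a) {#coord m l a c#}"
    using edge_mirror[OF *(1)] edge_less[OF *(1)] by (auto simp: coord_star)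
  ultimately have "path False m (mirror m b) (wstar w @ [indet_star l]) (mirror m a) (Y + {#coord m l a c#})"
    unfolding path_append by blast
  then show ?case using *(3) by simp
qed auto

lemma path_inG: "path u m a w b X \<Longrightarrow> inG m w"
  by (induction w arbitrary: a X) (auto simp: edge_def intro!: Zr_closed vt_Zr dest: path_less)

lemma path_zero: "nz w = 0 \<Longrightarrow> path u m a w b X \<Longrightarrow> b = a"
  using path_edge[of u m a w b X] wdeg_nz_0[of w] by (auto simp: edge_zero)

lemma path_nz: "path u m a w b X \<Longrightarrow> a = b \<longleftrightarrow> nz w = 0"
proof
  assume "path u m a w b X" "a = b"
  then show "nz w = 0"
  proof (induction w arbitrary: a X)
    case (Cons l w)
    then obtain c Y where *: "edge m a c (vdeg l)" "path u m c w b Y" by auto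
    then have "a \<le> c" "c \<le> b" using edge_less path_less by blast+
    then have "c = a" using Cons by auto
    with * Cons show ?case by (auto simp: edge_refl)
  qed simp
qed (use path_zero in blast)

text \<open>Along a path the index never decreases, so nonzero degrees cannot cancel.\<close>

lemma path_wdeg_nz: "path u m a w b X \<Longrightarrow> wdeg w = 0 \<longleftrightarrow> nz w = 0"
  using path_edge[of u m a w b X] path_nz[of u m a w b X] by (auto simp: edge_refl edge_zero)

lemma path_zero_ex: "nz w = 0 \<Longrightarrow> a < m \<Longrightarrow> \<exists>X. path False m a w a X"
proof (induction w)
  case Nil
  then have "path False m a [] a {#}" by simp
  then show ?case by blast
next
  case (Cons l w)
  then obtain X where "path False m a w a X" by auto
  with Cons.prems have "path False m a (l # w) a (add_mset (coord m l a a) X)"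
    by (auto simp: edge_zero)
  then show ?case by blast
qed

text \<open>Cut after the first letter of nonzero degree: both parts have nonzero degree, act as two
  consecutive edges and fix the start by \<open>edge_unique2\<close>; the rest follows by
  determinism.\<close>

lemma path_unique2:
  assumes "path u m a w b X" "path u' m a' w b' X'" "2 \<le> nz w"
  shows "a' = a \<and> b' = b \<and> X' = X"
proof -
  obtain x l y where w: "w = x @ l # y" and l: "nz x = 0" "vdeg l \<noteq> 0"
    using split_first_nz[of w] assms(3) by auto
  then have w: "w = (x @ [l]) @ y" and nz: "nz (x @ [l]) \<noteq> 0" "nz y \<noteq> 0" using assms(3) by auto
  obtain c Y Z where 1: "path u m a (x @ [l]) c Y" "path u m c y b Z"
    using assms(1) unfolding w path_append by blast
  obtain c' Y' Z' where 2: "path u' m a' (x @ [l]) c' Y'" "path u' m c' y b' Z'"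
    using assms(2) unfolding w path_append by blast
  have "a' = a" using edge_unique2[OF path_edge[OF 1(1)] path_edge[OF 1(2)] path_edge[OF 2(1)] path_edge[OF 2(2)]]
      path_wdeg_nz[OF 1(1)] path_wdeg_nz[OF 1(2)] nz by blast
  then show ?thesis using path_det assms(1,2) by blast
qed

text \<open>Comparing two words with the same monomial begins here: an entry contributed by a letter
  of one word is traced back to some letter of the other.\<close>

lemma path_memE:
  assumes "path u m a w b X" "k \<in># X"
  obtains x l y c d Y Z where "w = x @ l # y" "k = coord m l c d" "path u m a x c Y" "edge m c d (vdeg l)"
    "path u m d y b Z" "X = add_mset k (Y + Z)" "u \<and> vdeg l = 0 \<and> mirror m c = c \<longrightarrow> \<not> starred l"
proof -
  have "\<exists>x l y c d Y Z. w = x @ l # y \<and> k = coord m l c d \<and> path u m a x c Y \<and> edge m c d (vdeg l) \<and>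
    path u m d y b Z \<and> X = add_mset k (Y + Z) \<and> (u \<and> vdeg l = 0 \<and> mirror m c = c \<longrightarrow> \<not> starred l)"
    using assms
  proof (induction w arbitrary: a X)
    case (Cons l w)
    then obtain c Y where *: "edge m a c (vdeg l)" "path u m c w b Y" "X = add_mset (coord m l a c) Y"
      "u \<and> vdeg l = 0 \<and> mirror m a = a \<longrightarrow> \<not> starred l" by auto
    show ?case
    proof (cases "k = coord m l a c")
      case True
      then show ?thesis
        using * edge_less[OF *(1)]
        by (intro exI[of _ "[]"] exI[of _ l] exI[of _ w] exI[of _ a] exI[of _ c] exI[of _ "{#}"] exI[of _ Y]) simp
    next
      case False
      with Cons.prems * have "k \<in># Y" by auto
      from Cons.IH[OF *(2) this] obtain x l' y c' d Y' Z where
        **: "w = x @ l' # y" "k = coord m l' c' d" "path u m c x c' Y'" "edge m c' d (vdeg l')"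
        "path u m d y b Z" "Y = add_mset k (Y' + Z)" "u \<and> vdeg l' = 0 \<and> mirror m c' = c' \<longrightarrow> \<not> starred l'" by blast
      have "path u m a (l # x) c' (add_mset (coord m l a c) Y')" using * ** by auto
      with ** * show ?thesis
        by (intro exI[of _ "l # x"] exI[of _ l'] exI[of _ y] exI[of _ c'] exI[of _ d]
            exI[of _ "add_mset (coord m l a c) Y'"] exI[of _ Z]) simp
    qed
  qed simp
  with that show thesis by blast
qed

lemma path_mem:
  assumes "path u m a (x @ l # y) b X" "path u' m a x c Y" "edge m c d (vdeg l)"
  shows "coord m l c d \<in># X"
proof -
  obtain c' Y' Z' where *: "path u m a x c' Y'" "path u m c' (l # y) b Z'" "X = Y' + Z'"
    using assms(1) unfolding path_append by blast
  then have "c' = c" using path_det assms(2) by blast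
  with * obtain d' W where "edge m c d' (vdeg l)" "Z' = add_mset (coord m l c d') W" by auto
  moreover from this assms(3) have "d' = d" using edge_det by blast
  ultimately show ?thesis using * by simp
qed

text \<open>The entry (i, p, q) can be read unstarred on the edge from p to q or starred on the
  mirrored edge. When q is the mirror image of p these edges coincide and the star is
  invisible.\<close>

lemma coord_eqD:
  assumes "coord m l a c = coord m l' a' c'" "edge m a c (vdeg l)" "edge m a' c' (vdeg l')"
  shows "vdeg l' = vdeg l" and "a' = a \<and> c' = c \<and> (l' = l \<or> l' = indet_star l \<and> c = mirror m a) \<or>
    a' = mirror m c \<and> c' = mirror m a \<and> l' = indet_star l"
proof -
  have lt: "a < m" "c < m" "a' < m" "c' < m" using edge_less assms(2,3) by blast+
  show d: "vdeg l' = vdeg l"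
    using assms lt vt_mirror_diff[of a m c] vt_mirror_diff[of a' m c'] by (auto simp: coord_def edge_def split: if_splits)
  have v: "vind l' = vind l" using assms(1) by (simp add: coord_def)
  have "l' = l \<or> l' = indet_star l"
    using d v by (cases l; cases l') (auto simp: indet_star_def)
  then show "a' = a \<and> c' = c \<and> (l' = l \<or> l' = indet_star l \<and> c = mirror m a) \<or>
    a' = mirror m c \<and> c' = mirror m a \<and> l' = indet_star l"
  proof
    assume "l' = l"
    then show ?thesis using assms(1) lt by (auto simp: coord_def mirror_inj split: if_splits)
  next
    assume "l' = indet_star l"
    then have "a' = mirror m c" "c' = mirror m a"
      using assms(1) lt mirror_mirror[OF lt(3)] mirror_mirror[OF lt(4)] by (auto simp: coord_def split: if_splits)
    then show ?thesis using \<open>l' = indet_star l\<close> by simp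
  qed
qed

text \<open>The premise supplies the paths on both sides of the central letter, because the reason
  that rules out its star depends on what is read before and after it.\<close>

lemma path_strengthen:
  assumes "path False m a w b X"
    and "\<And>x l y c Y. w = x @ l # y \<Longrightarrow> vdeg l = 0 \<Longrightarrow> mirror m c = c \<Longrightarrow> path False m a x c Y \<Longrightarrow>
      path False m c y b (X - add_mset (coord m l c c) Y) \<Longrightarrow> \<not> starred l"
  shows "path u m a w b X"
  using assms
proof (induction w arbitrary: a X)
  case (Cons l w)
  then obtain c Y where *: "edge m a c (vdeg l)" "path False m c w b Y" "X = add_mset (coord m l a c) Y" by auto
  have "path u m c w b Y"
  proof (rule Cons.IH[OF *(2)])
    fix x l' y d Z
    assume **: "w = x @ l' # y" "vdeg l' = 0" "mirror m d = d" "path False m c x d Z"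
      "path False m d y b (Y - add_mset (coord m l' d d) Z)"
    show "\<not> starred l'"
      by (rule Cons.prems(2)[of "l # x" _ y d "add_mset (coord m l a c) Z"]) (use * ** in \<open>auto simp: add_mset_commute\<close>)
  qed
  moreover have "\<not> starred l" if "vdeg l = 0" "mirror m a = a"
  proof (rule Cons.prems(2)[of "[]" _ w a "{#}"])
    have "c = a" using * that(1) by (auto simp: edge_zero)
    then show "path False m a w b (X - add_mset (coord m l a a) {#})" using * by simp
  qed (use that edge_less[OF *(1)] in auto)
  ultimately show ?case using * by auto
qed auto

text \<open>Off-diagonal entries come from letters of nonzero degree and diagonal entries from
  letters of degree 0, so the monomial alone counts them.\<close>

lemma path_nz_eq:
  assumes "path u m a w b X" "path u' m a' w' b' X"
  shows "nz w' = nz w"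
proof -
  have *: "nz w = size (filter_mset (\<lambda>(i, p, q). p \<noteq> q) X)" if "path u m a w b X" for u a w b X
    using that
  proof (induction w arbitrary: a X)
    case (Cons l w)
    then obtain c Y where *: "edge m a c (vdeg l)" "path u m c w b Y" "X = add_mset (coord m l a c) Y" by auto
    have "vdeg l = 0 \<longleftrightarrow> a = c" using edge_less_iff[OF *(1)] edge_less[OF *(1)] by auto
    with Cons.IH[OF *(2)] *(3) edge_less[OF *(1)] show ?case by (auto simp: coord_def mirror_inj)
  qed simp
  show ?thesis using *[OF assms(1)] *[OF assms(2)] by simp
qed


section \<open>Consequences of the proposed basis\<close>

lemma fmonom_mult: "fmonom u * fmonom v = (fmonom (u @ v) :: ('g, 'f::field) fpoly)"
  by (simp add: fmonom_def mult_single plus_fmon_def)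

lemma fmonom_Nil: "fmonom [] = (1 :: ('g, 'f::field) fpoly)"
  by (simp add: fmonom_def flip: single_one zero_fmon_def)

lemma fmonom_carrier: "fmonom w \<in> carrier (free_alg (Zr m)) \<longleftrightarrow> inG m w"
  by (auto simp: fmonom_def free_alg_simps inG_def)

section \<open>Linear extension of maps between words, and endomorphisms given by
  substitution\<close>

definition push :: "('a fmon \<Rightarrow> 'b fmon) \<Rightarrow> ('a fmon \<Rightarrow>\<^sub>0 'f::field) \<Rightarrow> ('b fmon \<Rightarrow>\<^sub>0 'f)" where
  "push h p = (\<Sum>w \<in> Poly_Mapping.keys p. Poly_Mapping.single (h w) (Poly_Mapping.lookup p w))"

lemma push_eq_sum:
  assumes "finite S" "Poly_Mapping.keys p \<subseteq> S"
  shows "push h p = (\<Sum>w \<in> S. Poly_Mapping.single (h w) (Poly_Mapping.lookup p w))"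
  unfolding push_def using assms by (intro sum.mono_neutral_left) (auto simp: in_keys_iff)

lemma push_add: "push h (p + q) = push h p + push h q"
proof -
  let ?S = "Poly_Mapping.keys p \<union> Poly_Mapping.keys q"
  show ?thesis
    using Poly_Mapping.keys_add[of p q]
    by (simp add: push_eq_sum[of ?S] lookup_add single_add sum.distrib)
qed

lemma push_zero [simp]: "push h 0 = 0"
  by (simp add: push_def)

lemma push_single: "push h (Poly_Mapping.single w c) = Poly_Mapping.single (h w) c"
  by (simp add: push_eq_sum[of "{w}"])

lemma push_sum: "push h (sum f S) = (\<Sum>i \<in> S. push h (f i))"
  by (induction S rule: infinite_finite_induct) (simp_all add: push_add)

lemma push_minus: "push h (- p) = - push h p"
  using push_add[of h p "- p"] by (simp add: eq_neg_iff_add_eq_0 add.commute)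

lemma push_diff: "push h (p - q) = push h p - push h q"
  using push_add[of h p "- q"] by (simp add: push_minus)

lemma sum_single_lookup:
  "(\<Sum>w \<in> Poly_Mapping.keys p. Poly_Mapping.single w (Poly_Mapping.lookup p w)) = p"
  by (rule poly_mapping_eqI) (auto simp: lookup_sum lookup_single when_def in_keys_iff)

lemma push_mult:
  assumes h: "\<And>v w. h (v + w) = h v + h w"
  shows "push h (p * q) = push h p * push h q"
proof -
  let ?s = "\<lambda>p w. Poly_Mapping.single w (Poly_Mapping.lookup p w)"
  have "p * q = (\<Sum>v \<in> Poly_Mapping.keys p. \<Sum>w \<in> Poly_Mapping.keys q. ?s p v * ?s q w)"
    by (simp only: sum_product[symmetric] sum_single_lookup)
  then have "push h (p * q) = push h (\<Sum>v \<in> Poly_Mapping.keys p. \<Sum>w \<in> Poly_Mapping.keys q. ?s p v * ?s q w)"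
    by simp
  also have "\<dots> = push h p * push h q"
    by (simp only: push_sum mult_single push_single h) (simp only: push_def[of h p] push_def[of h q] sum_product mult_single)
  finally show ?thesis .
qed

lemma push_push: "push h (push k p) = push (h \<circ> k) p"
  by (subst (2) push_def) (simp add: push_sum push_single push_def[of "h \<circ> k"])

lemma keys_push: "Poly_Mapping.keys (push h p) \<subseteq> h ` Poly_Mapping.keys p"
  unfolding push_def by (rule order_trans[OF Poly_Mapping.keys_sum]) auto

lemma free_star_push: "free_star p = push mono_star p"
  by (simp add: free_star_def push_def)

text \<open>Indeterminates are replaced by words only, not by polynomials: the rewriting below
  applies the generators to factors of words.\<close>

definition sub :: "(nat \<Rightarrow> zgrp \<Rightarrow> zgrp indet list) \<Rightarrow> zgrp indet list \<Rightarrow> zgrp indet list" where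
  "sub \<sigma> w = concat (map (\<lambda>l. if starred l then wstar (\<sigma> (vind l) (vdeg l)) else \<sigma> (vind l) (vdeg l)) w)"

definition hsub :: "(nat \<Rightarrow> zgrp \<Rightarrow> zgrp indet list) \<Rightarrow> zgrp indet fmon \<Rightarrow> zgrp indet fmon" where
  "hsub \<sigma> w = FMon (sub \<sigma> (letters w))"

lemma sub_append: "sub \<sigma> (v @ w) = sub \<sigma> v @ sub \<sigma> w"
  by (simp add: sub_def)

lemma sub_wstar: "sub \<sigma> (wstar w) = wstar (sub \<sigma> w)"
  by (induction w) (auto simp: sub_def)

lemma mono_star_wstar: "mono_star (FMon w) = FMon (wstar w)"
  by (simp add: mono_star_def wstar_def)

definition valid_sub :: "nat \<Rightarrow> (nat \<Rightarrow> zgrp \<Rightarrow> zgrp indet list) \<Rightarrow> bool" where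
  "valid_sub m \<sigma> \<longleftrightarrow> (\<forall>i. \<forall>g \<in> Zr m. inG m (\<sigma> i g) \<and> wdeg (\<sigma> i g) = g)"

lemma sub_valid: "valid_sub m \<sigma> \<Longrightarrow> inG m w \<Longrightarrow> inG m (sub \<sigma> w) \<and> wdeg (sub \<sigma> w) = wdeg w"
  by (induction w) (auto simp: sub_def valid_sub_def)

lemma carrier_free_alg_iff:
  "p \<in> carrier (free_alg (Zr m)) \<longleftrightarrow> (\<forall>w \<in> Poly_Mapping.keys p. inG m (letters w))"
  by (auto simp: free_alg_simps inG_def)

text \<open>Gradedness holds since each letter is replaced by a word of its own degree; commutation
  with the involution holds since a starred letter receives the reversed and starred word.\<close>

lemma graded_star_endo_push:
  assumes "valid_sub m \<sigma>"
  shows "graded_star_endo (Zr m) (push (hsub \<sigma>) :: (zgrp, 'f::field) fpoly \<Rightarrow> _)"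
proof -
  have hom: "hsub \<sigma> (v + w) = hsub \<sigma> v + hsub \<sigma> w" for v w
    by (simp add: hsub_def plus_fmon_def sub_append)
  have closed: "push (hsub \<sigma>) p \<in> carrier (free_alg (Zr m))" if "p \<in> carrier (free_alg (Zr m))"
    for p :: "(zgrp, 'f) fpoly"
    using that keys_push[of "hsub \<sigma>" p] sub_valid[OF assms] unfolding carrier_free_alg_iff
    by (fastforce simp: hsub_def)
  have one: "push (hsub \<sigma>) 1 = (1 :: (zgrp, 'f) fpoly)"
    by (simp add: push_single hsub_def sub_def zero_fmon_def flip: single_one)
  have smult: "push (hsub \<sigma>) (Poly_Mapping.single 0 c * p) = Poly_Mapping.single 0 c * push (hsub \<sigma>) p"
    for c and p :: "(zgrp, 'f) fpoly"
    by (simp add: push_mult hom push_single) (simp add: hsub_def sub_def zero_fmon_def)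
  have comp: "(push (hsub \<sigma>) :: (zgrp, 'f) fpoly \<Rightarrow> _) ` free_comp (Zr m) g \<subseteq> free_comp (Zr m) g" for g
  proof (rule image_subsetI)
    fix p :: "(zgrp, 'f) fpoly"
    assume p: "p \<in> free_comp (Zr m) g"
    have "mdeg w' = g" if w': "w' \<in> Poly_Mapping.keys (push (hsub \<sigma>) p)" for w'
    proof -
      from w' obtain w where w: "w \<in> Poly_Mapping.keys p" "w' = hsub \<sigma> w" using keys_push by blast
      then have "mdeg w = g" "inG m (letters w)" using p by (auto simp: free_comp_def carrier_free_alg_iff)
      then show ?thesis using w sub_valid[OF assms, of "letters w"] by (simp add: mdeg_def wdeg_def hsub_def)
    qed
    then show "push (hsub \<sigma>) p \<in> free_comp (Zr m) g" using closed p by (auto simp: free_comp_def)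
  qed
  have star: "hsub \<sigma> \<circ> mono_star = mono_star \<circ> hsub \<sigma>"
  proof
    fix w show "(hsub \<sigma> \<circ> mono_star) w = (mono_star \<circ> hsub \<sigma>) w"
      using sub_wstar[of \<sigma> "letters w"] by (simp add: hsub_def mono_star_def wstar_def)
  qed
  show ?thesis
    unfolding graded_star_endo_def
  proof (intro conjI ballI)
    show "push (hsub \<sigma>) \<in> Ring.ring_hom (free_alg (Zr m)) (free_alg (Zr m) :: ('f, _) module)"
      by (rule Ring.ring_hom_memI) (simp_all add: closed free_alg_simps(2-) push_add push_mult hom one)
    show "push (hsub \<sigma>) \<in> LinearCombinations.module_hom class_ring (free_alg (Zr m)) (free_alg (Zr m) :: ('f, _) module)"
      by (auto simp: LinearCombinations.module_hom_def closed free_alg_simps(2-) push_add smult)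
  qed (use comp in \<open>auto simp: free_star_push push_push star\<close>)
qed

lemma push_fmonom: "push (hsub \<sigma>) (fmonom w) = fmonom (sub \<sigma> w)"
  by (simp add: fmonom_def push_single hsub_def)

lemma free_star_fmonom: "free_star (fmonom w :: (zgrp, 'f::field) fpoly) = fmonom (wstar w)"
  by (simp add: free_star_push fmonom_def push_single mono_star_wstar)

section \<open>Congruence of words modulo a T-ideal containing the proposed basis\<close>

locale basis_ideal =
  fixes m :: nat and I :: "(zgrp, 'f::field) fpoly set"
  assumes m_pos: "0 < m" and T_ideal: "T_ideal (Zr m) I" and gens: "gens m \<subseteq> I"
begin

lemma ideal_I: "ideal I (free_alg (Zr m))"
  using T_ideal by (simp add: T_ideal_def)

lemma I_zero: "0 \<in> I"
  using additive_subgroup.zero_closed[OF ideal.axioms(1)[OF ideal_I]] by (simp add: free_alg_simps)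

lemma I_add: "p \<in> I \<Longrightarrow> q \<in> I \<Longrightarrow> p + q \<in> I"
  using additive_subgroup.a_closed[OF ideal.axioms(1)[OF ideal_I]] by (simp add: free_alg_simps)

lemma I_mult_left: "p \<in> I \<Longrightarrow> q \<in> carrier (free_alg (Zr m)) \<Longrightarrow> q * p \<in> I"
  using ideal.I_l_closed[OF ideal_I] by (simp add: free_alg_simps(2-))

lemma I_mult_right: "p \<in> I \<Longrightarrow> q \<in> carrier (free_alg (Zr m)) \<Longrightarrow> p * q \<in> I"
  using ideal.I_r_closed[OF ideal_I] by (simp add: free_alg_simps(2-))

lemma I_smult: "p \<in> I \<Longrightarrow> Poly_Mapping.single 0 c * p \<in> I"
  by (rule I_mult_left) (auto intro: free_alg_closed)

lemma I_minus: "p \<in> I \<Longrightarrow> - p \<in> I"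
  using I_smult[of p "-1"] by (simp add: single_uminus)

lemma I_star: "p \<in> I \<Longrightarrow> free_star p \<in> I"
  using T_ideal by (auto simp: T_ideal_def)

lemma I_sub: "p \<in> I \<Longrightarrow> valid_sub m \<sigma> \<Longrightarrow> push (hsub \<sigma>) p \<in> I"
  using T_ideal graded_star_endo_push[of m \<sigma>, where ?'f = 'f] by (auto simp: T_ideal_def)

lemma gens_sub: "gens_a \<subseteq> I" "gens_b m \<subseteq> I" "odd m \<Longrightarrow> gens_c m \<subseteq> I" "odd m \<Longrightarrow> gens_d m \<subseteq> I"
  "odd m \<Longrightarrow> gens_e m \<subseteq> I" "gens_f m \<subseteq> I"
  using gens by (auto simp: gens_def)

definition eqv :: "zgrp indet list \<Rightarrow> zgrp indet list \<Rightarrow> bool" where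
  "eqv v w \<longleftrightarrow> fmonom v - fmonom w \<in> I"

lemma eqv_refl [simp]: "eqv w w"
  by (simp add: eqv_def I_zero)

lemma eqv_sym: "eqv v w \<Longrightarrow> eqv w v"
  unfolding eqv_def using I_minus by fastforce

lemma eqv_trans [trans]: "eqv u v \<Longrightarrow> eqv v w \<Longrightarrow> eqv u w"
  unfolding eqv_def using I_add by fastforce

lemma eqv_context: "eqv v w \<Longrightarrow> inG m x \<Longrightarrow> inG m y \<Longrightarrow> eqv (x @ v @ y) (x @ w @ y)"
  using I_mult_left[OF I_mult_right, of "fmonom v - fmonom w" "fmonom y" "fmonom x"]
  by (simp add: eqv_def fmonom_carrier algebra_simps fmonom_mult)

lemma eqv_left: "eqv v w \<Longrightarrow> inG m x \<Longrightarrow> eqv (x @ v) (x @ w)"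
  using eqv_context[of v w x "[]"] by simp

lemma eqv_right: "eqv v w \<Longrightarrow> inG m y \<Longrightarrow> eqv (v @ y) (w @ y)"
  using eqv_context[of v w "[]" y] by simp

lemma eqv_star: "eqv v w \<Longrightarrow> eqv (wstar v) (wstar w)"
  unfolding eqv_def using I_star[of "fmonom v - fmonom w"]
  by (simp add: free_star_push push_diff) (simp flip: free_star_push add: free_star_fmonom)

text \<open>The generators involve at most three indices. The test on g keeps the substitution
  graded: the indeterminates with index 1, 2 or 3 but another degree stay fixed.\<close>

definition sg :: "zgrp indet list \<Rightarrow> zgrp indet list \<Rightarrow> zgrp indet list \<Rightarrow> nat \<Rightarrow> zgrp \<Rightarrow> zgrp indet list" where
  "sg u1 u2 u3 i g = (if i = 1 \<and> g = wdeg u1 then u1 else if i = 2 \<and> g = wdeg u2 then u2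
     else if i = 3 \<and> g = wdeg u3 then u3 else [Indet i g False])"

lemma valid_sg: "inG m u1 \<Longrightarrow> inG m u2 \<Longrightarrow> inG m u3 \<Longrightarrow> valid_sub m (sg u1 u2 u3)"
  by (auto simp: valid_sub_def sg_def)

lemma sub_sg:
  "sub (sg u1 u2 u3) [] = []"
  "sub (sg u1 u2 u3) (Indet 1 (wdeg u1) b # w) = (if b then wstar u1 else u1) @ sub (sg u1 u2 u3) w"
  "sub (sg u1 u2 u3) (Indet 2 (wdeg u2) b # w) = (if b then wstar u2 else u2) @ sub (sg u1 u2 u3) w"
  "sub (sg u1 u2 u3) (Indet 3 (wdeg u3) b # w) = (if b then wstar u3 else u3) @ sub (sg u1 u2 u3) w"
  by (simp_all add: sub_def sg_def)

lemma I_sub_diff: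
  assumes "fmonom v - fmonom w \<in> I" "inG m u1" "inG m u2" "inG m u3"
  shows "eqv (sub (sg u1 u2 u3) v) (sub (sg u1 u2 u3) w)"
  using I_sub[OF assms(1) valid_sg[OF assms(2-4)]] by (simp add: eqv_def push_diff push_fmonom)

text \<open>From here to \<open>I_blocks\<close> the generators (a), (b), (c), (e), (d) and (f) are
  restated with words of suitable degree in place of their indeterminates.\<close>

lemma eqv_comm:
  assumes "inG m u" "inG m v" "wdeg u = 0" "wdeg v = 0"
  shows "eqv (u @ v) (v @ u)"
proof -
  have "xvar 1 0 * xvar 2 0 - xvar 2 0 * xvar 1 0 \<in> I"
    using gens by (auto simp: gens_def gens_a_def)
  then have "fmonom [Indet 1 (wdeg u) False, Indet 2 (wdeg v) False]
      - fmonom [Indet 2 (wdeg v) False, Indet 1 (wdeg u) False] \<in> I"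
    by (simp add: xvar_def fmonom_mult assms)
  from I_sub_diff[OF this assms(1,2) inG_simps(1)] show ?thesis
    unfolding sub_sg by simp
qed

lemma eqv_wstar:
  assumes "inG m w" "dimU TYPE('f) m (wdeg w) = 1"
  shows "eqv (wstar w) w"
proof -
  have "xstar 1 (wdeg w) - xvar 1 (wdeg w) \<in> I"
    by (rule subsetD[OF gens_sub(2)]) (use assms wdeg_Zr in \<open>auto simp: gens_b_def\<close>)
  from I_sub_diff[OF this[unfolded xvar_def xstar_def] assms(1) inG_simps(1,1)] show ?thesis
    unfolding sub_sg by simp
qed

lemma eqv_inner:
  assumes "odd m" "inG m s" "inG m z" "inG m t" "wdeg z = 0" "wdeg s \<in> basis_elts m" "wdeg t \<in> basis_elts m"
  shows "eqv (s @ z @ t) (s @ wstar z @ t)"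
proof -
  have "xvar 1 (wdeg s) * xvar 2 0 * xvar 3 (wdeg t) - xvar 1 (wdeg s) * xstar 2 0 * xvar 3 (wdeg t) \<in> I"
    by (rule subsetD[OF gens_sub(3)[OF assms(1)]]) (use assms in \<open>auto simp: gens_c_def\<close>)
  then have "fmonom [Indet 1 (wdeg s) False, Indet 2 (wdeg z) False, Indet 3 (wdeg t) False]
    - fmonom [Indet 1 (wdeg s) False, Indet 2 (wdeg z) True, Indet 3 (wdeg t) False] \<in> I"
    by (simp add: xvar_def xstar_def fmonom_mult assms)
  from I_sub_diff[OF this assms(2,3,4)] show ?thesis
    unfolding sub_sg by simp
qed

lemma eqv_start:
  assumes "odd m" "inG m s" "inG m z" "inG m t" "wdeg z = 0" "wdeg s = eb i" "wdeg t = eb j - eb i"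
    "1 \<le> j" "j < i" "i \<le> m div 2"
  shows "eqv (z @ s @ t) (wstar z @ s @ t)"
proof -
  have "xvar 1 0 * xvar 2 (eb i) * xvar 3 (eb j - eb i) - xstar 1 0 * xvar 2 (eb i) * xvar 3 (eb j - eb i) \<in> I"
  proof -
    have "i \<in> {2..m div 2}" "j \<in> {1..<i}" using assms by auto
    then show ?thesis
      by (intro subsetD[OF gens_sub(5)[OF assms(1)]]) (unfold gens_e_def, blast)
  qed
  then have "fmonom [Indet 1 (wdeg z) False, Indet 2 (wdeg s) False, Indet 3 (wdeg t) False]
    - fmonom [Indet 1 (wdeg z) True, Indet 2 (wdeg s) False, Indet 3 (wdeg t) False] \<in> I"
    by (simp add: xvar_def xstar_def fmonom_mult assms)
  from I_sub_diff[OF this assms(3,2,4)] show ?thesis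
    unfolding sub_sg by simp
qed

lemma two_sided_I:
  assumes "odd m" "inG m s" "inG m z" "inG m z'" "wdeg z = 0" "wdeg z' = 0" "wdeg s \<in> basis_elts m"
  shows "(fmonom z - fmonom (wstar z)) * fmonom s * (fmonom z' - fmonom (wstar z')) \<in> I"
proof -
  let ?g = "wdeg s"
  have "xvar 1 0 * xvar 2 ?g * xvar 3 0 - xstar 1 0 * xvar 2 ?g * xvar 3 0
     - xvar 1 0 * xvar 2 ?g * xstar 3 0 + xstar 1 0 * xvar 2 ?g * xstar 3 0 \<in> I"
    by (rule subsetD[OF gens_sub(4)[OF assms(1)]]) (use assms in \<open>auto simp: gens_d_def\<close>)
  then have "fmonom [Indet 1 (wdeg z) False, Indet 2 (wdeg s) False, Indet 3 (wdeg z') False]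
    - fmonom [Indet 1 (wdeg z) True, Indet 2 (wdeg s) False, Indet 3 (wdeg z') False]
    - fmonom [Indet 1 (wdeg z) False, Indet 2 (wdeg s) False, Indet 3 (wdeg z') True]
    + fmonom [Indet 1 (wdeg z) True, Indet 2 (wdeg s) False, Indet 3 (wdeg z') True] \<in> I"
    by (simp add: xvar_def xstar_def fmonom_mult assms)
  from I_sub[OF this valid_sg[OF assms(3,2,4)]] show ?thesis
    unfolding push_add push_diff push_fmonom sub_sg by (simp add: algebra_simps fmonom_mult)
qed

lemma gens_f_I:
  assumes "n \<le> 3" "\<And>i. i \<in> {1..n} \<Longrightarrow> g i \<in> Zr m \<and> g i \<noteq> 0"
    "fmonom (map (\<lambda>i. Indet i (g i) False) [1..<Suc n]) \<in> (UT_identities m :: (zgrp, 'f) fpoly set)"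
  shows "fmonom (map (\<lambda>i. Indet i (g i) False) [1..<Suc n]) \<in> I"
  by (rule subsetD[OF gens_sub(6)]) (use assms in \<open>unfold gens_f_def, blast\<close>)

lemma I_blocks:
  assumes "length ws \<le> 3" "\<And>w. w \<in> set ws \<Longrightarrow> inG m w \<and> wdeg w \<noteq> 0"
    "fmonom (map (\<lambda>i. Indet i (wdeg (ws ! (i - 1))) False) [1..<Suc (length ws)])
       \<in> (UT_identities m :: (zgrp, 'f) fpoly set)"
  shows "fmonom (concat ws) \<in> I"
proof -
  let ?x = "map (\<lambda>i. Indet i (wdeg (ws ! (i - 1))) False) [1..<Suc (length ws)]"
  have *: "fmonom ?x \<in> I"
    by (rule gens_f_I[OF assms(1) _ assms(3)]) (use assms(2) wdeg_Zr in auto)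
  \<comment> \<open>For fewer than three words the empty word serves as padding; the padded indices
    do not occur in \<open>?x\<close>.\<close>
  define u where "u i = (if i < length ws then ws ! i else [])" for i
  have u: "inG m (u i)" for i using assms(2) by (auto simp: u_def)
  have "fmonom (sub (sg (u 0) (u 1) (u 2)) ?x) \<in> I"
    using I_sub[OF * valid_sg[OF u u u]] by (simp add: push_fmonom)
  moreover have "sub (sg (u 0) (u 1) (u 2)) ?x = concat ws"
  proof -
    consider "ws = []" | a where "ws = [a]" | a b where "ws = [a, b]" | a b c where "ws = [a, b, c]"
      using assms(1) by (cases ws; cases "tl ws"; cases "tl (tl ws)") (auto simp: numeral_3_eq_3)
    then show ?thesis
      by cases (simp_all add: u_def sub_def sg_def)
  qed
  ultimately show ?thesis by simp
qed

end


section \<open>Evaluation of words\<close>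

definition valid_eval :: "nat \<Rightarrow> (nat \<Rightarrow> zgrp \<Rightarrow> 'f::field mat) \<Rightarrow> bool" where
  "valid_eval m a \<longleftrightarrow> (\<forall>i. \<forall>g \<in> Zr m. a i g \<in> UT_comp m g)"

text \<open>The matrix is taken in degree \<open>vt m p - vt m q\<close>, the only degree whose
  component has a matrix unit at (p, q).\<close>

definition cval :: "nat \<Rightarrow> (nat \<Rightarrow> zgrp \<Rightarrow> 'f::field mat) \<Rightarrow> nat \<times> nat \<times> nat \<Rightarrow> 'f" where
  "cval m a = (\<lambda>(i, p, q). a i (vt m p - vt m q) $$ (p, q))"

lemma UT_comp_iff:
  "A \<in> UT_comp m g \<longleftrightarrow> A \<in> carrier_mat m m \<and> (\<forall>p<m. \<forall>q<m. A $$ (p, q) \<noteq> 0 \<longrightarrow> edge m p q g)"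
  by (auto simp: UT_comp_def edge_def vt_def upper_triangular_def; metis less_trans not_less)

lemma reflection_index: "x < m \<Longrightarrow> y < m \<Longrightarrow> reflection m A $$ (x, y) = A $$ (mirror m y, mirror m x)"
  by (simp add: reflection_def mirror_def)

lemma eval_indet_carrier:
  "valid_eval m a \<Longrightarrow> vdeg l \<in> Zr m \<Longrightarrow> eval_indet m a l \<in> carrier_mat m m"
  by (auto simp: eval_indet_def valid_eval_def UT_comp_iff reflection_def)

lemma eval_indet_edge:
  assumes "valid_eval m a" "edge m x y (vdeg l)"
  shows "eval_indet m a l $$ (x, y) = cval m a (coord m l x y)"
  using edge_less[OF assms(2)] assms(2) vt_mirror_diff[of x m y]
  by (auto simp: eval_indet_def reflection_def cval_def coord_def edge_def) (simp_all add: mirror_def)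

lemma eval_indet_nonedge:
  assumes "valid_eval m a" "vdeg l \<in> Zr m" "\<not> edge m x y (vdeg l)" "x < m" "y < m"
  shows "eval_indet m a l $$ (x, y) = 0"
proof -
  have *: "a (vind l) (vdeg l) \<in> UT_comp m (vdeg l)"
    using assms by (auto simp: valid_eval_def)
  have "\<not> edge m (mirror m y) (mirror m x) (vdeg l)"
    using edge_mirror[of m "mirror m y" "mirror m x" "vdeg l"] assms by auto
  then show ?thesis
    using * assms unfolding UT_comp_iff
    by (auto simp: eval_indet_def reflection_index) (metis mirror_less)
qed

abbreviation mono_entry :: "nat \<Rightarrow> (nat \<Rightarrow> zgrp \<Rightarrow> 'f::field mat) \<Rightarrow> nat \<Rightarrow> nat \<Rightarrow> zgrp indet list \<Rightarrow> 'f" where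
  "mono_entry m a x y w \<equiv> eval_mono m a (FMon w) $$ (x, y)"

lemma eval_mono_carrier:
  "valid_eval m a \<Longrightarrow> inG m w \<Longrightarrow> eval_mono m a (FMon w) \<in> carrier_mat m m"
  by (induction w) (auto simp: eval_mono_def dest: eval_indet_carrier intro!: mult_carrier_mat)

lemma mono_entry_Nil: "x < m \<Longrightarrow> y < m \<Longrightarrow> mono_entry m a x y [] = of_bool (x = y)"
  by (auto simp: eval_mono_def)

lemma mono_entry_Cons:
  assumes "valid_eval m a" "inG m (l # w)" "x < m" "y < m"
  shows "mono_entry m a x y (l # w) = (\<Sum>c<m. eval_indet m a l $$ (x, c) * mono_entry m a c y w)"
proof -
  have "eval_indet m a l \<in> carrier_mat m m" "eval_mono m a (FMon w) \<in> carrier_mat m m"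
    using assms by (auto intro: eval_indet_carrier eval_mono_carrier)
  then show ?thesis
    using assms(3,4) by (auto simp: eval_mono_def scalar_prod_def atLeast0LessThan intro!: sum.cong)
qed

lemma mono_entry_append:
  assumes "valid_eval m a" "inG m v" "inG m w" "x < m" "y < m"
  shows "mono_entry m a x y (v @ w) = (\<Sum>c<m. mono_entry m a x c v * mono_entry m a c y w)"
  using assms(2,4)
proof (induction v arbitrary: x)
  case Nil
  have "(\<Sum>c<m. mono_entry m a x c [] * mono_entry m a c y w) = (\<Sum>c<m. if c = x then mono_entry m a c y w else 0)"
    by (intro sum.cong) (use Nil in \<open>auto simp: mono_entry_Nil\<close>)
  then show ?case using Nil by simp
next
  case (Cons l v)
  have "mono_entry m a x y ((l # v) @ w) = (\<Sum>c<m. eval_indet m a l $$ (x, c) * mono_entry m a c y (v @ w))"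
    using Cons.prems assms by (simp add: mono_entry_Cons)
  also have "\<dots> = (\<Sum>c<m. \<Sum>d<m. eval_indet m a l $$ (x, c) * mono_entry m a c d v * mono_entry m a d y w)"
    using Cons by (intro sum.cong) (auto simp: sum_distrib_left mult.assoc)
  also have "\<dots> = (\<Sum>d<m. \<Sum>c<m. eval_indet m a l $$ (x, c) * mono_entry m a c d v * mono_entry m a d y w)"
    by (rule sum.swap)
  also have "\<dots> = (\<Sum>d<m. mono_entry m a x d (l # v) * mono_entry m a d y w)"
    using Cons.prems assms by (intro sum.cong) (auto simp: sum_distrib_right mono_entry_Cons)
  finally show ?case .
qed

text \<open>At most one edge of a given degree leaves an index (\<open>edge_det\<close>), so the row
  by column sum retains a single term at every letter.\<close>

lemma mono_entry_path:
  assumes "valid_eval m a" "path False m x w y X"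
  shows "mono_entry m a x y w = prod_mset (image_mset (cval m a) X)"
  using assms(2)
proof (induction w arbitrary: x X)
  case Nil
  then show ?case by (simp add: mono_entry_Nil)
next
  case (Cons l w)
  then obtain c Y where *: "edge m x c (vdeg l)" "path False m c w y Y" "X = add_mset (coord m l x c) Y" by auto
  have lt: "x < m" "y < m" "c < m" using path_less[OF Cons.prems] path_less[OF *(2)] by auto
  have G: "inG m (l # w)" using path_inG[OF Cons.prems] .
  have "mono_entry m a x y (l # w) = (\<Sum>d<m. eval_indet m a l $$ (x, d) * mono_entry m a d y w)"
    using mono_entry_Cons[OF assms(1) G lt(1,2)] .
  also have "\<dots> = (\<Sum>d<m. if d = c then cval m a (coord m l x c) * mono_entry m a c y w else 0)"
  proof (intro sum.cong refl)
    fix d assume "d \<in> {..<m}"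
    then show "eval_indet m a l $$ (x, d) * mono_entry m a d y w =
      (if d = c then cval m a (coord m l x c) * mono_entry m a c y w else 0)"
      using eval_indet_edge[OF assms(1) *(1)] eval_indet_nonedge[OF assms(1), of l x d] G lt edge_det[OF *(1), of d]
      by auto
  qed
  finally show ?case using Cons.IH[OF *(2)] lt(3) *(3) by simp
qed

lemma mono_entry_nopath:
  assumes "valid_eval m a" "inG m w" "x < m" "y < m" "\<nexists>X. path False m x w y X"
  shows "mono_entry m a x y w = 0"
  using assms(2,3,5)
proof (induction w arbitrary: x)
  case Nil
  then show ?case using assms(4) by (auto simp: mono_entry_Nil)
next
  case (Cons l w)
  have "eval_indet m a l $$ (x, c) * mono_entry m a c y w = 0" if "c < m" for c
  proof (cases "edge m x c (vdeg l)")
    case True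
    with Cons.prems have "\<nexists>X. path False m c w y X" by auto
    with Cons that show ?thesis by simp
  next
    case False
    with Cons.prems that assms(1) show ?thesis by (simp add: eval_indet_nonedge)
  qed
  then show ?case using mono_entry_Cons[OF assms(1) Cons.prems(1,2) assms(4)] by (simp add: sum.neutral)
qed

text \<open>Entries depend on a word only through its path monomials; this reduces the verification
  of identities to statements about \<open>path\<close>.\<close>

lemma mono_entry_cong:
  assumes "valid_eval m a" "inG m v" "inG m w" "x < m" "y < m" "x' < m" "y' < m"
    "\<And>X. path False m x v y X \<longleftrightarrow> path False m x' w y' X"
  shows "mono_entry m a x y v = mono_entry m a x' y' w"
proof (cases "\<exists>X. path False m x v y X")
  case True
  then obtain X where "path False m x v y X" by blast
  with assms show ?thesis using mono_entry_path by metis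
next
  case False
  then have "\<nexists>X. path False m x' w y' X" using assms(8) by blast
  with False assms show ?thesis by (simp add: mono_entry_nopath)
qed

lemma mono_entry_wstar:
  assumes "valid_eval m a" "inG m w" "x < m" "y < m"
  shows "mono_entry m a x y (wstar w) = mono_entry m a (mirror m y) (mirror m x) w"
proof (rule mono_entry_cong)
  fix X
  show "path False m x (wstar w) y X \<longleftrightarrow> path False m (mirror m y) w (mirror m x) X"
    using path_star[of False m x "wstar w" y X] path_star[of False m "mirror m y" w "mirror m x" X] assms by auto
qed (use assms in auto)

section \<open>Entries of evaluated polynomials\<close>

definition ev :: "nat \<Rightarrow> (nat \<Rightarrow> zgrp \<Rightarrow> 'f::field mat) \<Rightarrow> nat \<Rightarrow> nat \<Rightarrow> (zgrp, 'f) fpoly \<Rightarrow> 'f" where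
  "ev m a x y p = (\<Sum>w \<in> Poly_Mapping.keys p. Poly_Mapping.lookup p w * mono_entry m a x y (letters w))"

lemma ev_eq_sum:
  assumes "finite S" "Poly_Mapping.keys p \<subseteq> S"
  shows "ev m a x y p = (\<Sum>w \<in> S. Poly_Mapping.lookup p w * mono_entry m a x y (letters w))"
  unfolding ev_def using assms by (intro sum.mono_neutral_left) (auto simp: in_keys_iff)

lemma ev_add: "ev m a x y (p + q) = ev m a x y p + ev m a x y q"
proof -
  let ?S = "Poly_Mapping.keys p \<union> Poly_Mapping.keys q"
  show ?thesis
    using Poly_Mapping.keys_add[of p q]
    by (simp add: ev_eq_sum[of ?S] lookup_add distrib_right sum.distrib)
qed

lemma ev_zero [simp]: "ev m a x y 0 = 0"
  by (simp add: ev_def)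

lemma ev_single: "ev m a x y (Poly_Mapping.single w c) = c * mono_entry m a x y (letters w)"
  by (simp add: ev_eq_sum[of "{w}"])

lemma ev_fmonom: "ev m a x y (fmonom w) = mono_entry m a x y w"
  by (simp add: fmonom_def ev_single)

lemma ev_sum: "ev m a x y (sum f S) = (\<Sum>i \<in> S. ev m a x y (f i))"
  by (induction S rule: infinite_finite_induct) (simp_all add: ev_add)

lemma ev_minus: "ev m a x y (- p) = - ev m a x y p"
  using ev_add[of m a x y p "- p"] by (simp add: eq_neg_iff_add_eq_0 add.commute)

lemma ev_diff: "ev m a x y (p - q) = ev m a x y p - ev m a x y q"
  using ev_add[of m a x y p "- q"] by (simp add: ev_minus)

lemma ev_mult:
  assumes "valid_eval m a" "p \<in> carrier (free_alg (Zr m))" "q \<in> carrier (free_alg (Zr m))" "x < m" "y < m"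
  shows "ev m a x y (p * q) = (\<Sum>c<m. ev m a x c p * ev m a c y q)"
proof -
  let ?s = "\<lambda>p w. Poly_Mapping.single w (Poly_Mapping.lookup p w)"
  let ?K = Poly_Mapping.keys and ?L = Poly_Mapping.lookup
  have "p * q = (\<Sum>v \<in> ?K p. \<Sum>w \<in> ?K q. ?s p v * ?s q w)"
    by (simp only: sum_product[symmetric] sum_single_lookup)
  then have "ev m a x y (p * q) = ev m a x y (\<Sum>v \<in> ?K p. \<Sum>w \<in> ?K q. ?s p v * ?s q w)" by simp
  also have "\<dots> = (\<Sum>v \<in> ?K p. \<Sum>w \<in> ?K q. ?L p v * ?L q w * mono_entry m a x y (letters (v + w)))"
    by (simp only: ev_sum mult_single ev_single)
  also have "\<dots> = (\<Sum>v \<in> ?K p. \<Sum>w \<in> ?K q. \<Sum>c<m.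
      (?L p v * mono_entry m a x c (letters v)) * (?L q w * mono_entry m a c y (letters w)))"
  proof (intro sum.cong refl)
    fix v w assume "v \<in> ?K p" "w \<in> ?K q"
    then have "inG m (letters v)" "inG m (letters w)" using assms by (auto simp: carrier_free_alg_iff)
    from mono_entry_append[OF assms(1) this assms(4,5)]
    show "?L p v * ?L q w * mono_entry m a x y (letters (v + w)) =
      (\<Sum>c<m. (?L p v * mono_entry m a x c (letters v)) * (?L q w * mono_entry m a c y (letters w)))"
      by (simp add: plus_fmon_def sum_distrib_left mult_ac)
  qed
  also have "\<dots> = (\<Sum>v \<in> ?K p. \<Sum>c<m. \<Sum>w \<in> ?K q.
      (?L p v * mono_entry m a x c (letters v)) * (?L q w * mono_entry m a c y (letters w)))"
    by (intro sum.cong refl sum.swap)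
  also have "\<dots> = (\<Sum>c<m. \<Sum>v \<in> ?K p. \<Sum>w \<in> ?K q.
      (?L p v * mono_entry m a x c (letters v)) * (?L q w * mono_entry m a c y (letters w)))"
    by (rule sum.swap)
  finally show ?thesis by (simp add: ev_def sum_product)
qed

lemma ev_star:
  assumes "valid_eval m a" "p \<in> carrier (free_alg (Zr m))" "x < m" "y < m"
  shows "ev m a x y (free_star p) = ev m a (mirror m y) (mirror m x) p"
proof -
  have "ev m a x y (free_star p) =
      (\<Sum>w \<in> Poly_Mapping.keys p. Poly_Mapping.lookup p w * mono_entry m a x y (wstar (letters w)))"
    by (simp add: free_star_def ev_sum ev_single mono_star_def wstar_def)
  also have "\<dots> = ev m a (mirror m y) (mirror m x) p"
    unfolding ev_def using assms by (intro sum.cong) (auto simp: mono_entry_wstar carrier_free_alg_iff)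
  finally show ?thesis .
qed

text \<open>The structure \<open>R\<close> is kept general because it is both the module of all
  matrices and a single homogeneous component.\<close>

lemma finsum_mat_index:
  assumes R: "abelian_monoid R" "add R = (+)" "zero R = 0\<^sub>m m m" "carrier R \<subseteq> carrier_mat m m"
    and "finite S" "f \<in> S \<rightarrow> carrier R" "i < m" "j < m"
  shows "finsum R f S $$ (i, j) = (\<Sum>s \<in> S. f s $$ (i, j))"
  using assms(5,6)
proof (induction S)
  case empty
  interpret abelian_monoid R by fact
  show ?case using R assms by (simp add: finsum_empty)
next
  case (insert s S)
  interpret abelian_monoid R by fact
  have "finsum R f S \<in> carrier_mat m m" "f s \<in> carrier_mat m m"
    using insert.prems R(4) finsum_closed[of f S] by auto
  then show ?case
    using insert R(2) assms(7,8) by (simp add: finsum_insert)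
qed

lemma eval_poly_carrier:
  fixes p :: "(zgrp, 'f::field) fpoly"
  assumes "valid_eval m a" "p \<in> carrier (free_alg (Zr m))"
  shows "eval_poly m a p \<in> carrier_mat m m"
proof -
  interpret abelian_group "module_mat TYPE('f) m m" by (rule abelian_group_mat)
  have "inG m (letters w)" if "w \<in> Poly_Mapping.keys p" for w
    using that assms by (auto simp: carrier_free_alg_iff)
  then have "eval_mono m a w \<in> carrier_mat m m" if "w \<in> Poly_Mapping.keys p" for w
    using that eval_mono_carrier[OF assms(1), of "letters w"] by simp
  then have "eval_poly m a p \<in> carrier (module_mat TYPE('f) m m)"
    unfolding eval_poly_def by (intro finsum_closed) (auto simp: module_mat_simps)
  then show ?thesis by (simp add: module_mat_simps)
qed

lemma eval_poly_index:
  fixes p :: "(zgrp, 'f::field) fpoly"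
  assumes "valid_eval m a" "p \<in> carrier (free_alg (Zr m))" "x < m" "y < m"
  shows "eval_poly m a p $$ (x, y) = ev m a x y p"
proof -
  interpret abelian_group "module_mat TYPE('f) m m" by (rule abelian_group_mat)
  have "inG m (letters w)" if "w \<in> Poly_Mapping.keys p" for w
    using that assms by (auto simp: carrier_free_alg_iff)
  then have *: "eval_mono m a w \<in> carrier_mat m m" if "w \<in> Poly_Mapping.keys p" for w
    using that eval_mono_carrier[OF assms(1), of "letters w"] by simp
  have "eval_poly m a p $$ (x, y) =
      (\<Sum>w \<in> Poly_Mapping.keys p. (Poly_Mapping.lookup p w \<cdot>\<^sub>m eval_mono m a w) $$ (x, y))"
    unfolding eval_poly_def
    by (rule finsum_mat_index[OF abelian_monoid_axioms]) (use * assms in \<open>auto simp: module_mat_simps\<close>)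
  also have "\<dots> = ev m a x y p"
    unfolding ev_def by (intro sum.cong) (use * assms in \<open>auto dest!: *\<close>)
  finally show ?thesis .
qed

lemma UT_identities_iff:
  "p \<in> UT_identities m \<longleftrightarrow> p \<in> carrier (free_alg (Zr m)) \<and>
    (\<forall>a. valid_eval m a \<longrightarrow> (\<forall>x<m. \<forall>y<m. ev m a x y p = 0))"
proof -
  have "eval_poly m a p = 0\<^sub>m m m \<longleftrightarrow> (\<forall>x<m. \<forall>y<m. ev m a x y p = 0)"
    if "valid_eval m a" "p \<in> carrier (free_alg (Zr m))" for a
    using eval_poly_carrier[OF that] eval_poly_index[OF that] by (auto simp: mat_eq_iff)
  then show ?thesis by (auto simp: UT_identities_def valid_eval_def)
qed


section \<open>The identities form a T-ideal\<close>

lemma UT_carrier: "p \<in> UT_identities m \<Longrightarrow> p \<in> carrier (free_alg (Zr m))"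
  by (simp add: UT_identities_iff)

lemma UT_add: "p \<in> UT_identities m \<Longrightarrow> q \<in> UT_identities m \<Longrightarrow> p + q \<in> UT_identities m"
  by (auto simp: UT_identities_iff ev_add free_alg_closed)

lemma UT_minus: "p \<in> UT_identities m \<Longrightarrow> - p \<in> UT_identities m"
  by (auto simp: UT_identities_iff ev_minus free_alg_closed)

lemma UT_zero: "0 \<in> UT_identities m"
  using free_alg_closed(4)[of 0 "Zr m"] by (auto simp: UT_identities_iff)

lemma ideal_UT_identities: "ideal (UT_identities m :: (zgrp, 'f::field) fpoly set) (free_alg (Zr m))"
proof (rule idealI)
  interpret ring "free_alg (Zr m) :: ('f, (zgrp, 'f) fpoly) module" by (rule ring_free_alg)
  show "ring (free_alg (Zr m) :: ('f, (zgrp, 'f) fpoly) module)" by (rule ring_free_alg)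
  have neg: "\<ominus>\<^bsub>free_alg (Zr m)\<^esub> p = - p" if "p \<in> carrier (free_alg (Zr m))" for p :: "(zgrp, 'f) fpoly"
    by (rule minus_equality) (use that free_alg_closed in \<open>auto simp: free_alg_simps(2-)\<close>)
  show "subgroup (UT_identities m) (add_monoid (free_alg (Zr m) :: ('f, (zgrp, 'f) fpoly) module))"
  proof (rule subgroup.intro)
    show "UT_identities m \<subseteq> carrier (add_monoid (free_alg (Zr m) :: ('f, (zgrp, 'f) fpoly) module))"
      by (auto simp: UT_carrier)
  next
    fix p :: "(zgrp, 'f) fpoly"
    assume p: "p \<in> UT_identities m"
    have "inv\<^bsub>add_monoid (free_alg (Zr m))\<^esub> p = - p"
      using neg[OF UT_carrier[OF p]] by (simp add: a_inv_def)
    then show "inv\<^bsub>add_monoid (free_alg (Zr m))\<^esub> p \<in> UT_identities m"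
      using p by (simp add: UT_minus)
  qed (simp_all add: UT_add UT_zero free_alg_simps(2-))
next
  fix p q :: "(zgrp, 'f) fpoly"
  assume p: "p \<in> UT_identities m" and q: "q \<in> carrier (free_alg (Zr m))"
  then show "q \<otimes>\<^bsub>free_alg (Zr m)\<^esub> p \<in> UT_identities m" "p \<otimes>\<^bsub>free_alg (Zr m)\<^esub> q \<in> UT_identities m"
    by (auto simp: UT_identities_iff ev_mult free_alg_closed free_alg_simps(2-) intro!: sum.neutral)
qed

lemma free_star_carrier: "p \<in> carrier (free_alg (Zr m)) \<Longrightarrow> free_star p \<in> carrier (free_alg (Zr m))"
  unfolding carrier_free_alg_iff free_star_push
proof
  fix w assume *: "\<forall>w \<in> Poly_Mapping.keys p. inG m (letters w)" "w \<in> Poly_Mapping.keys (push mono_star p)"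
  then obtain v where "v \<in> Poly_Mapping.keys p" "w = mono_star v" using keys_push by blast
  with * show "inG m (letters w)" by (simp add: mono_star_def flip: wstar_def)
qed

lemma UT_star: "p \<in> UT_identities m \<Longrightarrow> free_star p \<in> UT_identities m"
  by (auto simp: UT_identities_iff ev_star free_star_carrier)

lemma eval_poly_free_comp:
  assumes a: "valid_eval m a" and p: "p \<in> free_comp (Zr m) g"
  shows "eval_poly m a p \<in> UT_comp m g"
proof -
  have p': "p \<in> carrier (free_alg (Zr m))" using p by (simp add: free_comp_def)
  have "edge m x y g" if xy: "x < m" "y < m" "ev m a x y p \<noteq> 0" for x y
  proof -
    from xy(3) obtain w where w: "w \<in> Poly_Mapping.keys p" "mono_entry m a x y (letters w) \<noteq> 0"
      unfolding ev_def by (metis (no_types, lifting) mult_zero_right sum.neutral)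
    moreover have "inG m (letters w)" using w p' by (auto simp: carrier_free_alg_iff)
    ultimately obtain X where X: "path False m x (letters w) y X" using mono_entry_nopath a xy by blast
    have "wdeg (letters w) = g" using p w by (simp add: free_comp_def mdeg_def wdeg_def)
    then show ?thesis using path_edge[OF X] by simp
  qed
  then show ?thesis
    using eval_poly_carrier[OF a p'] eval_poly_index[OF a p'] by (auto simp: UT_comp_iff)
qed

text \<open>Evaluating the image of p at \<open>a\<close> is evaluating p at the matrices
  \<open>b\<close> obtained from the images of the unstarred indeterminates. These are admissible
  because the endomorphism is graded, and starred letters are evaluated correctly because it
  commutes with the involution.\<close>

lemma UT_endo:
  fixes \<phi> :: "(zgrp, 'f::field) fpoly \<Rightarrow> (zgrp, 'f) fpoly"
  assumes \<phi>: "graded_star_endo (Zr m) \<phi>" and p: "p \<in> UT_identities m"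
  shows "\<phi> p \<in> UT_identities m"
proof -
  let ?A = "free_alg (Zr m) :: ('f, (zgrp, 'f) fpoly) module"
  have hom: "\<phi> \<in> Ring.ring_hom ?A ?A" and lin: "\<phi> \<in> LinearCombinations.module_hom class_ring ?A ?A"
    using \<phi> by (auto simp: graded_star_endo_def)
  have closed: "\<phi> q \<in> carrier ?A" if "q \<in> carrier ?A" for q
    using Ring.ring_hom_closed[OF hom that] .
  have mult: "\<phi> (q * q') = \<phi> q * \<phi> q'" if "q \<in> carrier ?A" "q' \<in> carrier ?A" for q q'
    using Ring.ring_hom_mult[OF hom that] by (simp add: free_alg_simps(2-))
  have add: "\<phi> (q + q') = \<phi> q + \<phi> q'" if "q \<in> carrier ?A" "q' \<in> carrier ?A" for q q'
    using Ring.ring_hom_add[OF hom that] by (simp add: free_alg_simps(2-))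
  have one: "\<phi> 1 = 1"
    using Ring.ring_hom_one[OF hom] by (simp add: free_alg_simps(2-))
  have smult: "\<phi> (Poly_Mapping.single 0 c * q) = Poly_Mapping.single 0 c * \<phi> q" if "q \<in> carrier ?A" for c q
    using lin that by (auto simp: LinearCombinations.module_hom_def free_alg_simps(2-))
  have star: "\<phi> (free_star q) = free_star (\<phi> q)" if "q \<in> carrier ?A" for q
    using \<phi> that by (auto simp: graded_star_endo_def)
  have pc: "p \<in> carrier ?A" using p by (rule UT_carrier)
  have "ev m a x y (\<phi> p) = 0" if a: "valid_eval m a" and xy: "x < m" "y < m" for a x y
  proof -
    define b where "b i g = eval_poly m a (\<phi> (fmonom [Indet i g False]))" for i g
    have "\<phi> (fmonom [Indet i g False]) \<in> free_comp (Zr m) g" if "g \<in> Zr m" for i g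
    proof -
      have "fmonom [Indet i g False] \<in> (free_comp (Zr m) g :: (zgrp, 'f) fpoly set)"
        using that by (simp add: free_comp_def fmonom_carrier) (simp add: fmonom_def mdeg_def)
      then show ?thesis using \<phi> that by (auto simp: graded_star_endo_def)
    qed
    then have b: "valid_eval m b"
      unfolding b_def valid_eval_def by (intro allI ballI eval_poly_free_comp a)
    have letter: "ev m a x y (\<phi> (fmonom [l])) = eval_indet m b l $$ (x, y)"
      if "vdeg l \<in> Zr m" "x < m" "y < m" for l x y
    proof -
      let ?l = "Indet (vind l) (vdeg l) False"
      have c: "(fmonom [?l] :: (zgrp, 'f) fpoly) \<in> carrier ?A" using that by (simp add: fmonom_carrier)
      have *: "ev m a x y (\<phi> (fmonom [?l])) = b (vind l) (vdeg l) $$ (x, y)" if "x < m" "y < m" for x y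
        unfolding b_def by (rule eval_poly_index[symmetric, OF a closed[OF c] that])
      show ?thesis
      proof (cases "starred l")
        case True
        then have "fmonom [l] = free_star (fmonom [?l] :: (zgrp, 'f) fpoly)"
          by (simp add: free_star_fmonom indet_star_def) (metis indet.collapse)
        then have "\<phi> (fmonom [l]) = free_star (\<phi> (fmonom [?l]))" using star c by simp
        then show ?thesis
          using True that * by (simp add: ev_star[OF a closed[OF c]] eval_indet_def reflection_index)
      next
        case False
        then have "l = ?l" by (metis (full_types) indet.collapse)
        then show ?thesis using *[OF that(2,3)] False by (simp add: eval_indet_def)
      qed
    qed
    have mono: "ev m a x y (\<phi> (fmonom w)) = mono_entry m b x y w" if "inG m w" "x < m" "y < m" for w x y
      using that
    proof (induction w arbitrary: x)
      case Nil
      then show ?case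
        using ev_fmonom[of m a x y "[]"] by (simp add: fmonom_Nil one mono_entry_Nil)
    next
      case (Cons l w)
      have c: "fmonom [l] \<in> carrier ?A" "fmonom w \<in> carrier ?A" using Cons.prems by (simp_all add: fmonom_carrier)
      have "fmonom (l # w) = fmonom [l] * (fmonom w :: (zgrp, 'f) fpoly)" by (simp add: fmonom_mult)
      then have "\<phi> (fmonom (l # w)) = \<phi> (fmonom [l]) * \<phi> (fmonom w)" using mult c by simp
      then have "ev m a x y (\<phi> (fmonom (l # w))) =
          (\<Sum>c<m. ev m a x c (\<phi> (fmonom [l])) * ev m a c y (\<phi> (fmonom w)))"
        using ev_mult[OF a closed[OF c(1)] closed[OF c(2)]] Cons.prems by simp
      also have "\<dots> = (\<Sum>c<m. eval_indet m b l $$ (x, c) * mono_entry m b c y w)"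
        using Cons letter by (intro sum.cong) auto
      finally show ?case using mono_entry_Cons[OF b] Cons.prems by simp
    qed
    have sums: "\<phi> (sum f S) = (\<Sum>i \<in> S. \<phi> (f i)) \<and> sum f S \<in> carrier ?A"
      if "finite S" "\<And>i. i \<in> S \<Longrightarrow> f i \<in> carrier ?A" for S and f :: "zgrp indet fmon \<Rightarrow> (zgrp, 'f) fpoly"
      using that
    proof (induction S)
      case empty
      have "(0 :: (zgrp, 'f) fpoly) \<in> carrier ?A" by (rule UT_carrier[OF UT_zero])
      then show ?case using add[of 0 0] by simp
    next
      case (insert i S)
      then show ?case by (simp add: add free_alg_closed)
    qed
    have G: "inG m (letters w)" if "w \<in> Poly_Mapping.keys p" for w
      using that pc by (auto simp: carrier_free_alg_iff)
    have single: "Poly_Mapping.single w c = Poly_Mapping.single 0 c * fmonom (letters w)" for w and c :: 'f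
      by (simp add: fmonom_def mult_single)
    have "\<phi> p = \<phi> (\<Sum>w \<in> Poly_Mapping.keys p. Poly_Mapping.single w (Poly_Mapping.lookup p w))"
      by (simp only: sum_single_lookup)
    also have "\<dots> = (\<Sum>w \<in> Poly_Mapping.keys p. \<phi> (Poly_Mapping.single w (Poly_Mapping.lookup p w)))"
      by (rule conjunct1[OF sums]) (auto simp: carrier_free_alg_iff G)
    also have "\<dots> = (\<Sum>w \<in> Poly_Mapping.keys p. Poly_Mapping.single 0 (Poly_Mapping.lookup p w) * \<phi> (fmonom (letters w)))"
      by (intro sum.cong refl) (subst single, simp add: smult fmonom_carrier G)
    finally have "ev m a x y (\<phi> p) = (\<Sum>w \<in> Poly_Mapping.keys p.
        ev m a x y (Poly_Mapping.single 0 (Poly_Mapping.lookup p w) * \<phi> (fmonom (letters w))))"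
      by (simp add: ev_sum)
    also have "\<dots> = (\<Sum>w \<in> Poly_Mapping.keys p. Poly_Mapping.lookup p w * mono_entry m b x y (letters w))"
    proof (intro sum.cong refl)
      fix w assume w: "w \<in> Poly_Mapping.keys p"
      let ?c = "Poly_Mapping.lookup p w"
      have "ev m a x y (Poly_Mapping.single 0 ?c * \<phi> (fmonom (letters w))) =
          (\<Sum>c<m. ev m a x c (Poly_Mapping.single 0 ?c) * ev m a c y (\<phi> (fmonom (letters w))))"
        using w G xy by (intro ev_mult a closed free_alg_closed) (auto simp: fmonom_carrier)
      also have "\<dots> = (\<Sum>c<m. if c = x then ?c * ev m a x y (\<phi> (fmonom (letters w))) else 0)"
        using xy by (intro sum.cong) (auto simp: ev_single zero_fmon_def mono_entry_Nil)
      finally show "ev m a x y (Poly_Mapping.single 0 ?c * \<phi> (fmonom (letters w))) = ?c * mono_entry m b x y (letters w)"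
        using mono w G xy by simp
    qed
    also have "\<dots> = ev m b x y p" by (simp add: ev_def)
    finally show ?thesis using p b xy by (simp add: UT_identities_iff)
  qed
  then show ?thesis using closed pc by (simp add: UT_identities_iff)
qed

lemma T_ideal_UT_identities: "T_ideal (Zr m) (UT_identities m :: (zgrp, 'f::field) fpoly set)"
  unfolding T_ideal_def using ideal_UT_identities UT_star UT_endo by blast


section \<open>The generators are identities\<close>

definition edges :: "nat \<Rightarrow> zgrp \<Rightarrow> (nat \<times> nat) set" where
  "edges m g = {(p, q). p < m \<and> edge m p q g}"

lemma finite_edges: "finite (edges m g)"
  by (rule finite_subset[of _ "{..<m} \<times> {..<m}"]) (auto simp: edges_def edge_def)

definition elem_mat :: "nat \<Rightarrow> nat \<times> nat \<Rightarrow> 'f::field mat" where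
  "elem_mat m s = mat m m (\<lambda>t. of_bool (t = s))"

lemma elem_mat_index: "i < m \<Longrightarrow> j < m \<Longrightarrow> elem_mat m s $$ (i, j) = of_bool ((i, j) = s)"
  by (simp add: elem_mat_def)

lemma inj_elem_mat: "inj_on (elem_mat m :: _ \<Rightarrow> 'f::field mat) (edges m g)"
proof (rule inj_onI)
  fix s t assume *: "s \<in> edges m g" "t \<in> edges m g" "(elem_mat m s :: 'f mat) = elem_mat m t"
  obtain i j where s: "s = (i, j)" by force
  with * have "i < m" "j < m" by (auto simp: edges_def edge_def)
  then have "(elem_mat m s :: 'f mat) $$ (i, j) = 1" by (simp add: elem_mat_index s)
  with * have "(elem_mat m t :: 'f mat) $$ (i, j) = 1" by simp
  with \<open>i < m\<close> \<open>j < m\<close> show "s = t" by (simp add: elem_mat_index s split: if_splits)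
qed

text \<open>The matrix units at the positions of degree g form a basis of the component.\<close>

lemma dimU_eq: "dimU TYPE('f::field) m g = card (edges m g)"
proof -
  let ?M = "module_mat TYPE('f) m m" and ?W = "UT_comp m g :: 'f mat set"
  let ?K = "class_ring :: 'f ring"
  let ?V = "?M\<lparr>carrier := ?W\<rparr>"
  interpret M: vectorspace ?K ?M by (rule matrix_vs)
  have "subspace ?K ?W ?M"
  proof (rule subspace.intro)
    show "submodule ?K ?W ?M"
    proof (rule submodule.intro)
      show "module ?K ?M" by unfold_locales
      show "?W \<subseteq> carrier ?M" by (auto simp: UT_comp_iff module_mat_simps)
      show "\<zero>\<^bsub>?M\<^esub> \<in> ?W" by (auto simp: UT_comp_iff module_mat_simps)
      fix A B assume "A \<in> ?W" "B \<in> ?W"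
      then show "A \<oplus>\<^bsub>?M\<^esub> B \<in> ?W" 
        by (auto simp: UT_comp_iff module_mat_simps) fastforce
    next
      fix c A assume "c \<in> carrier ?K" "A \<in> ?W"
      then show "c \<odot>\<^bsub>?M\<^esub> A \<in> ?W" by (auto simp: UT_comp_iff module_mat_simps)
    qed
    show "vectorspace ?K ?M" by unfold_locales
  qed
  then have vs: "vectorspace ?K ?V" by (rule vectorspace.subspace_is_vs[OF M.vectorspace_axioms])
  interpret V: vectorspace ?K ?V by (rule vs)
  let ?B = "elem_mat m ` edges m g :: 'f mat set"
  have B: "?B \<subseteq> ?W"
    by (auto simp: UT_comp_iff elem_mat_def edges_def split: if_splits)
  have fin: "finite ?B" using finite_edges by simp
  have index: "V.lincomb a S $$ (i, j) = (\<Sum>A \<in> S. a A * A $$ (i, j))"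
    if "S \<subseteq> ?B" "i < m" "j < m" for a S i j
  proof -
    have S: "finite S" "S \<subseteq> ?W" using finite_subset[OF that(1) fin] that(1) B by auto
    have "V.lincomb a S $$ (i, j) = (\<Sum>A \<in> S. (a A \<cdot>\<^sub>m A) $$ (i, j))"
      unfolding V.lincomb_def
    proof (subst finsum_mat_index)
      show "abelian_monoid ?V" by unfold_locales
      have "a A \<odot>\<^bsub>?V\<^esub> A \<in> carrier ?V" if "A \<in> S" for A
        using that S by (intro V.smult_closed) auto
      then show "(\<lambda>A. a A \<odot>\<^bsub>?V\<^esub> A) \<in> S \<rightarrow> carrier ?V" by auto
    qed (use S that in \<open>auto simp: module_mat_simps UT_comp_iff\<close>)
    also have "\<dots> = (\<Sum>A \<in> S. a A * A $$ (i, j))"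
    proof (intro sum.cong refl)
      fix A assume "A \<in> S"
      then have "A \<in> carrier_mat m m" using S by (auto simp: UT_comp_iff)
      then show "(a A \<cdot>\<^sub>m A) $$ (i, j) = a A * A $$ (i, j)" using that by simp
    qed
    finally show ?thesis .
  qed
  have "V.basis ?B"
    unfolding V.basis_def
  proof (intro conjI notI)
    assume "V.lin_dep ?B"
    then obtain S a A where *: "finite S" "S \<subseteq> ?B" "V.lincomb a S = \<zero>\<^bsub>?V\<^esub>" "A \<in> S" "a A \<noteq> 0"
      by (auto simp: V.lin_dep_def)
    then obtain p q where A: "A = elem_mat m (p, q)" "(p, q) \<in> edges m g" by auto
    then have pq: "p < m" "q < m" by (auto simp: edges_def edge_def)
    have "0 = V.lincomb a S $$ (p, q)" using *(3) pq by (simp add: module_mat_simps)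
    also have "\<dots> = (\<Sum>C \<in> S. a C * C $$ (p, q))" using index[OF *(2) pq] .
    also have "\<dots> = (\<Sum>C \<in> S. if C = A then a A else 0)"
      using *(2) pq A by (intro sum.cong) (auto simp: elem_mat_index)
    finally show False using * by simp
  next
    show "?B \<subseteq> carrier ?V" using B by simp
    show "V.span ?B = carrier ?V"
    proof
      show "V.span ?B \<subseteq> carrier ?V" using V.span_is_subset2[of ?B] B by simp
      show "carrier ?V \<subseteq> V.span ?B"
      proof
        fix A assume "A \<in> carrier ?V"
        then have A: "A \<in> ?W" by simp
        define a where "a C = A $$ inv_into (edges m g) (elem_mat m) C" for C :: "'f mat"
        have cl: "V.lincomb a ?B \<in> ?W" using V.lincomb_closed[of ?B a] B by auto
        have "V.lincomb a ?B = A"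
        proof (rule eq_matI)
          fix i j assume "i < dim_row A" "j < dim_col A"
          then have ij: "i < m" "j < m" using A by (auto simp: UT_comp_iff)
          have "V.lincomb a ?B $$ (i, j) = (\<Sum>s \<in> edges m g. A $$ s * elem_mat m s $$ (i, j))"
            using index[OF subset_refl ij] by (simp add: sum.reindex inj_elem_mat a_def inv_into_f_f)
          also have "\<dots> = (\<Sum>s \<in> edges m g. if s = (i, j) then A $$ (i, j) else 0)"
            using ij by (intro sum.cong) (auto simp: elem_mat_index)
          also have "\<dots> = A $$ (i, j)"
            using A ij finite_edges by (auto simp: edges_def UT_comp_iff)
          finally show "V.lincomb a ?B $$ (i, j) = A $$ (i, j)" .
        qed (use A cl in \<open>auto simp: UT_comp_iff\<close>)
        then show "A \<in> V.span ?B"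
          unfolding V.span_def using fin by (auto intro!: exI[of _ a] exI[of _ ?B])
      qed
    qed
  qed
  then have "V.dim = card ?B" by (rule V.dim_basis[OF fin])
  then show ?thesis by (simp add: dimU_def card_image inj_elem_mat)
qed

lemma dimU_1_unique:
  assumes "dimU TYPE('f::field) m g = 1" "edge m p q g" "edge m p' q' g"
  shows "p' = p \<and> q' = q"
proof -
  obtain s where "edges m g = {s}"
    using assms(1) unfolding dimU_eq One_nat_def card_1_singleton_iff by blast
  moreover have "(p, q) \<in> edges m g" "(p', q') \<in> edges m g"
    using assms(2,3) edge_less by (auto simp: edges_def)
  ultimately show ?thesis by auto
qed

text \<open>Mirroring fixes this edge, so \<open>edge_fold\<close> leaves no other edge of its
  degree. In degree 0 all diagonal positions count, hence m = 1 there.\<close>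

lemma dimU_1_edge:
  assumes "edge m a (mirror m a) g" "g \<noteq> 0 \<or> m = 1"
  shows "dimU TYPE('f::field) m g = 1"
proof -
  have "edges m g = {(a, mirror m a)}"
  proof (intro equalityI subsetI)
    fix s assume "s \<in> edges m g"
    then obtain p q where s: "s = (p, q)" "p < m" "edge m p q g" by (auto simp: edges_def)
    have "p = a \<and> q = mirror m a"
    proof (cases "g = 0")
      case True
      then show ?thesis using s assms edge_less[OF assms(1)] by (auto simp: edge_zero)
    next
      case False
      then show ?thesis
        using edge_fold[OF assms(1) s(3)] edge_less[OF assms(1)] edge_less_iff[OF assms(1)] by auto
    qed
    then show "s \<in> {(a, mirror m a)}" using s by simp
  qed (use assms edge_less in \<open>auto simp: edges_def\<close>)
  then show ?thesis by (simp add: dimU_eq)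
qed

text \<open>The mirrored edge has the same degree, so a lone edge is its own mirror image.\<close>

lemma dimU_1_mirror: "dimU TYPE('f::field) m g = 1 \<Longrightarrow> edge m p q g \<Longrightarrow> q = mirror m p"
  using dimU_1_unique[of m g p q "mirror m q" "mirror m p", where ?'f = 'f] edge_mirror[of m p q g] by auto

lemma UT_diff_path:
  assumes "inG m v" "inG m w"
    and "\<And>x y X. path False m x v y X \<longleftrightarrow> path False m x w y X"
  shows "fmonom v - fmonom w \<in> (UT_identities m :: (zgrp, 'f::field) fpoly set)"
proof -
  let ?f = "fmonom :: _ \<Rightarrow> (zgrp, 'f) fpoly"
  have "?f v + - ?f w \<in> carrier (free_alg (Zr m))"
    using assms by (intro free_alg_closed) (auto simp only: fmonom_carrier)
  then have "?f v - ?f w \<in> carrier (free_alg (Zr m))" by simp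
  moreover have "mono_entry m a x y v = mono_entry m a x y w" if "valid_eval m a" "x < m" "y < m"
    for x y and a :: "nat \<Rightarrow> zgrp \<Rightarrow> 'f mat"
    by (rule mono_entry_cong) (use assms that in auto)
  ultimately show ?thesis by (auto simp: UT_identities_iff ev_diff ev_fmonom)
qed

lemma basis_elts_Zr: "g \<in> basis_elts m \<Longrightarrow> g \<in> Zr m"
  by (auto simp: basis_elts_def intro: Zr_closed)

section \<open>Edges at the center for odd m\<close>

lemma vt_center: "odd m \<Longrightarrow> vt m (m div 2) = 0"
  by (subst vt_eq) (auto elim: oddE)

lemma mirror_center_iff: "a < m \<Longrightarrow> mirror m a = a \<longleftrightarrow> odd m \<and> a = m div 2"
  by (auto simp: mirror_def elim!: oddE) presburger

lemma edge_to_center: "odd m \<Longrightarrow> p < m div 2 \<Longrightarrow> edge m p (m div 2) (eb (Suc p))"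
  by (simp add: edge_def vt_center) (simp add: vt_eq)

lemma edge_from_center: "odd m \<Longrightarrow> m div 2 < p \<Longrightarrow> p < m \<Longrightarrow> edge m (m div 2) p (eb (m - p))"
  by (simp add: edge_def vt_center) (simp add: vt_eq)

text \<open>This gives the degrees in (c), (d) and (e) a geometric meaning: e_i belongs to one pair
  of mirrored edges, which join the center to a vertex and to its mirror image.\<close>

lemma basis_elt_edge:
  assumes "odd m" "edge m p q g"
  shows "g \<in> basis_elts m \<longleftrightarrow> p < q \<and> (p = m div 2 \<or> q = m div 2)"
proof
  assume "g \<in> basis_elts m"
  then obtain i where i: "1 \<le> i" "i \<le> m div 2" "g = eb i" by (auto simp: basis_elts_def)
  then have "edge m (i - 1) (m div 2) g" "i - 1 < m div 2"
    using edge_to_center[OF assms(1), of "i - 1"] by auto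
  from edge_fold[OF this(1) assms(2) this(2)] this(2) show "p < q \<and> (p = m div 2 \<or> q = m div 2)"
    using mirror_center_iff[of "m div 2" m] assms(1) edge_less[OF assms(2)]
    by (auto simp: mirror_def elim!: oddE)
next
  assume *: "p < q \<and> (p = m div 2 \<or> q = m div 2)"
  have lt: "q < m" using assms(2) edge_less by blast
  have "g = eb (Suc p) \<and> Suc p \<le> m div 2 \<or> g = eb (m - q) \<and> 1 \<le> m - q \<and> m - q \<le> m div 2"
    using * edge_to_center[OF assms(1), of p] edge_from_center[OF assms(1), of q] assms lt
    by (auto simp: edge_def elim!: oddE)
  then show "g \<in> basis_elts m" by (auto simp: basis_elts_def)
qed

lemma eb_diff_nonbasis: "i \<noteq> j \<Longrightarrow> eb j - eb i \<notin> basis_elts m"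
proof
  assume "i \<noteq> j" "eb j - eb i \<in> basis_elts m"
  then obtain k where "eb j - eb i = eb k" by (auto simp: basis_elts_def)
  from arg_cong[OF this, of "\<lambda>p. Poly_Mapping.lookup p i"] \<open>i \<noteq> j\<close> show False
    by (auto simp: eb_def lookup_minus lookup_single when_def split: if_splits)
qed

lemma eb_nonzero: "eb i \<noteq> 0"
  by (metis eb_def lookup_single_eq lookup_zero zero_neq_one)

lemma gens_subset_UT: "gens m \<subseteq> (UT_identities m :: (zgrp, 'f::field) fpoly set)"
proof -
  have edge0: "edge m x y 0 \<longleftrightarrow> x = y \<and> x < m" for x y by (rule edge_zero)
  have Z: "0 \<in> Zr m" by (rule Zr_closed)
  have "gens_a \<subseteq> (UT_identities m :: (zgrp, 'f) fpoly set)"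
    unfolding gens_a_def xvar_def fmonom_mult
    by (auto intro!: UT_diff_path simp: edge0 Z coord_def add_mset_commute)
  moreover have "gens_b m \<subseteq> (UT_identities m :: (zgrp, 'f) fpoly set)"
  proof
    fix p :: "(zgrp, 'f) fpoly" assume "p \<in> gens_b m"
    then obtain g where g: "g \<in> Zr m" "dimU TYPE('f) m g = 1" "p = xstar 1 g - xvar 1 g" by (auto simp: gens_b_def)
    have "coord m (Indet 1 g True) x y = coord m (Indet 1 g False) x y" if "edge m x y g" for x y
      using dimU_1_mirror[OF g(2) that] edge_less[OF that] by (simp add: coord_def)
    then show "p \<in> UT_identities m"
      unfolding g(3) xstar_def xvar_def
      using g by (intro UT_diff_path) auto
  qed
  moreover have "gens_c m \<subseteq> (UT_identities m :: (zgrp, 'f) fpoly set)" if "odd m"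
  proof
    fix p :: "(zgrp, 'f) fpoly" assume "p \<in> gens_c m"
    then obtain g h where g: "g \<in> basis_elts m" "h \<in> basis_elts m"
      "p = fmonom [Indet 1 g False, Indet 2 0 False, Indet 3 h False]
        - fmonom [Indet 1 g False, Indet 2 0 True, Indet 3 h False]"
      by (auto simp: gens_c_def xvar_def xstar_def fmonom_mult)
    \<comment> \<open>Both edges touch the center and neither is a loop; if they did not meet there,
      the center would lie both before and after c.\<close>
    have c: "c = mirror m c" if "edge m x c g" "edge m c y h" for x c y
      using basis_elt_edge[OF \<open>odd m\<close> that(1)] basis_elt_edge[OF \<open>odd m\<close> that(2)] g mirror_center_iff[of c m] \<open>odd m\<close>
        edge_less[OF that(2)] by auto
    have path: "path False m x [Indet 1 g False, Indet 2 0 b, Indet 3 h False] y X \<longleftrightarrow>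
        (\<exists>c. edge m x c g \<and> edge m c y h \<and>
          X = {#coord m (Indet 1 g False) x c, coord m (Indet 2 0 b) c c, coord m (Indet 3 h False) c y#})" for b x y X
      by (auto simp: edge0 dest: edge_less)
    show "p \<in> UT_identities m"
      unfolding g(3)
    proof (rule UT_diff_path)
      have "coord m (Indet 2 0 True) c c = coord m (Indet 2 0 False) c c" if "edge m x c g" "edge m c y h" for x c y
        using c[OF that] by (simp add: coord_def)
      then show "path False m x [Indet 1 g False, Indet 2 0 False, Indet 3 h False] y X \<longleftrightarrow>
          path False m x [Indet 1 g False, Indet 2 0 True, Indet 3 h False] y X" for x y X
        unfolding path by metis
    qed (use g Z basis_elts_Zr in auto)
  qed
  moreover have "gens_d m \<subseteq> (UT_identities m :: (zgrp, 'f) fpoly set)" if "odd m"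
  proof
    fix p :: "(zgrp, 'f) fpoly" assume "p \<in> gens_d m"
    then obtain g where g: "g \<in> basis_elts m" and
      p: "p = fmonom [Indet 1 0 False, Indet 2 g False, Indet 3 0 False]
        - fmonom [Indet 1 0 True, Indet 2 g False, Indet 3 0 False]
        - fmonom [Indet 1 0 False, Indet 2 g False, Indet 3 0 True]
        + fmonom [Indet 1 0 True, Indet 2 g False, Indet 3 0 True]"
        (is "p = fmonom (?w False False) - fmonom (?w True False) - fmonom (?w False True) + fmonom (?w True True)")
      by (auto simp: gens_d_def xvar_def xstar_def fmonom_mult)
    have G: "inG m (?w b b')" for b b' using g basis_elts_Zr Z by auto
    have carrier: "p \<in> carrier (free_alg (Zr m))"
    proof -
      let ?f = "fmonom :: _ \<Rightarrow> (zgrp, 'f) fpoly"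
      have "?f (?w False False) + - ?f (?w True False) + - ?f (?w False True) + ?f (?w True True) \<in> carrier (free_alg (Zr m))"
        using G by (intro free_alg_closed) (auto simp only: fmonom_carrier)
      then show ?thesis by (simp add: p)
    qed
    have "ev m a x y p = 0" if a: "valid_eval m a" and xy: "x < m" "y < m" for a x y
    proof -
      have path: "path False m x (?w b b') y X \<longleftrightarrow> edge m x y g \<and>
        X = {#coord m (Indet 1 0 b) x x, coord m (Indet 2 g False) x y, coord m (Indet 3 0 b') y y#}" for b b' X
        using xy by (auto simp: edge0)
      \<comment> \<open>The edge has one end at the center, where a star is invisible; on that side
        the four terms cancel in pairs.\<close>
      consider "\<not> edge m x y g" | "x = mirror m x" | "y = mirror m y"
        using basis_elt_edge[OF \<open>odd m\<close>, of x y g] g mirror_center_iff[of x m] mirror_center_iff[of y m] \<open>odd m\<close> xy by auto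
      then show ?thesis
      proof cases
        case 1
        then have "mono_entry m a x y (?w b b') = 0" for b b'
          by (intro mono_entry_nopath[OF a G xy]) (simp only: path, simp)
        then show ?thesis by (simp add: p ev_add ev_diff ev_fmonom)
      next
        case 2
        then have "mono_entry m a x y (?w True b') = mono_entry m a x y (?w False b')" for b'
          by (intro mono_entry_cong[OF a G G xy xy]) (simp only: path, simp add: coord_def)
        then show ?thesis by (simp add: p ev_add ev_diff ev_fmonom)
      next
        case 3
        then have "mono_entry m a x y (?w b True) = mono_entry m a x y (?w b False)" for b
          by (intro mono_entry_cong[OF a G G xy xy]) (simp only: path, simp add: coord_def)
        then show ?thesis by (simp add: p ev_add ev_diff ev_fmonom)
      qed
    qed
    with carrier show "p \<in> UT_identities m" by (simp add: UT_identities_iff)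
  qed
  moreover have "gens_e m \<subseteq> (UT_identities m :: (zgrp, 'f) fpoly set)" if "odd m"
  proof
    fix p :: "(zgrp, 'f) fpoly" assume "p \<in> gens_e m"
    then obtain i j where ij: "i \<in> {2..m div 2}" "j \<in> {1..<i}" and
      p: "p = fmonom [Indet 1 0 False, Indet 2 (eb i) False, Indet 3 (eb j - eb i) False]
        - fmonom [Indet 1 0 True, Indet 2 (eb i) False, Indet 3 (eb j - eb i) False]"
      by (auto simp: gens_e_def xvar_def xstar_def fmonom_mult)
    \<comment> \<open>The degree e_j - e_i is nonzero and not in the basis, so the second edge
      avoids the center, and the first edge can touch it only at its start x.\<close>
    have c: "x = mirror m x" if "edge m x c (eb i)" "edge m c y (eb j - eb i)" for x c y
    proof -
      have "eb i \<in> basis_elts m" using ij by (auto simp: basis_elts_def)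
      then have "x < c" "x = m div 2 \<or> c = m div 2" using basis_elt_edge[OF \<open>odd m\<close> that(1)] by auto
      moreover have "c \<noteq> m div 2"
      proof
        assume "c = m div 2"
        have "eb j - eb i \<noteq> 0"
        proof
          assume "eb j - eb i = 0"
          from arg_cong[OF this, of "\<lambda>p. Poly_Mapping.lookup p i"] ij show False
            by (auto simp: eb_def lookup_minus lookup_single when_def)
        qed
        then have "c < y" using edge_less_iff[OF that(2)] by simp
        then show False
          using \<open>c = m div 2\<close> basis_elt_edge[OF \<open>odd m\<close> that(2)] eb_diff_nonbasis[of i j m] ij by auto
      qed
      ultimately show ?thesis using mirror_center_iff[of x m] \<open>odd m\<close> edge_less[OF that(1)] by auto
    qed
    have path: "path False m x [Indet 1 0 b, Indet 2 (eb i) False, Indet 3 (eb j - eb i) False] y X \<longleftrightarrow>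
        (\<exists>c. edge m x c (eb i) \<and> edge m c y (eb j - eb i) \<and> X = {#coord m (Indet 1 0 b) x x,
          coord m (Indet 2 (eb i) False) x c, coord m (Indet 3 (eb j - eb i) False) c y#})" for b x y X
      by (auto simp: edge0 dest: edge_less)
    show "p \<in> UT_identities m"
      unfolding p
    proof (rule UT_diff_path)
      have "coord m (Indet 1 0 True) x x = coord m (Indet 1 0 False) x x"
        if "edge m x c (eb i)" "edge m c y (eb j - eb i)" for x c y
        using c[OF that] by (simp add: coord_def)
      then show "path False m x [Indet 1 0 False, Indet 2 (eb i) False, Indet 3 (eb j - eb i) False] y X \<longleftrightarrow>
          path False m x [Indet 1 0 True, Indet 2 (eb i) False, Indet 3 (eb j - eb i) False] y X" for x y X
        unfolding path by metis
    qed (use ij Z in \<open>auto intro!: Zr_closed\<close>)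
  qed
  moreover have "gens_f m \<subseteq> (UT_identities m :: (zgrp, 'f) fpoly set)"
    by (auto simp: gens_f_def)
  ultimately show ?thesis by (auto simp: gens_def)
qed

lemma basis_ideal_UT: "0 < m \<Longrightarrow> basis_ideal m (UT_identities m :: (zgrp, 'f::field) fpoly set)"
  by (intro basis_ideal.intro T_ideal_UT_identities gens_subset_UT)


section \<open>Words with the same path monomial are congruent\<close>

lemma nopath_UT:
  assumes "inG m w" "\<nexists>a b X. path False m a w b X"
  shows "fmonom w \<in> UT_identities m"
  using assms by (auto simp: UT_identities_iff fmonom_carrier ev_fmonom intro!: mono_entry_nopath)

text \<open>The blocks are the words to be substituted for the indeterminates in (f).\<close>

lemma split_blocks: "nz w \<noteq> 0 \<Longrightarrow> \<exists>ws. concat ws = w \<and> length ws = nz w \<and> (\<forall>u \<in> set ws. nz u = 1)"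
proof (induction "nz w" arbitrary: w)
  case (Suc n)
  obtain u l v where w: "w = u @ l # v" "nz u = 0" "vdeg l \<noteq> 0" using split_first_nz[of w] Suc.prems by blast
  show ?case
  proof (cases "nz v = 0")
    case True
    with w show ?thesis by (intro exI[of _ "[w]"]) simp
  next
    case False
    moreover have "n = nz v" using w Suc(2) by simp
    ultimately obtain ws where ws: "concat ws = v \<and> length ws = nz v \<and> (\<forall>u \<in> set ws. nz u = 1)"
      using Suc(1) by blast
    with w show ?thesis by (intro exI[of _ "(u @ [l]) # ws"]) simp
  qed
qed simp

text \<open>Letters of degree 0 add only loops, so a block behaves like one letter of its
  degree.\<close>

lemma path_one_nz:
  assumes "nz u = 1" "edge m a c (wdeg u)"
  shows "\<exists>X. path False m a u c X"
proof -
  obtain x l y where u: "u = x @ l # y" "nz x = 0" "vdeg l \<noteq> 0" using split_first_nz[of u] assms(1) by auto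
  then have y: "nz y = 0" using assms(1) by simp
  obtain X where X: "path False m a x a X" using path_zero_ex[OF u(2)] edge_less[OF assms(2)] by blast
  obtain Y where Y: "path False m c y c Y" using path_zero_ex[OF y] edge_less[OF assms(2)] by blast
  have "edge m a c (vdeg l)" using assms(2) u y by (simp add: wdeg_nz_0)
  with Y have "path False m a (l # y) c (add_mset (coord m l a c) Y)" by auto
  with X show ?thesis unfolding u(1) path_append by blast
qed

text \<open>Used in the contrapositive: if a word has no path, neither has the word formed by the
  degrees of its blocks, and the latter is a monomial of type (f) when there are at most three
  blocks.\<close>

lemma path_concat:
  assumes "list_all2 (\<lambda>l u. vdeg l = wdeg u) xs ws" "\<forall>u \<in> set ws. nz u = 1" "path False m a xs b X"
  shows "\<exists>Y. path False m a (concat ws) b Y"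
  using assms
proof (induction xs ws arbitrary: a X rule: list_all2_induct)
  case (Cons l xs u ws)
  then obtain c Z where *: "edge m a c (wdeg u)" "path False m c xs b Z" by auto
  obtain Y where "path False m c (concat ws) b Y" using Cons.IH[OF _ *(2)] Cons.prems by auto
  moreover obtain Y' where "path False m a u c Y'" using path_one_nz[OF _ *(1)] Cons.prems by auto
  ultimately show ?case by (auto simp: path_append)
qed auto

lemma nz_1_wdeg: "nz u = 1 \<Longrightarrow> wdeg u \<noteq> 0"
proof -
  assume "nz u = 1"
  then obtain x l y where "u = x @ l # y" "nz x = 0" "vdeg l \<noteq> 0" using split_first_nz[of u] by auto
  with \<open>nz u = 1\<close> show ?thesis by (simp add: wdeg_nz_0)
qed

definition unst :: "zgrp indet \<Rightarrow> zgrp indet" where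
  "unst l = Indet (vind l) (vdeg l) False"

lemma unst_simps [simp]: "vind (unst l) = vind l" "vdeg (unst l) = vdeg l" "\<not> starred (unst l)"
  by (simp_all add: unst_def)

lemma unst_cases: "unst l = l \<or> l = indet_star (unst l)"
  by (cases l) (auto simp: unst_def indet_star_def)

context basis_ideal
begin

text \<open>A word with at least four letters of nonzero degree and no path loses its first or its last
  block without acquiring one: the middle part has at most one path, so paths of the two
  shorter words would fit together.\<close>

lemma nopath_I:
  assumes "inG m w" "\<nexists>a b X. path False m a w b X"
  shows "fmonom w \<in> I"
  using assms
proof (induction "nz w" arbitrary: w rule: less_induct)
  case less
  \<comment> \<open>Letters of degree 0 alone would give a path that stays at index 0, which exists
    as m > 0.\<close>
  have nz0: "nz w \<noteq> 0" using path_zero_ex[of w 0 m] m_pos less.prems by blast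
  show ?case
  proof (cases "nz w \<le> 3")
    case True
    obtain ws where ws: "concat ws = w" "length ws = nz w" "\<forall>u \<in> set ws. nz u = 1"
      using split_blocks[OF nz0] by blast
    let ?x = "map (\<lambda>i. Indet i (wdeg (ws ! (i - 1))) False) [1..<Suc (length ws)]"
    have G: "inG m u" if "u \<in> set ws" for u
      using less.prems(1) that ws(1) by (auto simp: inG_def)
    have "fmonom ?x \<in> (UT_identities m :: (zgrp, 'f) fpoly set)"
    proof (rule nopath_UT)
      have "wdeg u \<in> Zr m" if "u \<in> set ws" for u using wdeg_Zr[OF G[OF that]] .
      then show "inG m ?x" by (auto simp: inG_def)
      have "list_all2 (\<lambda>l u. vdeg l = wdeg u) ?x ws"
        by (auto simp: list_all2_conv_all_nth nth_append simp del: upt_Suc)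
      then show "\<nexists>a b X. path False m a ?x b X"
        using path_concat[OF _ ws(3)] less.prems(2) ws(1) by blast
    qed
    then have "fmonom (concat ws) \<in> I"
      using ws True G nz_1_wdeg by (intro I_blocks) auto
    then show ?thesis using ws by simp
  next
    case False
    obtain x l v where w: "w = x @ l # v" "nz x = 0" "vdeg l \<noteq> 0" using split_first_nz[OF nz0] by blast
    then have "nz v \<noteq> 0" using False by auto
    then obtain v1 l' y where v: "v = v1 @ l' # y" "nz y = 0" "vdeg l' \<noteq> 0" using split_last_nz by blast
    let ?x = "x @ [l]" and ?y = "l' # y"
    have w': "w = ?x @ v1 @ ?y" using w v by simp
    have n: "nz ?x = 1" "nz ?y = 1" using w v by simp_all
    then have n1: "2 \<le> nz v1" using False w' by simp
    have G: "inG m ?x" "inG m v1" "inG m ?y" using less.prems(1) w' by auto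
    consider (1) "\<nexists>a b X. path False m a (?x @ v1) b X" | (2) "\<nexists>a b X. path False m a (v1 @ ?y) b X"
      | (3) a b X a' b' X' where "path False m a (?x @ v1) b X" "path False m a' (v1 @ ?y) b' X'" by blast
    then show ?thesis
    proof cases
      case 1
      have "fmonom (?x @ v1) \<in> I" by (rule less.hyps) (use 1 G n w' in auto)
      then show ?thesis
        using I_mult_right[of "fmonom (?x @ v1)" "fmonom ?y"] G w' by (simp add: fmonom_mult fmonom_carrier)
    next
      case 2
      have "fmonom (v1 @ ?y) \<in> I" by (rule less.hyps) (use 2 G n w' in auto)
      then show ?thesis
        using I_mult_left[of "fmonom (v1 @ ?y)" "fmonom ?x"] G w' by (simp add: fmonom_mult fmonom_carrier)
    next
      case 3
      obtain c Y Z where p: "path False m a ?x c Y" "path False m c v1 b Z"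
        using 3(1) unfolding path_append[of _ _ _ ?x] by blast
      obtain d Y' Z' where q: "path False m a' v1 d Y'" "path False m d ?y b' Z'"
        using 3(2) unfolding path_append[of _ _ _ v1] by blast
      have "a' = c" "d = b" using path_unique2[OF p(2) q(1) n1] by auto
      then have "\<exists>X. path False m a (?x @ v1 @ ?y) b' X"
        using p q unfolding path_append[of _ _ _ ?x] path_append[of _ _ _ v1] by blast
      then show ?thesis using less.prems(2) w' by metis
    qed
  qed
qed

section \<open>Removal of stars at the center\<close>

lemma toggle_start:
  assumes "path False m f s f Y" "path False m f t e Z" "mirror m f = f" "vdeg z = 0" "2 \<le> nz t"
  shows "eqv (s @ z # t) (s @ indet_star z # t)"
proof -
  have "f < m" using path_less[OF assms(1)] by blast
  then have odd: "odd m" and f: "f = m div 2" using mirror_center_iff assms(3) by blast+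
  obtain x l y where t: "t = x @ l # y" "nz x = 0" "vdeg l \<noteq> 0" using split_first_nz[of t] assms(5) by auto
  then have nzy: "nz y \<noteq> 0" using assms(5) by auto
  have t': "t = (x @ [l]) @ y" using t by simp
  obtain d D E where p: "path False m f (x @ [l]) d D" "path False m d y e E"
    using assms(2) unfolding t' path_append[of _ _ _ "x @ [l]"] by blast
  have lt: "f < d" "d < e" "e < m" using path_nz[OF p(1)] path_nz[OF p(2)] path_less[OF p(1)] path_less[OF p(2)] t nzy by auto
  have vt: "vt m q = - eb (m - q)" if "f < q" "q < m" for q
    using that odd f by (simp add: vt_eq)
  \<comment> \<open>The path runs through the center, d and e, so in the notation of (e) the indices
    are i = m - d and j = m - e.\<close>
  have d: "wdeg (x @ [l]) = eb (m - d)"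
    using path_edge[OF p(1)] vt[of d] lt odd f by (simp add: edge_def vt_center)
  have e: "wdeg y = eb (m - e) - eb (m - d)"
    using path_edge[OF p(2)] vt[of d] vt[of e] lt by (simp add: edge_def)
  have "eqv ([z] @ (x @ [l]) @ y) (wstar [z] @ (x @ [l]) @ y)"
    by (rule eqv_start[OF odd _ _ _ _ d e])
      (use lt f odd assms(4) path_inG[OF p(1)] path_inG[OF p(2)] Zr_closed(1) in \<open>auto elim!: oddE\<close>)
  from eqv_left[OF this path_inG[OF assms(1)]] show ?thesis using t by simp
qed

text \<open>\<open>H\<close> excludes the words for which another path sees the star: for m > 1
  those with no letter of nonzero degree, and those with one such letter and an end at the center.
  Otherwise (c) applies if the center is passed in between, (e) if it is the start, the reverse of
  (e) if it is the end; for m = 1 it is (b) in degree 0.\<close>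

lemma toggle:
  assumes "path False m a s f Y" "path False m f t e Z" "mirror m f = f" "vdeg z = 0"
    and H: "2 \<le> nz (s @ t) \<or> m = 1 \<or> mirror m a \<noteq> a \<and> mirror m e \<noteq> e"
  shows "eqv (s @ z # t) (s @ indet_star z # t)"
proof -
  have lt: "a \<le> f" "f \<le> e" "f < m" using path_less[OF assms(1)] path_less[OF assms(2)] by auto
  then have odd: "odd m" and f: "f = m div 2" using mirror_center_iff assms(3) by blast+
  have G: "inG m s" "inG m t" "inG m [z]"
    using path_inG[OF assms(1)] path_inG[OF assms(2)] assms(4) Zr_closed(1) by auto
  consider "m = 1" | "a < f" "f < e" | "a = f" "2 \<le> nz t" | "e = f" "2 \<le> nz s"
    using H lt assms(3) path_nz[OF assms(1)] path_nz[OF assms(2)] by fastforce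
  then show ?thesis
  proof cases
    case 1
    then have "edge m 0 (mirror m 0) 0" by (simp add: edge_zero mirror_def)
    then have "dimU TYPE('f) m (wdeg [z]) = 1" using dimU_1_edge[of m 0 0] 1 assms(4) by simp
    from eqv_sym[OF eqv_wstar[OF G(3) this]] have "eqv [z] [indet_star z]" by simp
    from eqv_context[OF this G(1,2)] show ?thesis by simp
  next
    case 2
    have "eqv (s @ [z] @ t) (s @ wstar [z] @ t)"
      by (rule eqv_inner)
        (use 2 G odd f assms(4) basis_elt_edge[OF odd path_edge[OF assms(1)]] basis_elt_edge[OF odd path_edge[OF assms(2)]] in auto)
    then show ?thesis by simp
  next
    case 3
    then show ?thesis using toggle_start[of f s Y t e Z z] assms by simp
  next
    case 4
    have "path False m f (wstar t) f Z" "path False m f (wstar s) (mirror m a) Y"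
      using path_star[OF assms(2)] path_star[OF assms(1)] assms(3) 4 by auto
    from toggle_start[OF this assms(3), of "indet_star z"]
    have "eqv (wstar t @ indet_star z # wstar s) (wstar t @ z # wstar s)"
      using assms(4) 4 by simp
    from eqv_star[OF this] show ?thesis by simp
  qed
qed

text \<open>The neighbours \<open>s\<close> and \<open>t\<close> do not change, but they take part:
  removing a star in \<open>w\<close> by (c) or (e) may involve letters on either side of
  \<open>w\<close>.\<close>

lemma toggle_all:
  assumes "path False m a s c S" "path False m c w d X" "path False m d t e T"
    and "2 \<le> nz (s @ w @ t) \<or> m = 1 \<or> mirror m a \<noteq> a \<and> mirror m e \<noteq> e"
  shows "\<exists>w'. path True m c w' d X \<and> eqv (s @ w @ t) (s @ w' @ t) \<and> nz w' = nz w"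
  using assms
proof (induction w arbitrary: s c S X)
  case Nil
  then show ?case by (intro exI[of _ "[]"]) simp
next
  case (Cons l w)
  from Cons.prems(2) obtain c' X' where *: "edge m c c' (vdeg l)" "path False m c' w d X'" "X = add_mset (coord m l c c') X'"
    by auto
  define l' where "l' = (if vdeg l = 0 \<and> mirror m c = c \<and> starred l then indet_star l else l)"
  have v: "vdeg l' = vdeg l" by (simp add: l'_def)
  have c: "coord m l' c c' = coord m l c c'"
    using *(1) by (auto simp: l'_def coord_def edge_zero)
  have "path False m c [l'] c' {#coord m l c c'#}"
    using *(1) v c edge_less[OF *(1)] by auto
  with Cons.prems(1) have s: "path False m a (s @ [l']) c' (S + {#coord m l c c'#})"
    unfolding path_append[of _ _ _ s] by blast
  have n: "2 \<le> nz ((s @ [l']) @ w @ t) \<or> m = 1 \<or> mirror m a \<noteq> a \<and> mirror m e \<noteq> e"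
    using Cons.prems(4) v by simp
  obtain w' where w': "path True m c' w' d X'" "eqv ((s @ [l']) @ w @ t) ((s @ [l']) @ w' @ t)" "nz w' = nz w"
    using Cons.IH[OF s *(2) Cons.prems(3) n] by blast
  have "eqv (s @ l # w @ t) (s @ l' # w @ t)"
  proof (cases "l' = l")
    case False
    then have l: "vdeg l = 0" "mirror m c = c" "l' = indet_star l" by (auto simp: l'_def split: if_splits)
    then have "c' = c" using *(1) by (simp add: edge_zero)
    then have wt: "path False m c (w @ t) e (X' + T)" using *(2) Cons.prems(3) unfolding path_append[of _ _ _ w] by blast
    show ?thesis
      using toggle[OF Cons.prems(1) wt l(2,1)] Cons.prems(4) l by simp
  qed simp
  also have "eqv (s @ l' # w @ t) (s @ l' # w' @ t)" using w'(2) by simp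
  finally have "eqv (s @ (l # w) @ t) (s @ (l' # w') @ t)" by simp
  moreover have "path True m c (l' # w') d X"
    using w'(1) *(1,3) v c by (auto simp: l'_def)
  ultimately show ?case using w'(3) v by (intro exI[of _ "l' # w'"]) simp
qed

lemma eqv_palindrome:
  assumes "path u m a s (mirror m a) X" "mirror m a \<noteq> a"
  shows "eqv s (wstar s)"
proof -
  have "wdeg s \<noteq> 0" using path_wdeg_nz[OF assms(1)] path_nz[OF assms(1)] assms(2) by auto
  then have "dimU TYPE('f) m (wdeg s) = 1" using dimU_1_edge[OF path_edge[OF assms(1)]] by blast
  then show ?thesis using eqv_sym[OF eqv_wstar[OF path_inG[OF assms(1)]]] by blast
qed

text \<open>If the letter \<open>l\<close> is read in \<open>w\<close> on the mirrored edge, the prefix of \<open>w\<close> up to it leads from \<open>a\<close> to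
  \<open>mirror m a\<close>, has a degree with a one-dimensional component, and may be reversed.\<close>

lemma pull_first:
  assumes w: "path True m a w b X" and k: "coord m l a c \<in># X" and e: "edge m a c (vdeg l)"
    and l: "vdeg l = 0 \<and> mirror m a = a \<longrightarrow> \<not> starred l"
    and first: "a = c \<or> vdeg (hd w) \<noteq> 0"
  shows "\<exists>v. eqv w (l # v) \<and> path True m c v b (X - {#coord m l a c#})"
proof -
  obtain x l' y c' d' Y Z where *: "w = x @ l' # y" "coord m l a c = coord m l' c' d'" "path True m a x c' Y"
    "edge m c' d' (vdeg l')" "path True m d' y b Z" "X = add_mset (coord m l a c) (Y + Z)"
    "True \<and> vdeg l' = 0 \<and> mirror m c' = c' \<longrightarrow> \<not> starred l'"
    using path_memE[OF w k] by metis
  have lt: "a < m" "c < m" "a \<le> c" using edge_less[OF e] by auto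
  have G: "inG m x" "inG m y" "vdeg l' \<in> Zr m" using path_inG[OF w] *(1) by auto
  note D = coord_eqD[OF *(2) e *(4)]
  show ?thesis
  proof (cases "c' = a \<and> d' = c")
    case True
    \<comment> \<open>The prefix stays at index a. If l has degree 0 the prefix commutes with it by
      (a); if not, \<open>first\<close> makes the prefix empty.\<close>
    then have x: "nz x = 0" using path_nz[OF *(3)] by auto
    from D(2) True consider "l' = l" | "l' \<noteq> l" "l' = indet_star l" "c = mirror m a" by auto
    then show ?thesis
    proof cases
      case 1
      show ?thesis
      proof (cases "a = c")
        case True
        then have "vdeg l = 0" using e by (auto simp: edge_refl)
        then have "eqv (x @ [l]) ([l] @ x)"
          using G x 1 by (intro eqv_comm) (auto simp: wdeg_nz_0)
        from eqv_right[OF this G(2)] have "eqv w (l # x @ y)" using 1 *(1) by simp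
        moreover have "path True m a (x @ y) b (Y + Z)"
          unfolding path_append using *(3,5) \<open>c' = a \<and> d' = c\<close> True by blast
        ultimately show ?thesis using True *(6) by auto
      next
        case False
        then have "vdeg (hd w) \<noteq> 0" using first by simp
        then have "x = []" using *(1) x by (cases x) auto
        then show ?thesis using * 1 True by (intro exI[of _ y]) auto
      qed
    next
      case 2
      show ?thesis
      proof (cases "a = c")
        case True
        \<comment> \<open>At the center both letters are known to be unstarred, so one cannot be the
          star of the other.\<close>
        then have "vdeg l = 0" "mirror m a = a" using e 2 by (auto simp: edge_refl)
        then show ?thesis using l *(7) 2 \<open>c' = a \<and> d' = c\<close> D(1) by auto
      next
        case False
        then have "vdeg (hd w) \<noteq> 0" using first by simp
        then have x: "x = []" using *(1) x by (cases x) auto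
        have "path False m a [l] c {#coord m l a c#}" using e lt by auto
        then have "eqv [l] (wstar [l])" using eqv_palindrome 2 False by metis
        then have "eqv [indet_star l] [l]" using eqv_sym by simp
        from eqv_right[OF this G(2)] have "eqv w (l # y)" using 2 *(1) x by simp
        then show ?thesis using * x True by auto
      qed
    qed
  next
    case False
    then have B: "c' = mirror m c" "d' = mirror m a" "l' = indet_star l" using D(2) by auto
    have ne: "mirror m a \<noteq> a"
    proof
      assume "mirror m a = a"
      then have "mirror m c \<le> a" using mirror_mono[OF lt(3), of m] by simp
      moreover have "a \<le> mirror m c" using path_less[OF *(3)] B by simp
      ultimately have "mirror m c = a" by simp
      then have "c = a" using mirror_mirror[OF lt(2)] \<open>mirror m a = a\<close> by simp
      then show False using False B \<open>mirror m a = a\<close> by simp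
    qed
    have p1: "path False m c' [l'] (mirror m a) {#coord m l a c#}" using *(2,4) B edge_less[OF *(4)] by auto
    then have "path False m a (x @ [l']) (mirror m a) (Y + {#coord m l a c#})"
      unfolding path_append using path_weaken[OF *(3)] by blast
    from eqv_palindrome[OF this ne] have 1: "eqv (x @ [l']) (l # wstar x)" using B by simp
    \<comment> \<open>Reversing the prefix stars its letters read at the center. The ends a and
      \<open>mirror m a\<close> are not central, so these stars can be removed again and the flag is
      recovered.\<close>
    have p2: "path False m c (wstar x) (mirror m a) Y" using path_star[OF *(3)] B lt by simp
    have "path False m a [l] c {#coord m l a c#}" using e lt by auto
    moreover have "path False m (mirror m a) [] (mirror m a) {#}" using lt by simp
    ultimately obtain x' where x': "path True m c x' (mirror m a) Y" "eqv (l # wstar x) (l # x')"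
      using toggle_all[of a "[l]" c _ "wstar x" "mirror m a" Y "[]" "mirror m a"] p2 ne lt by auto
    have "eqv ((x @ [l']) @ y) ((l # x') @ y)"
      by (rule eqv_right[OF eqv_trans[OF 1 x'(2)] G(2)])
    then have "eqv w (l # x' @ y)" using *(1) by simp
    moreover have "path True m c (x' @ y) b (Y + Z)"
      unfolding path_append using x'(1) *(5) B by blast
    ultimately show ?thesis using *(6) by auto
  qed
qed

text \<open>A letter of nonzero degree cannot be pulled past leading letters of degree 0. So if
  exactly one of the two first letters has degree 0, that letter is the one pulled to the front of
  the other word.\<close>

lemma eqv_path:
  assumes "path True m a v b X" "path True m a w b X"
  shows "eqv v w"
  using assms
proof (induction "size X" arbitrary: a v w X)
  case 0
  then show ?case using path_size[OF 0(2)] path_size[OF 0(3)] by simp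
next
  case (Suc n)
  have "v \<noteq> []" "w \<noteq> []" using path_size[OF Suc(3)] path_size[OF Suc(4)] Suc(2) by auto
  then obtain l v1 l' w1 where vw: "v = l # v1" "w = l' # w1" by (metis list.exhaust)
  have G: "vdeg l \<in> Zr m" "vdeg l' \<in> Zr m" using path_inG[OF Suc(3)] path_inG[OF Suc(4)] vw by auto
  obtain c Y where v: "edge m a c (vdeg l)" "path True m c v1 b Y" "X = add_mset (coord m l a c) Y"
    "vdeg l = 0 \<and> mirror m a = a \<longrightarrow> \<not> starred l" using Suc(3) vw(1) by auto
  obtain c' Y' where w: "edge m a c' (vdeg l')" "path True m c' w1 b Y'" "X = add_mset (coord m l' a c') Y'"
    "vdeg l' = 0 \<and> mirror m a = a \<longrightarrow> \<not> starred l'" using Suc(4) vw(2) by auto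
  show ?case
  proof (cases "vdeg l = 0 \<or> vdeg l' \<noteq> 0")
    case True
    then have "a = c \<or> vdeg (hd w) \<noteq> 0" using v(1) vw by (auto simp: edge_zero)
    then obtain u where u: "eqv w (l # u)" "path True m c u b Y"
      using pull_first[OF Suc(4) _ v(1,4)] v(3) by auto
    have "eqv v1 u" using Suc(1)[OF _ v(2) u(2)] Suc(2) v(3) by simp
    from eqv_left[OF this, of "[l]"] have "eqv v (l # u)" using G vw by simp
    then show ?thesis using eqv_trans eqv_sym[OF u(1)] by blast
  next
    case False
    then have "a = c'" using w(1) by (auto simp: edge_zero)
    then obtain u where u: "eqv v (l' # u)" "path True m c' u b Y'"
      using pull_first[OF Suc(3) _ w(1,4)] w(3) by auto
    have "eqv u w1" using Suc(1)[OF _ u(2) w(2)] Suc(2) w(3) by simp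
    from eqv_left[OF this, of "[l']"] have "eqv (l' # u) w" using G vw by simp
    then show ?thesis using eqv_trans[OF u(1)] by blast
  qed
qed

lemma eqv_path_toggle:
  assumes "path False m a v b X" "path False m a w b X"
    and "2 \<le> nz v \<or> m = 1 \<or> mirror m a \<noteq> a \<and> mirror m b \<noteq> b"
  shows "eqv v w"
proof -
  have *: "\<exists>v'. path True m a v' b X \<and> eqv v v'"
    if "path False m a v b X" "2 \<le> nz v \<or> m = 1 \<or> mirror m a \<noteq> a \<and> mirror m b \<noteq> b" for v
  proof -
    have "path False m a [] a {#}" "path False m b [] b {#}" using path_less[OF that(1)] by auto
    from toggle_all[OF this(1) that(1) this(2)] that(2) show ?thesis by auto
  qed
  obtain v' where "path True m a v' b X" "eqv v v'" using *[OF assms(1,3)] by blast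
  moreover obtain w' where "path True m a w' b X" "eqv w w'"
    using *[OF assms(2)] assms(3) path_nz_eq[OF assms(1,2)] by auto
  ultimately show ?thesis using eqv_path eqv_trans eqv_sym by meson
qed

text \<open>Relation (d) is bilinear in its two differences. The difference between a word and its
  unstarred form telescopes over the letters, on the left first and then on the right; the letters
  of degree 0 left over are absorbed into \<open>s\<close> or stand outside as factors.\<close>

lemma two_sided_expand:
  assumes "odd m" "inG m u" "inG m v" "nz u = 0" "nz v = 0" "inG m s" "wdeg s \<in> basis_elts m"
  shows "(fmonom u - fmonom (map unst u)) * fmonom s * (fmonom v - fmonom (map unst v)) \<in> I"
proof -
  let ?d = "\<lambda>u. fmonom u - fmonom (map unst u) :: (zgrp, 'f) fpoly"
  have un: "?d [l] * fmonom s * ?d [l'] \<in> I"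
    if l: "vdeg l = 0" "vdeg l' = 0" and s: "inG m s" "wdeg s \<in> basis_elts m" for l l' s
  proof -
    have *: "?d [l] = 0 \<or> ?d [l] = - (fmonom [unst l] - fmonom (wstar [unst l]))" for l
      using unst_cases[of l] by auto
    have "(fmonom [unst l] - fmonom (wstar [unst l])) * fmonom s * (fmonom [unst l'] - fmonom (wstar [unst l'])) \<in> I"
      by (rule two_sided_I) (use assms(1) l s Zr_closed(1) in auto)
    then show ?thesis using *[of l] *[of l'] I_zero
      by (elim disjE) (simp_all only: mult_minus_left mult_minus_right mult_zero_left mult_zero_right
        add.inverse_inverse add.inverse_neutral)
  qed
  have d_cons: "?d (l # u) = ?d [l] * fmonom u + fmonom [unst l] * ?d u" for l u
    by (simp add: algebra_simps fmonom_mult)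
  have d_snoc: "?d (u @ [l]) = ?d u * fmonom [l] + fmonom (map unst u) * ?d [l]" for l u
    by (simp add: algebra_simps fmonom_mult)
  have left: "?d u * fmonom s * ?d [l] \<in> I"
    if "nz u = 0" "inG m u" "vdeg l = 0" "inG m s" "wdeg s \<in> basis_elts m" for u s l
    using that
  proof (induction u)
    case Nil
    then show ?case by (simp add: I_zero)
  next
    case (Cons l' u)
    have "?d (l' # u) * fmonom s * ?d [l] =
        ?d [l'] * fmonom (u @ s) * ?d [l] + fmonom [unst l'] * (?d u * fmonom s * ?d [l])"
      by (subst d_cons) (simp add: distrib_right mult.assoc flip: fmonom_mult)
    moreover have "?d [l'] * fmonom (u @ s) * ?d [l] \<in> I"
      by (rule un) (use Cons.prems in \<open>auto simp: wdeg_nz_0 split: if_splits\<close>)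
    moreover have "fmonom [unst l'] * (?d u * fmonom s * ?d [l]) \<in> I"
      by (rule I_mult_left) (use Cons in \<open>auto simp: fmonom_carrier split: if_splits\<close>)
    ultimately show ?case using I_add by simp
  qed
  show ?thesis
    using assms(3,5)
  proof (induction v rule: rev_induct)
    case Nil
    then show ?case by (simp add: I_zero)
  next
    case (snoc l v)
    have "?d u * fmonom s * ?d (v @ [l]) =
        ?d u * fmonom s * ?d v * fmonom [l] + ?d u * fmonom (s @ map unst v) * ?d [l]"
      by (subst d_snoc) (simp add: distrib_left mult.assoc flip: fmonom_mult)
    moreover have "?d u * fmonom s * ?d v * fmonom [l] \<in> I"
      by (rule I_mult_right) (use snoc in \<open>auto simp: fmonom_carrier split: if_splits\<close>)
    moreover have "?d u * fmonom (s @ map unst v) * ?d [l] \<in> I"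
    proof (rule left)
      have "nz (map unst v) = 0" "inG m (map unst v)" using snoc.prems by (auto simp: nz_0_iff inG_def)
      then show "inG m (s @ map unst v)" "wdeg (s @ map unst v) \<in> basis_elts m" using assms by (auto simp: wdeg_nz_0)
    qed (use assms snoc.prems in \<open>auto split: if_splits\<close>)
    ultimately show ?case using I_add by simp
  qed
qed

end


section \<open>Elimination of path monomials\<close>

text \<open>Dedekind's independence of characters, for the multiplicative maps \<open>t \<mapsto> \<Prod>\<^bsub>v \<in> X\<^esub> t v\<close>.\<close>

lemma mset_prod_independent:
  fixes d :: "'v multiset \<Rightarrow> 'k::field_char_0"
  assumes "finite S" "\<And>t :: 'v \<Rightarrow> 'k. (\<Sum>X \<in> S. d X * prod_mset (image_mset t X)) = 0" "X \<in> S"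
  shows "d X = 0"
  using assms
proof (induction S arbitrary: d X)
  case (insert X0 S)
  let ?P = "\<lambda>t X. prod_mset (image_mset t X) :: 'k"
  have mult: "?P (\<lambda>v. s v * t v) X = ?P s X * ?P t X" for s t X
    by (induction X) (simp_all add: mult_ac)
  have S0: "d X = 0" if "X \<in> S" for X
  proof -
    \<comment> \<open>Subtracting the value of the character X0 at s times the relation at t from
      the relation at the product of s and t cancels the term of X0.\<close>
    have *: "d X * (?P s X - ?P s X0) = 0" for s
    proof (rule insert.IH[OF _ that])
      fix t
      have "(\<Sum>Y \<in> S. d Y * (?P s Y - ?P s X0) * ?P t Y) =
          (\<Sum>Y \<in> S. d Y * ?P (\<lambda>v. s v * t v) Y) - ?P s X0 * (\<Sum>Y \<in> S. d Y * ?P t Y)"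
        by (simp add: mult sum_distrib_left sum_subtractf algebra_simps)
      also have "\<dots> = (\<Sum>Y \<in> insert X0 S. d Y * ?P (\<lambda>v. s v * t v) Y) - ?P s X0 * (\<Sum>Y \<in> insert X0 S. d Y * ?P t Y)"
        using insert.hyps by (simp add: mult algebra_simps)
      finally show "(\<Sum>Y \<in> S. d Y * (?P s Y - ?P s X0) * ?P t Y) = 0"
        by (simp only: insert.prems(1) mult_zero_right diff_self)
    qed
    have "X \<noteq> X0" using that insert.hyps by blast
    then obtain v where v: "count X v \<noteq> count X0 v" by (meson multiset_eqI)
    \<comment> \<open>The value 2 at v separates the two exponents, since distinct powers of 2
      remain distinct in characteristic 0.\<close>
    define s :: "'v \<Rightarrow> 'k" where "s u = (if u = v then 2 else 1)" for u
    have P: "?P s Y = 2 ^ count Y v" for Y by (induction Y) (auto simp: s_def)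
    have "?P s X \<noteq> ?P s X0"
    proof
      assume "?P s X = ?P s X0"
      then have "of_nat (2 ^ count X v) = (of_nat (2 ^ count X0 v) :: 'k)" by (simp add: P)
      then show False using v by (simp only: of_nat_eq_iff) simp
    qed
    with *[of s] show ?thesis by simp
  qed
  moreover have "d X0 = 0"
    using insert.prems(1)[of "\<lambda>_. 1"] S0 insert.hyps by (simp add: image_mset_const_eq)
  ultimately show ?case using insert.prems(2) by blast
qed simp

lemma path_coord_edge: "path u m a w b X \<Longrightarrow> (i, p, q) \<in># X \<Longrightarrow> edge m p q (vt m p - vt m q)"
proof (induction w arbitrary: a X)
  case (Cons l w)
  then obtain c Y where *: "edge m a c (vdeg l)" "path u m c w b Y" "X = add_mset (coord m l a c) Y" by auto
  show ?case
  proof (cases "(i, p, q) = coord m l a c")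
    case True
    then show ?thesis using *(1) edge_mirror[OF *(1)] by (auto simp: coord_def edge_def split: if_splits)
  next
    case False
    with Cons * show ?thesis by auto
  qed
qed simp

text \<open>With arbitrary values t at all positions of the right degrees, the entry (x, y) of p
  becomes a combination of monomials in t; the sum in question is the coefficient of X, and the
  monomials are independent.\<close>

lemma class_sum_zero:
  fixes p :: "(zgrp, 'f::field_char_0) fpoly"
  assumes p: "p \<in> UT_identities m"
  shows "(\<Sum>w \<in> {w \<in> Poly_Mapping.keys p. path False m x (letters w) y X}. Poly_Mapping.lookup p w) = 0"
proof (cases "x < m \<and> y < m")
  case True
  define W where "W = {w \<in> Poly_Mapping.keys p. \<exists>X. path False m x (letters w) y X}"
  define \<mu> where "\<mu> w = (SOME X. path False m x (letters w) y X)" for w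
  have \<mu>: "path False m x (letters w) y (\<mu> w)" if "w \<in> W" for w
    using that someI_ex[of "\<lambda>X. path False m x (letters w) y X"] by (auto simp: W_def \<mu>_def)
  have W: "finite W" by (simp add: W_def)
  define d where "d X = (\<Sum>w \<in> {w \<in> W. \<mu> w = X}. Poly_Mapping.lookup p w)" for X
  have "d X = 0" if "X \<in> \<mu> ` W" for X
  proof (rule mset_prod_independent[OF _ _ that])
    show "finite (\<mu> ` W)" using W by simp
    fix t :: "nat \<times> nat \<times> nat \<Rightarrow> 'f"
    define a where "a i g = mat m m (\<lambda>(p, q). if edge m p q g then t (i, p, q) else 0)" for i g
    have a: "valid_eval m a" by (auto simp: valid_eval_def UT_comp_iff a_def)
    have cval: "image_mset (cval m a) X = image_mset t X" if "path False m x w y X" for w X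
    proof (rule image_mset_cong)
      fix k assume k: "k \<in># X"
      obtain i p q where "k = (i, p, q)" by (cases k) auto
      then show "cval m a k = t k" using path_coord_edge[OF that, of i p q] k edge_less
        by (auto simp: cval_def a_def)
    qed
    have G: "inG m (letters w)" if "w \<in> Poly_Mapping.keys p" for w
      using that UT_carrier[OF p] by (auto simp: carrier_free_alg_iff)
    have "(\<Sum>X \<in> \<mu> ` W. d X * prod_mset (image_mset t X)) =
        (\<Sum>X \<in> \<mu> ` W. \<Sum>w \<in> {w \<in> W. \<mu> w = X}. Poly_Mapping.lookup p w * prod_mset (image_mset t (\<mu> w)))"
      by (auto simp: d_def sum_distrib_right intro!: sum.cong)
    also have "\<dots> = (\<Sum>w \<in> W. Poly_Mapping.lookup p w * prod_mset (image_mset t (\<mu> w)))"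
      by (rule sum.group) (use W in auto)
    also have "\<dots> = (\<Sum>w \<in> W. Poly_Mapping.lookup p w * mono_entry m a x y (letters w))"
      using mono_entry_path[OF a \<mu>] cval[OF \<mu>] by (intro sum.cong refl) simp
    also have "\<dots> = ev m a x y p"
      unfolding ev_def
    proof (rule sum.mono_neutral_left)
      show "\<forall>w \<in> Poly_Mapping.keys p - W. Poly_Mapping.lookup p w * mono_entry m a x y (letters w) = 0"
      proof
        fix w assume w: "w \<in> Poly_Mapping.keys p - W"
        then have "mono_entry m a x y (letters w) = 0"
          by (intro mono_entry_nopath[OF a]) (use G True in \<open>auto simp: W_def\<close>)
        then show "Poly_Mapping.lookup p w * mono_entry m a x y (letters w) = 0" by simp
      qed
    qed (auto simp: W_def)
    also have "\<dots> = 0" using p a True by (simp add: UT_identities_iff)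
    finally show "(\<Sum>X \<in> \<mu> ` W. d X * prod_mset (image_mset t X)) = 0" .
  qed
  moreover have "{w \<in> Poly_Mapping.keys p. path False m x (letters w) y X} = {w \<in> W. \<mu> w = X}"
    using \<mu> path_det by (auto simp: W_def) blast
  moreover have "d X = 0" if "X \<notin> \<mu> ` W"
  proof -
    have "{w \<in> W. \<mu> w = X} = {}" using that by blast
    then show ?thesis by (simp only: d_def sum.empty)
  qed
  ultimately show ?thesis by (metis d_def)
next
  case False
  then have "{w \<in> Poly_Mapping.keys p. path False m x (letters w) y X} = {}"
    using path_less by blast
  then show ?thesis by (simp only: sum.empty)
qed

lemma lookup_restrict:
  assumes "C \<subseteq> Poly_Mapping.keys p"
  shows "Poly_Mapping.lookup (\<Sum>w \<in> C. Poly_Mapping.single w (Poly_Mapping.lookup p w)) v =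
    (if v \<in> C then Poly_Mapping.lookup p v else 0)"
  using finite_subset[OF assms] by (simp add: lookup_sum lookup_single when_def)

lemma single_sum: "Poly_Mapping.single k (sum f S) = (\<Sum>i \<in> S. Poly_Mapping.single k (f i))"
  by (induction S rule: infinite_finite_induct) (simp_all add: single_add)

text \<open>Words outside \<open>N0\<close> are removed one class at a time. The coefficients of a
  class add up to 0, so a class of mutually congruent words contributes an element of
  \<open>I\<close>. It suffices that each word has one path, possibly of several, whose class is of
  this kind.\<close>

lemma eliminate:
  fixes I :: "(zgrp, 'f::field_char_0) fpoly set"
  assumes I: "0 \<in> I" "\<And>p q. p \<in> I \<Longrightarrow> q \<in> I \<Longrightarrow> p + q \<in> I"
      "\<And>c p. p \<in> I \<Longrightarrow> Poly_Mapping.single 0 c * p \<in> I" "I \<subseteq> UT_identities m"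
    and step: "\<And>w. w \<in> N - N0 \<Longrightarrow> fmonom w \<in> I \<or> (\<exists>a b X. path False m a w b X \<and>
      (\<forall>w' \<in> N. path False m a w' b X \<longrightarrow> fmonom w' - fmonom w \<in> I))"
    and p: "p \<in> UT_identities m" "Poly_Mapping.keys p \<subseteq> FMon ` N"
  shows "\<exists>p' \<in> UT_identities m. Poly_Mapping.keys p' \<subseteq> FMon ` N0 \<and> p - p' \<in> I"
  using p
proof (induction "card (Poly_Mapping.keys p - FMon ` N0)" arbitrary: p rule: less_induct)
  case less
  show ?case
  proof (cases "Poly_Mapping.keys p \<subseteq> FMon ` N0")
    case True
    then show ?thesis using less.prems I(1) by (intro bexI[of _ p]) auto
  next
    case False
    then obtain w where w: "FMon w \<in> Poly_Mapping.keys p" "FMon w \<notin> FMon ` N0"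
      using less.prems(2) by blast
    then have wN: "w \<in> N - N0" using less.prems(2) by auto
    let ?L = "Poly_Mapping.lookup p"
    have single: "Poly_Mapping.single v c = Poly_Mapping.single 0 c * fmonom (letters v)" for v and c :: 'f
      by (simp add: fmonom_def mult_single)
    obtain C where C: "C \<subseteq> Poly_Mapping.keys p" "FMon w \<in> C" "(\<Sum>v \<in> C. Poly_Mapping.single v (?L v)) \<in> I"
    proof (cases "fmonom w \<in> I")
      case True
      have "(\<Sum>v \<in> {FMon w}. Poly_Mapping.single v (?L v)) \<in> I"
        using I(3)[OF True, of "?L (FMon w)"] single[of "FMon w"] by simp
      then show ?thesis by (rule that[rotated 2]) (use w in auto)
    next
      case False
      then obtain a b X where X: "path False m a w b X"
        "\<And>w'. w' \<in> N \<Longrightarrow> path False m a w' b X \<Longrightarrow> fmonom w' - fmonom w \<in> I"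
        using step[OF wN] by blast
      let ?C = "{v \<in> Poly_Mapping.keys p. path False m a (letters v) b X}"
      have fin: "finite ?C" by simp
      have diff: "fmonom (letters v) - fmonom w \<in> I" if "v \<in> ?C" for v
        using that X(2)[of "letters v"] less.prems(2) by auto
      have sums: "(\<Sum>v \<in> S. f v) \<in> I" if "\<And>v. v \<in> S \<Longrightarrow> f v \<in> I" for S and f :: "zgrp indet fmon \<Rightarrow> _"
        using that by (induction S rule: infinite_finite_induct) (auto simp: I(1,2))
      \<comment> \<open>Replacing each word v of the class by v - w costs w times the sum of the
        coefficients, which vanishes.\<close>
      have "(\<Sum>v \<in> ?C. Poly_Mapping.single v (?L v)) =
          (\<Sum>v \<in> ?C. Poly_Mapping.single 0 (?L v) * (fmonom (letters v) - fmonom w))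
          + Poly_Mapping.single 0 (\<Sum>v \<in> ?C. ?L v) * fmonom w"
        by (simp add: single_sum sum_distrib_right right_diff_distrib sum_subtractf flip: single)
      moreover have "(\<Sum>v \<in> ?C. ?L v) = 0" by (rule class_sum_zero[OF less.prems(1)])
      ultimately have "(\<Sum>v \<in> ?C. Poly_Mapping.single v (?L v)) =
          (\<Sum>v \<in> ?C. Poly_Mapping.single 0 (?L v) * (fmonom (letters v) - fmonom w))" by simp
      also have "\<dots> \<in> I" by (intro sums I(3) diff)
      finally show ?thesis by (rule that[rotated 2]) (use w X in auto)
    qed
    let ?q = "\<Sum>v \<in> C. Poly_Mapping.single v (?L v)"
    have keys: "Poly_Mapping.keys (p - ?q) = Poly_Mapping.keys p - C"
      using C(1) by (auto simp: in_keys_iff lookup_minus lookup_restrict split: if_splits)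
    have "p - ?q \<in> UT_identities m"
      using UT_add[OF less.prems(1) UT_minus[of ?q m]] C(3) I(4) by auto
    moreover have "card (Poly_Mapping.keys (p - ?q) - FMon ` N0) < card (Poly_Mapping.keys p - FMon ` N0)"
      unfolding keys by (rule psubset_card_mono) (use C w in auto)
    moreover have "Poly_Mapping.keys (p - ?q) \<subseteq> FMon ` N" using keys less.prems(2) by blast
    ultimately obtain p' where p': "p' \<in> UT_identities m" "Poly_Mapping.keys p' \<subseteq> FMon ` N0" "p - ?q - p' \<in> I"
      using less.hyps by blast
    have "p - p' = (p - ?q - p') + ?q" by simp
    then have "p - p' \<in> I" using I(2)[OF p'(3) C(3)] by metis
    then show ?thesis using p' by blast
  qed
qed

text \<open>The words with exactly two paths, both of which have the center as an end point. Each path sees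
  the stars on one side of the word only, so here alone a relation between more than two words, namely (d), is
  needed.\<close>

definition special :: "nat \<Rightarrow> zgrp indet list \<Rightarrow> bool" where
  "special m w \<longleftrightarrow> odd m \<and> nz w = 1 \<and> wdeg w \<in> basis_elts m"

text \<open>For a special word these are the letters read at the center on the path that starts
  there; \<open>right_unst\<close> is the counterpart for the path that ends there.\<close>

definition left_unst :: "zgrp indet list \<Rightarrow> bool" where
  "left_unst w \<longleftrightarrow> (\<forall>x z y. w = x @ z # y \<longrightarrow> nz x = 0 \<longrightarrow> vdeg z = 0 \<longrightarrow> \<not> starred z)"

definition right_unst :: "zgrp indet list \<Rightarrow> bool" where
  "right_unst w \<longleftrightarrow> (\<forall>x z y. w = x @ z # y \<longrightarrow> nz y = 0 \<longrightarrow> vdeg z = 0 \<longrightarrow> \<not> starred z)"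

definition reduced :: "nat \<Rightarrow> zgrp indet list \<Rightarrow> bool" where
  "reduced m w \<longleftrightarrow> inG m w \<and> (special m w \<longrightarrow> left_unst w \<or> right_unst w)"

text \<open>The situation of \<open>eqv_path_toggle\<close>, in which all stars at the center can be
  removed.\<close>

definition noncentral :: "nat \<Rightarrow> nat \<Rightarrow> nat \<Rightarrow> zgrp indet list \<Rightarrow> bool" where
  "noncentral m a b w \<longleftrightarrow> 2 \<le> nz w \<or> m = 1 \<or> mirror m a \<noteq> a \<and> mirror m b \<noteq> b"

lemma center_unique: "a < m \<Longrightarrow> c < m \<Longrightarrow> mirror m a = a \<Longrightarrow> mirror m c = c \<Longrightarrow> a = c"
  by (auto simp: mirror_center_iff)

lemma left_unst_path:
  assumes "path False m f w b X" "mirror m f = f" "left_unst w"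
  shows "path True m f w b X"
proof (rule path_strengthen[OF assms(1)])
  fix x l y c Y
  assume *: "w = x @ l # y" "vdeg l = 0" "mirror m c = c" "path False m f x c Y"
  then have "c = f" using center_unique[of c m f] path_less[OF *(4)] assms(2) by simp
  then have "nz x = 0" using path_nz[OF *(4)] by simp
  with * assms(3) show "\<not> starred l" by (auto simp: left_unst_def)
qed

lemma right_unst_path:
  assumes "path False m a w f X" "mirror m f = f" "right_unst w"
  shows "path True m a w f X"
proof (rule path_strengthen[OF assms(1)])
  fix x l y c Y
  assume *: "w = x @ l # y" "vdeg l = 0" "mirror m c = c" "path False m a x c Y"
    "path False m c y f (X - add_mset (coord m l c c) Y)"
  then have "c = f" using center_unique[of c m f] path_less[OF *(5)] assms(2) by simp
  then have "nz y = 0" using path_nz[OF *(5)] by simp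
  with * assms(3) show "\<not> starred l" by (auto simp: right_unst_def)
qed

text \<open>The coordinates see the stars at a vertex that is not the center.\<close>

lemma right_unst_transfer:
  assumes "path False m f v b X" "path False m f w b X" "mirror m f = f" "f < b" "right_unst w"
  shows "right_unst v"
  unfolding right_unst_def
proof (intro allI impI notI)
  fix x z y assume *: "v = x @ z # y" "nz y = 0" "vdeg z = 0" "starred z"
  have lt: "f < m" "b < m" using path_less[OF assms(1)] by auto
  have b: "mirror m b \<noteq> b" "mirror m b < f"
    using assms(3,4) lt center_unique[of b m f] mirror_mono[of f b m] mirror_inj[of f m b] by (auto simp: order_less_le)
  obtain c Y Z where p: "path False m f x c Y" "path False m c (z # y) b Z" "X = Y + Z"
    using assms(1) unfolding *(1) path_append by blast
  have "nz (z # y) = 0" using * by simp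
  then have "c = b" using path_zero[OF _ p(2)] by simp
  then have "coord m z b b \<in># X" using p * lt by (auto simp: edge_zero)
  from path_memE[OF assms(2) this] obtain x' z' y' c' d' Y' Z' where
    q: "w = x' @ z' # y'" "coord m z b b = coord m z' c' d'" "path False m f x' c' Y'" "edge m c' d' (vdeg z')"
      "path False m d' y' b Z'" by metis
  have "edge m b b (vdeg z)" using * lt by (simp add: edge_zero)
  note D = coord_eqD[OF q(2) this q(4)]
  \<comment> \<open>The mirrored reading would take place at \<open>mirror m b\<close>, before the
    start f of the path.\<close>
  have "f \<le> c'" using path_less[OF q(3)] by simp
  then have "z' = z" "d' = b" using D b by auto
  then have "nz y' = 0" using path_nz[OF q(5)] by simp
  then show False using assms(5) q(1) * \<open>z' = z\<close> by (auto simp: right_unst_def)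
qed

lemma left_unst_transfer:
  assumes "path False m a v f X" "path False m a w f X" "mirror m f = f" "a < f" "left_unst w"
  shows "left_unst v"
  unfolding left_unst_def
proof (intro allI impI notI)
  fix x z y assume *: "v = x @ z # y" "nz x = 0" "vdeg z = 0" "starred z"
  have lt: "a < m" "f < m" using path_less[OF assms(1)] by auto
  have a: "mirror m a \<noteq> a" "f < mirror m a"
    using assms(3,4) lt center_unique[of a m f] mirror_mono[of a f m] mirror_inj[of a m f] by (auto simp: order_less_le)
  obtain c Y Z where p: "path False m a x c Y" "path False m c (z # y) f Z" "X = Y + Z"
    using assms(1) unfolding *(1) path_append by blast
  then have "c = a" using path_zero[OF *(2) p(1)] by simp
  then have "coord m z a a \<in># X" using p * lt by (auto simp: edge_zero)
  from path_memE[OF assms(2) this] obtain x' z' y' c' d' Y' Z' where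
    q: "w = x' @ z' # y'" "coord m z a a = coord m z' c' d'" "path False m a x' c' Y'" "edge m c' d' (vdeg z')"
      "path False m d' y' f Z'" by metis
  have "edge m a a (vdeg z)" using * lt by (simp add: edge_zero)
  note D = coord_eqD[OF q(2) this q(4)]
  have "d' \<le> f" using path_less[OF q(5)] by simp
  then have "z' = z" "c' = a" using D a by auto
  then have "nz x' = 0" using path_nz[OF q(3)] by simp
  then show False using assms(5) q(1) * \<open>z' = z\<close> by (auto simp: left_unst_def)
qed

lemma special_paths:
  assumes "special m w"
  obtains f b X a Y where "mirror m f = f" "f < b" "a < f" "path False m f w b X" "path False m a w f Y"
proof -
  obtain i where i: "1 \<le> i" "i \<le> m div 2" "wdeg w = eb i"
    using assms by (auto simp: special_def basis_elts_def)
  let ?f = "m div 2" and ?a = "i - 1"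
  have odd: "odd m" and nz: "nz w = 1" using assms by (auto simp: special_def)
  have f: "mirror m ?f = ?f" "?f < m" using odd by (auto simp: mirror_def elim!: oddE)
  have a: "?a < ?f" using i by simp
  have e: "edge m ?a ?f (wdeg w)" using edge_to_center[OF odd a] i by simp
  have "?f < mirror m ?a" using a f mirror_mono[of ?a ?f m] mirror_inj[of ?a m ?f] by (auto simp: order_less_le)
  then show thesis
    using that[OF f(1) _ a] path_one_nz[OF nz e] path_one_nz[OF nz edge_mirror[OF e]] f by auto
qed

lemma special_path_iff:
  assumes "path False m a v b X" "path False m a w b X"
  shows "special m w \<longleftrightarrow> special m v"
  using path_nz_eq[OF assms] path_edge[OF assms(1)] path_edge[OF assms(2)] by (auto simp: special_def edge_def)

text \<open>On the path of a special word that starts at the center the stars on the left are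
  invisible, so a class may mix words with and without them. A class with stars on the right,
  however, has none on the left, because its words are reduced. A first round removes these classes
  and their counterparts for the other path; what remains of the special words has no stars on
  either side, and a second round removes everything.\<close>

lemma eliminate_reduced:
  fixes I :: "(zgrp, 'f::field_char_0) fpoly set"
  assumes "0 < m" and I: "0 \<in> I" "\<And>p q. p \<in> I \<Longrightarrow> q \<in> I \<Longrightarrow> p + q \<in> I"
      "\<And>c p. p \<in> I \<Longrightarrow> Poly_Mapping.single 0 c * p \<in> I" "I \<subseteq> UT_identities m"
    and N: "\<And>w. w \<in> N \<Longrightarrow> reduced m w"
    and nopath: "\<And>w. w \<in> N \<Longrightarrow> \<nexists>a b X. path False m a w b X \<Longrightarrow> fmonom w \<in> I"
    and same: "\<And>v w a b X. v \<in> N \<Longrightarrow> w \<in> N \<Longrightarrow> path False m a v b X \<Longrightarrow> path False m a w b X \<Longrightarrow>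
      noncentral m a b v \<or> path True m a v b X \<and> path True m a w b X \<Longrightarrow> fmonom v - fmonom w \<in> I"
    and p: "p \<in> UT_identities m" "Poly_Mapping.keys p \<subseteq> FMon ` N"
  shows "p \<in> I"
proof -
  define N0 where "N0 = {w \<in> N. special m w \<longrightarrow> left_unst w \<and> right_unst w}"
  have "\<exists>p' \<in> UT_identities m. Poly_Mapping.keys p' \<subseteq> FMon ` N0 \<and> p - p' \<in> I"
  proof (rule eliminate[OF I _ p])
    fix w assume "w \<in> N - N0"
    then have w: "w \<in> N" "special m w" "\<not> (left_unst w \<and> right_unst w)" "left_unst w \<or> right_unst w"
      using N[of w] by (auto simp: N0_def reduced_def)
    obtain f b X a Y where fb: "mirror m f = f" "f < b" "a < f" "path False m f w b X" "path False m a w f Y"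
      by (rule special_paths[OF w(2)])
    show "fmonom w \<in> I \<or> (\<exists>a b X. path False m a w b X \<and>
      (\<forall>w' \<in> N. path False m a w' b X \<longrightarrow> fmonom w' - fmonom w \<in> I))"
    proof (cases "right_unst w")
      case False
      have "fmonom w' - fmonom w \<in> I" if w': "w' \<in> N" "path False m f w' b X" for w'
      proof -
        have "\<not> right_unst w'" using right_unst_transfer[OF fb(4) w'(2) fb(1,2)] False by blast
        moreover have "special m w'" using special_path_iff[OF fb(4) w'(2)] w(2) by blast
        ultimately have "left_unst w'" using N[OF w'(1)] by (auto simp: reduced_def)
        then show ?thesis
          using same[OF w'(1) w(1) w'(2) fb(4)] left_unst_path[OF fb(4,1)] left_unst_path[OF w'(2) fb(1)] w False by blast
      qed
      then show ?thesis using fb(4) by blast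
    next
      case True
      then have "\<not> left_unst w" using w by blast
      have "fmonom w' - fmonom w \<in> I" if w': "w' \<in> N" "path False m a w' f Y" for w'
      proof -
        have "\<not> left_unst w'" using left_unst_transfer[OF fb(5) w'(2) fb(1,3)] \<open>\<not> left_unst w\<close> by blast
        moreover have "special m w'" using special_path_iff[OF fb(5) w'(2)] w(2) by blast
        ultimately have "right_unst w'" using N[OF w'(1)] by (auto simp: reduced_def)
        then show ?thesis
          using same[OF w'(1) w(1) w'(2) fb(5)] right_unst_path[OF fb(5,1)] right_unst_path[OF w'(2) fb(1)] True by blast
      qed
      then show ?thesis using fb(5) by blast
    qed
  qed
  then obtain p' where p': "p' \<in> UT_identities m" "Poly_Mapping.keys p' \<subseteq> FMon ` N0" "p - p' \<in> I" by blast
  have "\<exists>p'' \<in> UT_identities m. Poly_Mapping.keys p'' \<subseteq> FMon ` {} \<and> p' - p'' \<in> I"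
  proof (rule eliminate[OF I _ p'(1,2)])
    fix w assume "w \<in> N0 - {}"
    then have w: "w \<in> N" "special m w \<Longrightarrow> left_unst w" by (auto simp: N0_def)
    have N0: "w' \<in> N" if "w' \<in> N0" for w' using that by (simp add: N0_def)
    have nc: "fmonom w' - fmonom w \<in> I"
      if "path False m a w b X" "noncentral m a b w" "w' \<in> N0" "path False m a w' b X" for a b X w'
      using same[OF N0[OF that(3)] w(1) that(4,1)] that(2) path_nz_eq[OF that(1,4)] by (auto simp: noncentral_def)
    show "fmonom w \<in> I \<or> (\<exists>a b X. path False m a w b X \<and>
      (\<forall>w' \<in> N0. path False m a w' b X \<longrightarrow> fmonom w' - fmonom w \<in> I))"
    proof (cases "\<exists>a b X. path False m a w b X")
      case False
      then show ?thesis using nopath[OF w(1)] by blast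
    next
      case True
      then obtain a b X where X: "path False m a w b X" by blast
      consider "special m w" | "noncentral m a b w" | "nz w = 0" "m \<noteq> 1" | "nz w = 1" "\<not> special m w" "\<not> noncentral m a b w"
        unfolding noncentral_def by linarith
      then show ?thesis
      proof cases
        case 1
        obtain f b X a Y where fb: "mirror m f = f" "f < b" "path False m f w b X" and "a < f" "path False m a w f Y"
          by (rule special_paths[OF 1])
        have "fmonom w' - fmonom w \<in> I" if w': "w' \<in> N0" "path False m f w' b X" for w'
        proof -
          have "left_unst w'" using special_path_iff[OF fb(3) w'(2)] 1 w'(1) by (simp add: N0_def)
          then show ?thesis
            using same[OF N0[OF w'(1)] w(1) w'(2) fb(3)] left_unst_path[OF fb(3,1)] left_unst_path[OF w'(2) fb(1)] w(2) 1 by blast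
        qed
        then show ?thesis using fb by blast
      next
        case 2
        then show ?thesis using nc X by blast
      next
        case 3
        \<comment> \<open>Words of letters of degree 0 are read at index 0, which is not the center
          for m > 1 and so shows every star.\<close>
        then obtain Z where "path False m 0 w 0 Z" using path_zero_ex[OF 3(1)] \<open>0 < m\<close> by blast
        moreover have "noncentral m 0 0 w" using 3(2) \<open>0 < m\<close> by (auto simp: noncentral_def mirror_def)
        ultimately show ?thesis using nc by blast
      next
        case 4
        \<comment> \<open>This case is void: a single edge of nonzero degree with an end at the
          center has degree e_i, and the word is special.\<close>
        have "a < b" using path_nz[OF X] path_less[OF X] 4(1) by auto
        moreover have "mirror m a = a \<or> mirror m b = b" using 4(3) by (auto simp: noncentral_def)
        ultimately have "special m w"
          using basis_elt_edge[OF _ path_edge[OF X]] mirror_center_iff path_less[OF X] 4(1) by (auto simp: special_def)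
        then show ?thesis using 4 by blast
      qed
    qed
  qed
  then have "p' \<in> I" by auto
  then show ?thesis using I(2)[OF p'(3)] by fastforce
qed

context basis_ideal
begin

text \<open>Expanding the product in \<open>two_sided_expand\<close> expresses a word with stars on
  both sides by three words, each free of stars on at least one side. Only stars change, so
  multilinear words yield multilinear words.\<close>

lemma reduce_word:
  assumes "inG m w"
  shows "\<exists>q. fmonom w - q \<in> I \<and>
    (\<forall>w' \<in> Poly_Mapping.keys q. reduced m (letters w') \<and> map vind (letters w') = map vind w)"
proof (cases "special m w \<and> \<not> left_unst w \<and> \<not> right_unst w")
  case False
  then show ?thesis using assms by (intro exI[of _ "fmonom w"]) (auto simp: reduced_def I_zero fmonom_def)
next
  case True
  then have "nz w = 1" "odd m" "wdeg w \<in> basis_elts m" by (auto simp: special_def)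
  then obtain u l v where w: "w = u @ [l] @ v" "nz u = 0" "vdeg l \<noteq> 0" "nz v = 0"
    using split_first_nz[of w] by auto
  let ?u = "map unst u" and ?v = "map unst v"
  let ?f = "fmonom :: _ \<Rightarrow> (zgrp, 'f) fpoly"
  let ?q = "?f (?u @ [l] @ v) + ?f (u @ [l] @ ?v) - ?f (?u @ [l] @ ?v)"
  have G: "inG m u" "inG m v" "inG m [l]" "inG m ?u" "inG m ?v" using assms w by (auto simp: inG_def)
  have nz: "nz ?u = 0" "nz ?v = 0" using w by (auto simp: nz_0_iff)
  have "(?f u - ?f ?u) * ?f [l] * (?f v - ?f ?v) \<in> I"
    by (rule two_sided_expand) (use True w G in \<open>auto simp: special_def wdeg_nz_0\<close>)
  moreover have "(?f u - ?f ?u) * ?f [l] * (?f v - ?f ?v) = ?f w - ?q"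
    using w by (simp add: algebra_simps fmonom_mult)
  moreover have "reduced m (letters w') \<and> map vind (letters w') = map vind w" if "w' \<in> Poly_Mapping.keys ?q" for w'
  proof -
    have uv: "z \<in> set ?u" if "?u @ l # y' = x @ z # y" "nz x = 0" "vdeg z = 0" for x y z y'
      using that w(3) by (auto simp: append_eq_append_conv2 Cons_eq_append_conv append_eq_Cons_conv simp del: set_map)
    have vu: "z \<in> set ?v" if "x' @ l # ?v = x @ z # y" "nz y = 0" "vdeg z = 0" for x y z x'
      using that w(3) by (auto simp: append_eq_append_conv2 Cons_eq_append_conv append_eq_Cons_conv simp del: set_map)
    have "w' \<in> {FMon (?u @ [l] @ v), FMon (u @ [l] @ ?v), FMon (?u @ [l] @ ?v)}"
      using that keys_add[of "?f (?u @ [l] @ v)" "?f (u @ [l] @ ?v)"] keys_diff[of "?f (?u @ [l] @ v) + ?f (u @ [l] @ ?v)" "?f (?u @ [l] @ ?v)"]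
      by (auto simp: fmonom_def split: if_splits)
    moreover have "left_unst (?u @ [l] @ y)" for y
      unfolding left_unst_def by (auto dest!: uv)
    moreover have "right_unst (x @ [l] @ ?v)" for x
      unfolding right_unst_def by (auto dest!: vu)
    ultimately show ?thesis using G w by (auto simp: reduced_def o_def)
  qed
  ultimately show ?thesis by (intro exI[of _ ?q]) simp
qed

end


section \<open>Good monomials as conditions on factorisations\<close>

text \<open>For the range from 1 to \<open>Suc k\<close> this is the word in
  \<open>good_mono\<close> without its last factor.\<close>

definition blk :: "(nat \<Rightarrow> zgrp indet list) \<Rightarrow> (nat \<Rightarrow> zgrp indet) \<Rightarrow> nat \<Rightarrow> nat \<Rightarrow> zgrp indet list" where
  "blk M y i j = concat (map (\<lambda>t. M t @ [y t]) [i..<j])"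

lemma blk_empty [simp]: "j \<le> i \<Longrightarrow> blk M y i j = []"
  by (simp add: blk_def)

lemma blk_first: "i < j \<Longrightarrow> blk M y i j = M i @ y i # blk M y (Suc i) j"
  by (simp add: blk_def upt_conv_Cons)

lemma blk_last: "i \<le> j \<Longrightarrow> blk M y i (Suc j) = blk M y i j @ M j @ [y j]"
  by (simp add: blk_def)

lemma blk_cong: "(\<And>t. i \<le> t \<Longrightarrow> t < j \<Longrightarrow> M t = M' t \<and> y t = y' t) \<Longrightarrow> blk M y i j = blk M' y' i j"
  by (auto simp: blk_def intro!: arg_cong[of _ _ concat])

lemma blk_split: "i \<le> t \<Longrightarrow> t < j \<Longrightarrow> blk M y i j = blk M y i t @ M t @ y t # blk M y (Suc t) j"
proof -
  assume "i \<le> t" "t < j"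
  then have "[i..<j] = [i..<t] @ t # [Suc t..<j]"
    by (metis less_imp_le_nat upt_add_eq_append upt_conv_Cons le_Suc_ex)
  then show ?thesis by (simp add: blk_def)
qed

lemma split_at_nz:
  assumes "p @ a # r = u @ l # v" "nz p = 0" "vdeg l \<noteq> 0"
  shows "u = p \<and> l = a \<and> v = r \<or> (\<exists>u'. u = p @ a # u' \<and> r = u' @ l # v)"
  using assms by (auto simp: append_eq_append_conv2 Cons_eq_append_conv append_eq_Cons_conv)

locale word_blocks =
  fixes k :: nat and M :: "nat \<Rightarrow> zgrp indet list" and y :: "nat \<Rightarrow> zgrp indet" and w :: "zgrp indet list"
  assumes w: "w = blk M y 1 (Suc k) @ M (Suc k)"
    and y: "\<And>i. 1 \<le> i \<Longrightarrow> i \<le> k \<Longrightarrow> vdeg (y i) \<noteq> 0"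
    and M: "\<And>i. 1 \<le> i \<Longrightarrow> i \<le> Suc k \<Longrightarrow> nz (M i) = 0"
begin

definition tl_from :: "nat \<Rightarrow> zgrp indet list" where
  "tl_from i = blk M y i (Suc k) @ M (Suc k)"

lemma tl_from_Suc: "i \<le> k \<Longrightarrow> tl_from i = M i @ y i # tl_from (Suc i)"
  by (simp add: tl_from_def blk_first)

lemma tl_from_end: "tl_from (Suc k) = M (Suc k)"
  by (simp add: tl_from_def)

lemma w_tl: "w = tl_from 1"
  by (simp add: w tl_from_def)

lemma w_split: "1 \<le> i \<Longrightarrow> i \<le> k \<Longrightarrow> w = blk M y 1 i @ M i @ y i # tl_from (Suc i)"
  using blk_split[of 1 i "Suc k" M y] by (simp add: w tl_from_def)

lemma w_split2:
  assumes "1 \<le> i" "i < j" "j \<le> k"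
  shows "w = blk M y 1 i @ M i @ y i # blk M y (Suc i) j @ M j @ y j # tl_from (Suc j)"
  using w_split[of i] assms blk_split[of "Suc i" j "Suc k" M y] by (simp add: tl_from_def)

lemma nz_blk: "1 \<le> i \<Longrightarrow> i \<le> j \<Longrightarrow> j \<le> Suc k \<Longrightarrow> nz (blk M y i j) = j - i"
proof (induction j)
  case (Suc j)
  show ?case
  proof (cases "i = Suc j")
    case False
    then have "i \<le> j" using Suc by simp
    then show ?thesis using Suc y[of j] M[of j] by (simp add: blk_last)
  qed simp
qed simp

lemma wdeg_blk: "1 \<le> i \<Longrightarrow> i \<le> j \<Longrightarrow> j \<le> Suc k \<Longrightarrow> wdeg (blk M y i j) = (\<Sum>t = i..<j. vdeg (y t))"
proof (induction j)
  case (Suc j)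
  show ?case
  proof (cases "i = Suc j")
    case False
    then have "i \<le> j" using Suc by simp
    then show ?thesis using Suc M[of j] by (simp add: blk_last wdeg_nz_0)
  qed simp
qed simp

text \<open>The letters \<open>y t\<close> are the only ones of nonzero degree, so every
  factorisation at such a letter comes from the block structure.\<close>

lemma split_nz:
  assumes "1 \<le> i" "i \<le> Suc k" "tl_from i = u @ l # v" "vdeg l \<noteq> 0"
  shows "\<exists>t. i \<le> t \<and> t \<le> k \<and> l = y t \<and> u = blk M y i t @ M t \<and> v = tl_from (Suc t)"
  using assms(2,1,3)
proof (induction i arbitrary: u rule: inc_induct)
  case base
  then have "nz (M (Suc k)) \<noteq> 0" using assms(4) by (simp add: tl_from_end)
  then show ?case using M[of "Suc k"] by simp
next
  case (step i)
  have "M i @ y i # tl_from (Suc i) = u @ l # v" using step by (simp add: tl_from_Suc)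
  from split_at_nz[OF this _ assms(4)] M[of i] step
  consider "u = M i" "l = y i" "v = tl_from (Suc i)" | u' where "u = M i @ y i # u'" "tl_from (Suc i) = u' @ l # v"
    by auto
  then show ?case
  proof cases
    case 1
    then show ?thesis using step by (intro exI[of _ i]) auto
  next
    case 2
    obtain t where "Suc i \<le> t \<and> t \<le> k \<and> l = y t \<and> u' = blk M y (Suc i) t @ M t \<and> v = tl_from (Suc t)"
      using step.IH[OF _ 2(2)] by auto
    then show ?thesis using 2 by (intro exI[of _ t]) (auto simp: blk_first)
  qed
qed

lemma split_zeros:
  assumes "1 \<le> i" "i \<le> Suc k" "tl_from i = u @ l # l' # v" "vdeg l = 0" "vdeg l' = 0"
  shows "\<exists>t p q. i \<le> t \<and> t \<le> Suc k \<and> M t = p @ l # l' # q"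
  using assms(2,1,3)
proof (induction i arbitrary: u rule: inc_induct)
  case base
  then show ?case by (auto simp: tl_from_end)
next
  case (step i)
  have nz: "vdeg (y i) \<noteq> 0" using y step by simp
  have "M i @ y i # tl_from (Suc i) = u @ l # l' # v" using step by (simp add: tl_from_Suc)
  then consider us where "M i = u @ us" "us @ y i # tl_from (Suc i) = l # l' # v"
    | us where "u = M i @ us" "y i # tl_from (Suc i) = us @ l # l' # v"
    by (auto simp: append_eq_append_conv2)
  then show ?case
  proof cases
    case 1
    then obtain q where "us = l # l' # q"
      using nz assms(4,5) by (auto simp: Cons_eq_append_conv append_eq_Cons_conv)
    then show ?thesis using 1 step by (intro exI[of _ i]) auto
  next
    case 2
    then obtain u' where "tl_from (Suc i) = u' @ l # l' # v"
      using nz assms(4) by (auto simp: Cons_eq_append_conv)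
    from step.IH[OF _ this] show ?thesis by (auto intro: Suc_leD)
  qed
qed

end

lemma word_blocks_exist: "\<exists>k M y. word_blocks k M y w"
proof (induction w rule: rev_induct)
  case Nil
  have "word_blocks 0 (\<lambda>_. []) undefined []" by unfold_locales auto
  then show ?case by blast
next
  case (snoc l w)
  then obtain k M y where "word_blocks k M y w" by blast
  then interpret word_blocks k M y w .
  show ?case
  proof (cases "vdeg l = 0")
    case True
    have "word_blocks k (M(Suc k := M (Suc k) @ [l])) y (w @ [l])"
      by unfold_locales (use True w y M in \<open>auto intro!: blk_cong\<close>)
    then show ?thesis by blast
  next
    case False
    have "word_blocks (Suc k) (M(Suc (Suc k) := [])) (y(Suc k := l)) (w @ [l])"
    proof unfold_locales
      have "blk (M(Suc (Suc k) := [])) (y(Suc k := l)) 1 (Suc k) = blk M y 1 (Suc k)"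
        by (rule blk_cong) auto
      then show "w @ [l] = blk (M(Suc (Suc k) := [])) (y(Suc k := l)) 1 (Suc (Suc k)) @ (M(Suc (Suc k) := [])) (Suc (Suc k))"
        by (simp add: blk_last[of "Suc 0" "Suc k"] w)
    next
      show "vdeg ((y(Suc k := l)) i) \<noteq> 0" if "1 \<le> i" "i \<le> Suc k" for i
        using False y[of i] that by auto
      show "nz ((M(Suc (Suc k) := [])) i) = 0" if "1 \<le> i" "i \<le> Suc (Suc k)" for i
        using M[of i] that by auto
    qed
    then show ?thesis by blast
  qed
qed

text \<open>Conditions (I)--(III) and (IV)--(VII), in terms of factorisations of the word; the former are
  inherited by suffixes.\<close>

definition good_order :: "'f::field itself \<Rightarrow> nat \<Rightarrow> zgrp indet list \<Rightarrow> bool" where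
  "good_order ty m w \<longleftrightarrow>
    (\<forall>x l l' z. w = x @ l # l' # z \<and> vdeg l = 0 \<and> vdeg l' = 0 \<longrightarrow> vind l < vind l') \<and>
    (\<forall>x l z. w = x @ l # z \<and> vdeg l \<noteq> 0 \<and> dimU TYPE('f) m (vdeg l) = 1 \<longrightarrow>
       \<not> starred l \<and> (x = [] \<or> vdeg (last x) \<noteq> 0)) \<and>
    (\<forall>x l s l' z. w = x @ l # s @ l' # z \<and> vdeg l \<noteq> 0 \<and> vdeg l' \<noteq> 0 \<and>
       dimU TYPE('f) m (wdeg (l # s @ [l'])) = 1 \<longrightarrow> vind l < vind l' \<and> (x = [] \<or> vdeg (last x) \<noteq> 0))"

definition good_center :: "nat \<Rightarrow> zgrp indet list \<Rightarrow> bool" where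
  "good_center m w \<longleftrightarrow> (odd m \<longrightarrow>
    (\<forall>x l s l' z. w = x @ l # s @ l' # z \<and> nz s = 0 \<and> vdeg l \<in> basis_elts m \<and> vdeg l' \<in> basis_elts m \<longrightarrow> unstarred s) \<and>
    (\<forall>s l z l' z'. w = s @ l # z @ l' # z' \<and> nz s = 0 \<and> nz z = 0 \<and> vdeg l \<in> basis_elts m \<and>
       vdeg l' \<noteq> 0 \<and> vdeg l' \<notin> basis_elts m \<longrightarrow> unstarred s) \<and>
    (\<forall>z' l' z l s. w = z' @ l' # z @ l # s \<and> nz s = 0 \<and> nz z = 0 \<and> vdeg l \<in> basis_elts m \<and>
       vdeg l' \<noteq> 0 \<and> vdeg l' \<notin> basis_elts m \<longrightarrow> unstarred s) \<and>
    (\<forall>s l s'. w = s @ l # s' \<and> nz s = 0 \<and> nz s' = 0 \<and> vdeg l \<in> basis_elts m \<longrightarrow> unstarred s \<or> unstarred s'))"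

text \<open>This lemma and the next three extract the clauses (IV), (V), (VI) and (VII).\<close>

lemma good_center_inner:
  assumes "good_center m w" "odd m" "w = x @ l # s @ l' # z" "nz s = 0" "vdeg l \<in> basis_elts m" "vdeg l' \<in> basis_elts m"
  shows "unstarred s"
  by (rule assms(1)[unfolded good_center_def, THEN mp, OF assms(2), THEN conjunct1, rule_format, OF
      conjI[OF assms(3) conjI[OF assms(4) conjI[OF assms(5) assms(6)]]]])

lemma good_center_start:
  assumes "good_center m w" "odd m" "w = s @ l # z @ l' # z'" "nz s = 0" "nz z = 0" "vdeg l \<in> basis_elts m"
    "vdeg l' \<noteq> 0" "vdeg l' \<notin> basis_elts m"
  shows "unstarred s"
  by (rule assms(1)[unfolded good_center_def, THEN mp, OF assms(2), THEN conjunct2, THEN conjunct1, rule_format, OF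
      conjI[OF assms(3) conjI[OF assms(4) conjI[OF assms(5) conjI[OF assms(6) conjI[OF assms(7) assms(8)]]]]]])

lemma good_center_end:
  assumes "good_center m w" "odd m" "w = z' @ l' # z @ l # s" "nz s = 0" "nz z = 0" "vdeg l \<in> basis_elts m"
    "vdeg l' \<noteq> 0" "vdeg l' \<notin> basis_elts m"
  shows "unstarred s"
  by (rule assms(1)[unfolded good_center_def, THEN mp, OF assms(2), THEN conjunct2, THEN conjunct2, THEN conjunct1, rule_format, OF
      conjI[OF assms(3) conjI[OF assms(4) conjI[OF assms(5) conjI[OF assms(6) conjI[OF assms(7) assms(8)]]]]]])

lemma good_center_single:
  assumes "good_center m w" "odd m" "w = s @ l # s'" "nz s = 0" "nz s' = 0" "vdeg l \<in> basis_elts m"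
  shows "unstarred s \<or> unstarred s'"
  by (rule assms(1)[unfolded good_center_def, THEN mp, OF assms(2), THEN conjunct2, THEN conjunct2, THEN conjunct2, rule_format, OF
      conjI[OF assms(3) conjI[OF assms(4) conjI[OF assms(5) assms(6)]]]])

lemma basis_elts_nonzero: "g \<in> basis_elts m \<Longrightarrow> g \<noteq> 0"
  by (auto simp: basis_elts_def eb_nonzero)

lemma sorted_wrt_adjacent:
  "(\<And>p l l' q. xs = p @ l # l' # q \<Longrightarrow> f l < (f l' :: nat)) \<Longrightarrow> sorted_wrt (<) (map f xs)"
proof (induction xs rule: induct_list012)
  case (3 a b xs)
  have "f a < f b" using "3.prems"[of "[]"] by simp
  moreover have "sorted_wrt (<) (map f (b # xs))"
    by (rule "3.IH"(2)) (use "3.prems"[of "a # _"] in auto)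
  ultimately show ?case by auto
qed auto

lemma sorted_wrt_adjacentD: "sorted_wrt (<) (map f (p @ l # l' # q)) \<Longrightarrow> f l < (f l' :: nat)"
  by (simp add: sorted_wrt_append)

text \<open>With \<open>blk_endD\<close> this translates the emptiness of a block into a condition
  on the letter in front of the next letter of nonzero degree, the form used in
  \<open>good_order\<close>.\<close>

lemma (in word_blocks) blk_end:
  assumes "1 \<le> i" "i \<le> Suc k" "M i = []"
  shows "blk M y 1 i @ M i = [] \<or> vdeg (last (blk M y 1 i @ M i)) \<noteq> 0"
proof (cases "i = 1")
  case False
  then obtain j where "i = Suc j" "1 \<le> j" using assms(1) by (cases i) auto
  then show ?thesis using assms y[of j] by (simp add: blk_last)
qed (use assms in simp)

lemma (in word_blocks) blk_endD:
  assumes "1 \<le> i" "i \<le> Suc k" "blk M y 1 i @ M i = [] \<or> vdeg (last (blk M y 1 i @ M i)) \<noteq> 0"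
  shows "M i = []"
proof (rule ccontr)
  assume *: "M i \<noteq> []"
  then have "last (blk M y 1 i @ M i) \<in> set (M i)" by simp
  then have "vdeg (last (blk M y 1 i @ M i)) = 0" using M[OF assms(1,2)] by (auto simp: nz_0_iff simp del: last_appendR)
  then show False using * assms(3) by auto
qed

lemma sum_both_ends:
  fixes f :: "nat \<Rightarrow> 'a::comm_monoid_add"
  assumes "i < j"
  shows "f i + (\<Sum>t = Suc i..<j. f t) + f j = (\<Sum>t = i..j. f t)"
proof -
  have "(\<Sum>t = i..j. f t) = (\<Sum>t = i..<j. f t) + f j"
    using assms by (simp add: sum.atLeastLessThan_Suc flip: atLeastLessThanSuc_atLeastAtMost)
  then show ?thesis using assms by (simp add: sum.atLeast_Suc_lessThan)
qed

lemma good_monoD: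
  assumes "good_mono TYPE('f::field) m w"
  shows "good_order TYPE('f) m w \<and> good_center m w"
  using assms unfolding good_mono_def
proof (elim conjE exE)
  fix k and M :: "nat \<Rightarrow> zgrp indet list" and y :: "nat \<Rightarrow> zgrp indet"
  assume w: "w = concat (map (\<lambda>i. M i @ [y i]) [1..<Suc k]) @ M (Suc k)" and
    y: "\<forall>i \<in> {1..k}. vdeg (y i) \<noteq> 0" and M: "\<forall>i \<in> {1..Suc k}. \<forall>l \<in> set (M i). vdeg l = 0" and
    c1: "\<forall>i \<in> {1..Suc k}. sorted_wrt (<) (map vind (M i))" and
    c2: "\<forall>i \<in> {1..k}. dimU TYPE('f) m (vdeg (y i)) = 1 \<longrightarrow> \<not> starred (y i) \<and> M i = []" and
    c3: "\<forall>i \<in> {1..k}. \<forall>j \<in> {1..k}. i < j \<and> dimU TYPE('f) m (\<Sum>t = i..j. vdeg (y t)) = 1 \<longrightarrow>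
          M i = [] \<and> vind (y i) < vind (y j)" and
    c4: "odd m \<longrightarrow> (\<forall>i \<in> {1..<k}.
          vdeg (y i) \<in> basis_elts m \<and> vdeg (y (Suc i)) \<in> basis_elts m \<longrightarrow> unstarred (M (Suc i)))" and
    c5: "odd m \<and> 2 \<le> k \<and> vdeg (y 1) \<in> basis_elts m \<and> vdeg (y 2) \<notin> basis_elts m \<longrightarrow> unstarred (M 1)" and
    c6: "odd m \<and> 2 \<le> k \<and> vdeg (y (k - 1)) \<notin> basis_elts m \<and> vdeg (y k) \<in> basis_elts m \<longrightarrow>
          unstarred (M (Suc k))" and
    c7: "odd m \<and> k = 1 \<and> vdeg (y 1) \<in> basis_elts m \<longrightarrow> unstarred (M 1) \<or> unstarred (M 2)"
  interpret word_blocks k M y w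
    by unfold_locales (use w y M in \<open>auto simp: blk_def nz_0_iff\<close>)
  have nz0: "t = i" if "1 \<le> i" "i \<le> t" "t \<le> Suc k" "nz (blk M y i t @ z) = 0" for i t z
    using nz_blk[of i t] that by simp
  have first: "\<exists>t. 1 \<le> t \<and> t \<le> k \<and> l = y t \<and> x = blk M y 1 t @ M t \<and> z = tl_from (Suc t)"
    if "w = x @ l # z" "vdeg l \<noteq> 0" for x l z
    using split_nz[of 1 x l z] that w_tl by auto
  have pair: "\<exists>t t'. 1 \<le> t \<and> t < t' \<and> t' \<le> k \<and> l = y t \<and> l' = y t' \<and> x = blk M y 1 t @ M t \<and>
      s = blk M y (Suc t) t' @ M t' \<and> z = tl_from (Suc t')"
    if w: "w = x @ l # s @ l' # z" and l: "vdeg l \<noteq> 0" "vdeg l' \<noteq> 0" for x l s l' z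
  proof -
    from first[OF w l(1)] obtain t where t: "1 \<le> t \<and> t \<le> k \<and> l = y t \<and> x = blk M y 1 t @ M t \<and> s @ l' # z = tl_from (Suc t)"
      by blast
    then have "tl_from (Suc t) = s @ l' # z" by simp
    from split_nz[OF _ _ this l(2)] t obtain t' where "Suc t \<le> t' \<and> t' \<le> k \<and> l' = y t' \<and> s = blk M y (Suc t) t' @ M t' \<and> z = tl_from (Suc t')"
      by auto
    with t show ?thesis by (intro exI[of _ t] exI[of _ t']) auto
  qed
  have "good_order TYPE('f) m w"
    unfolding good_order_def
  proof (intro conjI allI impI; elim conjE)
    fix x l l' z assume "w = x @ l # l' # z" "vdeg l = 0" "vdeg l' = 0"
    then obtain t p q where "1 \<le> t" "t \<le> Suc k" "M t = p @ l # l' # q"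
      using split_zeros[of 1 x l l' z] w_tl by auto
    then show "vind l < vind l'" using c1 sorted_wrt_adjacentD[of vind p l l' q] by (metis atLeastAtMost_iff)
  next
    fix x l z assume *: "w = x @ l # z" "vdeg l \<noteq> 0" "dimU TYPE('f) m (vdeg l) = 1"
    obtain t where t: "1 \<le> t" "t \<le> k" "l = y t" "x = blk M y 1 t @ M t"
      using first[OF *(1,2)] by blast
    then have "\<not> starred (y t) \<and> M t = []" using c2 *(3) by auto
    then show "\<not> starred l" "x = [] \<or> vdeg (last x) \<noteq> 0" using t blk_end[of t] by auto
  next
    fix x l s l' z assume *: "w = x @ l # s @ l' # z" "vdeg l \<noteq> 0" "vdeg l' \<noteq> 0"
      "dimU TYPE('f) m (wdeg (l # s @ [l'])) = 1"
    obtain t t' where t: "1 \<le> t" "t < t'" "t' \<le> k" "l = y t" "l' = y t'" "x = blk M y 1 t @ M t"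
      "s = blk M y (Suc t) t' @ M t'" using pair[OF *(1-3)] by blast
    have "wdeg (l # s @ [l']) = vdeg (y t) + (\<Sum>i = Suc t..<t'. vdeg (y i)) + vdeg (y t')"
      using t M[of t'] by (simp add: wdeg_blk wdeg_nz_0)
    also have "\<dots> = (\<Sum>i = t..t'. vdeg (y i))"
      by (rule sum_both_ends[OF t(2)])
    finally have "dimU TYPE('f) m (\<Sum>i = t..t'. vdeg (y i)) = 1" using *(4) by simp
    then have "M t = [] \<and> vind (y t) < vind (y t')" by (intro c3[rule_format]) (use t in auto)
    then show "vind l < vind l'" "x = [] \<or> vdeg (last x) \<noteq> 0" using t blk_end[of t] by auto
  qed
  moreover have "good_center m w"
    unfolding good_center_def
  proof (intro conjI allI impI; elim conjE)
    fix x l s l' z assume *: "odd m" "w = x @ l # s @ l' # z" "nz s = 0" "vdeg l \<in> basis_elts m" "vdeg l' \<in> basis_elts m"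
    then obtain t t' where t: "1 \<le> t" "t < t'" "t' \<le> k" "l = y t" "l' = y t'"
      "s = blk M y (Suc t) t' @ M t'" using pair[OF *(2)] basis_elts_nonzero by metis
    then have "t' = Suc t" using nz0[of "Suc t" t'] *(3) by auto
    then show "unstarred s" using c4 * t by auto
  next
    fix s l z l' z' assume *: "odd m" "w = s @ l # z @ l' # z'" "nz s = 0" "nz z = 0" "vdeg l \<in> basis_elts m"
      "vdeg l' \<noteq> 0" "vdeg l' \<notin> basis_elts m"
    then obtain t t' where t: "1 \<le> t" "t < t'" "t' \<le> k" "l = y t" "l' = y t'" "s = blk M y 1 t @ M t"
      "z = blk M y (Suc t) t' @ M t'" using pair[OF *(2) _ *(6)] basis_elts_nonzero by metis
    moreover have "t = 1" using nz0[of 1 t] *(3) t by auto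
    moreover have "t' = Suc t" using nz0[of "Suc t" t'] *(4) t by auto
    ultimately show "unstarred s" using c5 * by (auto simp: numeral_2_eq_2)
  next
    fix s l z l' z' assume *: "odd m" "w = z' @ l' # z @ l # s" "nz s = 0" "nz z = 0" "vdeg l \<in> basis_elts m"
      "vdeg l' \<noteq> 0" "vdeg l' \<notin> basis_elts m"
    then obtain t t' where t: "1 \<le> t" "t < t'" "t' \<le> k" "l' = y t" "l = y t'"
      "z = blk M y (Suc t) t' @ M t'" "s = tl_from (Suc t')" using pair[OF *(2,6)] basis_elts_nonzero by metis
    moreover have "t' = Suc t" using nz0[of "Suc t" t'] *(4) t by auto
    moreover have "Suc k = Suc t'" using nz0[of "Suc t'" "Suc k"] *(3) t by (auto simp: tl_from_def)
    moreover have "s = M (Suc k)" using calculation tl_from_end by metis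
    ultimately show "unstarred s" using c6 * by auto
  next
    fix s l s' assume *: "odd m" "w = s @ l # s'" "nz s = 0" "nz s' = 0" "vdeg l \<in> basis_elts m"
    then obtain t where t: "1 \<le> t" "t \<le> k" "l = y t" "s = blk M y 1 t @ M t" "s' = tl_from (Suc t)"
      using first[OF *(2)] basis_elts_nonzero by metis
    moreover have "t = 1" using nz0[of 1 t] *(3) t by auto
    moreover have "Suc k = Suc t" using nz0[of "Suc t" "Suc k"] *(4) t by (auto simp: tl_from_def)
    moreover have "s' = M (Suc k)" using calculation tl_from_end by metis
    ultimately show "unstarred s \<or> unstarred s'" using c7 * by (auto simp: numeral_2_eq_2)
  qed
  ultimately show ?thesis by simp
qed

lemma good_monoI:
  assumes nonid: "(fmonom w :: (zgrp, 'f::field) fpoly) \<notin> UT_identities m"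
    and good: "good_order TYPE('f) m w" "good_center m w"
  shows "good_mono TYPE('f) m w"
proof -
  obtain k M y where "word_blocks k M y w" using word_blocks_exist by blast
  then interpret word_blocks k M y w .
  have g1: "vind l < vind l'" if "w = x @ l # l' # z" "vdeg l = 0" "vdeg l' = 0" for x l l' z
    using good(1) that unfolding good_order_def by blast
  have g2: "\<not> starred l \<and> (x = [] \<or> vdeg (last x) \<noteq> 0)"
    if "w = x @ l # z" "vdeg l \<noteq> 0" "dimU TYPE('f) m (vdeg l) = 1" for x l z
    using good(1) that unfolding good_order_def by blast
  have g3: "vind l < vind l' \<and> (x = [] \<or> vdeg (last x) \<noteq> 0)"
    if "w = x @ l # s @ l' # z" "vdeg l \<noteq> 0" "vdeg l' \<noteq> 0" "dimU TYPE('f) m (wdeg (l # s @ [l'])) = 1" for x l s l' z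
    using good(1) that unfolding good_order_def by blast
  have s1: "sorted_wrt (<) (map vind (M i))" if i: "1 \<le> i" "i \<le> Suc k" for i
  proof (rule sorted_wrt_adjacent)
    fix p l l' q assume Mi: "M i = p @ l # l' # q"
    have "\<exists>z. w = blk M y 1 i @ M i @ z"
    proof (cases "i = Suc k")
      case True
      then show ?thesis using w by (intro exI[of _ "[]"]) simp
    next
      case False
      then show ?thesis using w_split[OF i(1)] i(2) by fastforce
    qed
    then obtain z where "w = (blk M y 1 i @ p) @ l # l' # (q @ z)" using Mi by auto
    moreover have "vdeg l = 0" "vdeg l' = 0" using M[OF i] Mi by (auto simp: nz_0_iff)
    ultimately show "vind l < vind l'" by (rule g1)
  qed
  have s2: "\<not> starred (y i) \<and> M i = []" if i: "1 \<le> i" "i \<le> k" "dimU TYPE('f) m (vdeg (y i)) = 1" for i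
  proof -
    have "w = (blk M y 1 i @ M i) @ y i # tl_from (Suc i)" using w_split[OF i(1,2)] by simp
    from g2[OF this y[OF i(1,2)] i(3)] have *: "\<not> starred (y i)"
      "blk M y 1 i @ M i = [] \<or> vdeg (last (blk M y 1 i @ M i)) \<noteq> 0" by blast+
    have "M i = []" by (rule blk_endD[OF i(1) _ *(2)]) (use i in simp)
    then show ?thesis using *(1) by simp
  qed
  have s3: "M i = [] \<and> vind (y i) < vind (y j)"
    if i: "1 \<le> i" "i < j" "j \<le> k" "dimU TYPE('f) m (\<Sum>t = i..j. vdeg (y t)) = 1" for i j
  proof -
    let ?s = "blk M y (Suc i) j @ M j"
    have "wdeg (y i # ?s @ [y j]) = vdeg (y i) + (\<Sum>t = Suc i..<j. vdeg (y t)) + vdeg (y j)"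
      using i M[of j] by (simp add: wdeg_blk wdeg_nz_0)
    also have "\<dots> = (\<Sum>t = i..j. vdeg (y t))"
      by (rule sum_both_ends[OF i(2)])
    finally have d: "dimU TYPE('f) m (wdeg (y i # ?s @ [y j])) = 1" using i by simp
    have "w = (blk M y 1 i @ M i) @ y i # ?s @ y j # tl_from (Suc j)" using w_split2[OF i(1-3)] by simp
    from g3[OF this y y d] i have *: "vind (y i) < vind (y j)"
      "blk M y 1 i @ M i = [] \<or> vdeg (last (blk M y 1 i @ M i)) \<noteq> 0" by simp_all
    have "M i = []" by (rule blk_endD[OF i(1) _ *(2)]) (use i in simp)
    then show ?thesis using *(1) by simp
  qed
  have s4: "unstarred (M (Suc i))"
    if "odd m" "1 \<le> i" "i < k" "vdeg (y i) \<in> basis_elts m" "vdeg (y (Suc i)) \<in> basis_elts m" for i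
  proof -
    have "w = (blk M y 1 i @ M i) @ y i # M (Suc i) @ y (Suc i) # tl_from (Suc (Suc i))"
      using w_split2[of i "Suc i"] that by simp
    from good_center_inner[OF good(2) that(1) this] show ?thesis using that M[of "Suc i"] by simp
  qed
  have s5: "unstarred (M 1)"
    if "odd m" "2 \<le> k" "vdeg (y 1) \<in> basis_elts m" "vdeg (y 2) \<notin> basis_elts m"
  proof -
    have "w = M 1 @ y 1 # M 2 @ y 2 # tl_from 3"
      using w_split2[of 1 2] that by (simp add: numeral_3_eq_3 numeral_2_eq_2)
    from good_center_start[OF good(2) that(1) this] show ?thesis using that M[of 1] M[of 2] y[of 2] by simp
  qed
  have s6: "unstarred (M (Suc k))"
    if "odd m" "2 \<le> k" "vdeg (y (k - 1)) \<notin> basis_elts m" "vdeg (y k) \<in> basis_elts m"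
  proof -
    have "w = (blk M y 1 (k - 1) @ M (k - 1)) @ y (k - 1) # M k @ y k # M (Suc k)"
      using w_split2[of "k - 1" k] that by (simp add: tl_from_end)
    from good_center_end[OF good(2) that(1) this] show ?thesis
      using that M[of k] M[of "Suc k"] y[of "k - 1"] by simp
  qed
  have s7: "unstarred (M 1) \<or> unstarred (M 2)" if "odd m" "k = 1" "vdeg (y 1) \<in> basis_elts m"
  proof -
    have "w = M 1 @ y 1 # M 2"
      using w_split[of 1] that tl_from_end by (simp add: numeral_2_eq_2)
    from good_center_single[OF good(2) that(1) this] show ?thesis using that M[of 1] M[of 2] by simp
  qed
  show ?thesis
    unfolding good_mono_def
  proof (intro conjI exI[of _ k] exI[of _ M] exI[of _ y])
    show "w = concat (map (\<lambda>i. M i @ [y i]) [1..<Suc k]) @ M (Suc k)" using w by (simp only: blk_def)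
    show "fmonom w \<notin> (UT_identities m :: (zgrp, 'f) fpoly set)" by (rule nonid)
    show "\<forall>i \<in> {1..k}. vdeg (y i) \<noteq> 0" using y by simp
    show "\<forall>i \<in> {1..Suc k}. \<forall>l \<in> set (M i). vdeg l = 0"
      using M unfolding nz_0_iff by (metis atLeastAtMost_iff)
    show "\<forall>i \<in> {1..Suc k}. sorted_wrt (<) (map vind (M i))" using s1 by simp
    show "\<forall>i \<in> {1..k}. dimU TYPE('f) m (vdeg (y i)) = 1 \<longrightarrow> \<not> starred (y i) \<and> M i = []"
      by (intro ballI impI s2) simp_all
    show "\<forall>i \<in> {1..k}. \<forall>j \<in> {1..k}. i < j \<and> dimU TYPE('f) m (\<Sum>t = i..j. vdeg (y t)) = 1 \<longrightarrow>
        M i = [] \<and> vind (y i) < vind (y j)"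
      by (intro ballI impI s3) simp_all
    show "odd m \<longrightarrow> (\<forall>i \<in> {1..<k}.
        vdeg (y i) \<in> basis_elts m \<and> vdeg (y (Suc i)) \<in> basis_elts m \<longrightarrow> unstarred (M (Suc i)))"
      by (intro ballI impI s4) simp_all
    show "odd m \<and> 2 \<le> k \<and> vdeg (y 1) \<in> basis_elts m \<and> vdeg (y 2) \<notin> basis_elts m \<longrightarrow> unstarred (M 1)"
      by (intro impI s5) simp_all
    show "odd m \<and> 2 \<le> k \<and> vdeg (y (k - 1)) \<notin> basis_elts m \<and> vdeg (y k) \<in> basis_elts m \<longrightarrow>
        unstarred (M (Suc k))"
      by (intro impI s6) simp_all
    show "odd m \<and> k = 1 \<and> vdeg (y 1) \<in> basis_elts m \<longrightarrow> unstarred (M 1) \<or> unstarred (M 2)"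
      by (intro impI s7) simp_all
  qed
qed


section \<open>Uniqueness of good words\<close>

lemma good_order_zeros:
  assumes "good_order TYPE('f::field) m (x @ l # l' # z)" "vdeg l = 0" "vdeg l' = 0"
  shows "vind l < vind l'"
  by (rule assms(1)[unfolded good_order_def, THEN conjunct1, rule_format,
      OF conjI[OF refl conjI[OF assms(2,3)]]])

lemma good_order_single:
  assumes "good_order TYPE('f::field) m (x @ l # z)" "vdeg l \<noteq> 0" "dimU TYPE('f) m (vdeg l) = 1"
  shows "\<not> starred l \<and> (x = [] \<or> vdeg (last x) \<noteq> 0)"
  by (rule assms(1)[unfolded good_order_def, THEN conjunct2, THEN conjunct1, rule_format,
      OF conjI[OF refl conjI[OF assms(2,3)]]])

lemma good_order_segment:
  assumes "good_order TYPE('f::field) m (x @ l # s @ l' # z)" "vdeg l \<noteq> 0" "vdeg l' \<noteq> 0"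
    "dimU TYPE('f) m (wdeg (l # s @ [l'])) = 1"
  shows "vind l < vind l' \<and> (x = [] \<or> vdeg (last x) \<noteq> 0)"
  by (rule assms(1)[unfolded good_order_def, THEN conjunct2, THEN conjunct2, rule_format,
      OF conjI[OF refl conjI[OF assms(2) conjI[OF assms(3,4)]]]])

lemma good_order_tl:
  assumes "good_order TYPE('f::field) m (l # w)"
  shows "good_order TYPE('f) m w"
  unfolding good_order_def
proof (intro conjI allI impI; elim conjE)
  fix x l1 l2 z assume "w = x @ l1 # l2 # z" "vdeg l1 = 0" "vdeg l2 = 0"
  then show "vind l1 < vind l2" using good_order_zeros[of m "l # x" l1 l2 z, where ?'f = 'f] assms by simp
next
  fix x l1 z assume "w = x @ l1 # z" "vdeg l1 \<noteq> 0" "dimU TYPE('f) m (vdeg l1) = 1"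
  then show "\<not> starred l1" "x = [] \<or> vdeg (last x) \<noteq> 0"
    using good_order_single[of m "l # x" l1 z, where ?'f = 'f] assms by (auto split: if_splits)
next
  fix x l1 s l2 z assume "w = x @ l1 # s @ l2 # z" "vdeg l1 \<noteq> 0" "vdeg l2 \<noteq> 0"
    "dimU TYPE('f) m (wdeg (l1 # s @ [l2])) = 1"
  then show "vind l1 < vind l2" "x = [] \<or> vdeg (last x) \<noteq> 0"
    using good_order_segment[of m "l # x" l1 s l2 z, where ?'f = 'f] assms by (auto split: if_splits)
qed

lemma good_order_sorted:
  "good_order TYPE('f::field) m (l' # x @ l # z) \<Longrightarrow> vdeg l' = 0 \<Longrightarrow> nz x = 0 \<Longrightarrow> vdeg l = 0 \<Longrightarrow>
    vind l' < vind l"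
proof (induction x arbitrary: l')
  case Nil
  then show ?case using good_order_zeros[of m "[]" l' l z, where ?'f = 'f] by simp
next
  case (Cons l2 x)
  then have "vdeg l2 = 0" "nz x = 0" by (auto split: if_splits)
  then have "vind l' < vind l2" using good_order_zeros[of m "[]" l' l2 "x @ l # z", where ?'f = 'f] Cons.prems by simp
  moreover have "vind l2 < vind l"
    using Cons.IH[OF _ \<open>vdeg l2 = 0\<close> \<open>nz x = 0\<close>] good_order_tl[of m l', where ?'f = 'f] Cons.prems by simp
  ultimately show ?case by simp
qed

text \<open>The degree of such a prefix has a one-dimensional component. Hence (II), or (III) for
  its first and last letters of nonzero degree, forbids a letter of degree 0 directly before the
  first of them.\<close>

lemma good_order_palindrome:
  assumes good: "good_order TYPE('f::field) m (x @ y)" and p: "path u m a x (mirror m a) X" and ne: "mirror m a \<noteq> a"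
  shows "x \<noteq> [] \<and> vdeg (hd x) \<noteq> 0"
proof -
  have nz: "nz x \<noteq> 0" using path_nz[OF p] ne by simp
  then have d: "dimU TYPE('f) m (wdeg x) = 1"
    using dimU_1_edge[OF path_edge[OF p], where ?'f = 'f] path_wdeg_nz[OF p] by simp
  obtain p l q where x: "x = p @ l # q" "nz p = 0" "vdeg l \<noteq> 0" using split_first_nz[OF nz] by blast
  have "p = [] \<or> vdeg (last p) \<noteq> 0"
  proof (cases "nz q = 0")
    case True
    then have "wdeg x = vdeg l" using x by (simp add: wdeg_nz_0)
    then have "dimU TYPE('f) m (vdeg l) = 1" using d by simp
    then show ?thesis using good_order_single[of m p l "q @ y", where ?'f = 'f] good x by simp
  next
    case False
    then obtain s l' t where q: "q = s @ l' # t" "nz t = 0" "vdeg l' \<noteq> 0" using split_last_nz by blast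
    then have "wdeg (l # s @ [l']) = wdeg x" using x by (simp add: wdeg_nz_0)
    then have "dimU TYPE('f) m (wdeg (l # s @ [l'])) = 1" using d by (simp only:)
    then show ?thesis using good_order_segment[of m p l s l' "t @ y", where ?'f = 'f] good x q by simp
  qed
  moreover have "p = [] \<or> vdeg (last p) = 0"
    using x(2) by (cases p rule: rev_cases) (auto simp: nz_0_iff)
  ultimately have "p = []" by blast
  then show ?thesis using x by simp
qed

text \<open>As v begins with a letter of degree 0, \<open>good_order_palindrome\<close> keeps it
  from reaching \<open>mirror m a\<close> when a is not central. If w read l there, w would end
  there or leave along an edge recorded in X; the common end or the common monomial would bring v
  there too. So w reads l at a, among its leading letters of degree 0, which are sorted by
  index.\<close>

lemma good_zero_step:
  assumes good: "good_order TYPE('f::field) m v" "good_order TYPE('f) m w"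
    and p: "path True m a v b X" "path True m a w b X" and v: "v = l # v1" "vdeg l = 0"
  shows "\<exists>l' w1. w = l' # w1 \<and> vdeg l' = 0 \<and> (l' = l \<or> vind l' < vind l)"
proof -
  have lt: "a < m" "b < m" using path_less[OF p(1)] by auto
  have e: "edge m a a (vdeg l)" using v(2) lt by (simp add: edge_zero)
  have l: "mirror m a = a \<longrightarrow> \<not> starred l" using p(1) v by auto
  have "coord m l a a \<in># X" using p(1) v by (auto simp: edge_zero)
  from path_memE[OF p(2) this] obtain x l2 y c d Y Z where
    w: "w = x @ l2 # y" "coord m l a a = coord m l2 c d" "path True m a x c Y" "edge m c d (vdeg l2)"
      "path True m d y b Z" "True \<and> vdeg l2 = 0 \<and> mirror m c = c \<longrightarrow> \<not> starred l2" by metis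
  note D = coord_eqD[OF w(2) e w(4)]
  show ?thesis
  proof (cases "c = a")
    case True
    then have "l2 = l" using D l w(6) v(2) lt mirror_mirror[OF lt(1)] by auto
    have "nz x = 0" using path_nz[OF w(3)] True by simp
    show ?thesis
    proof (cases x)
      case Nil
      then show ?thesis using w(1) \<open>l2 = l\<close> v(2) by simp
    next
      case (Cons l' x')
      then have "vdeg l' = 0" "nz x' = 0" using \<open>nz x = 0\<close> by (auto split: if_splits)
      moreover have "vind l' < vind l"
        using good_order_sorted[of m l' x' l y, where ?'f = 'f] good(2) w(1) Cons calculation \<open>l2 = l\<close> v(2) by simp
      ultimately show ?thesis using w(1) Cons by simp
    qed
  next
    case False
    then have c: "c = mirror m a" "d = mirror m a" "l2 = indet_star l" using D(2) by auto
    have no: False if "path True m a s (mirror m a) S" "v = s @ t" for s t S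
      using good_order_palindrome[of m s t True a S, where ?'f = 'f] that good(1) v c(1) False by (cases s) auto
    have "mirror m a \<le> b" using path_less[OF w(5)] c by simp
    show ?thesis
    proof (cases "b = mirror m a")
      case True
      then show ?thesis using no[of v X "[]"] p(1) by simp
    next
      case False
      then have "nz y \<noteq> 0" using path_nz[OF w(5)] c by auto
      then obtain s l3 t where y: "y = s @ l3 # t" "nz s = 0" "vdeg l3 \<noteq> 0" using split_first_nz by blast
      obtain d' S T where q: "path True m (mirror m a) s d' S" "path True m d' (l3 # t) b T"
        using w(5) c unfolding y(1) path_append by blast
      then have "d' = mirror m a" using path_zero[OF y(2)] by blast
      then obtain e' where e': "edge m (mirror m a) e' (vdeg l3)" using q(2) by auto
      have "path True m a ((x @ l2 # s) @ l3 # t) b X" using p(2) w(1) y(1) by simp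
      moreover have "path True m d s (mirror m a) S" using q(1) \<open>d' = mirror m a\<close> c by simp
      then have "path True m c (l2 # s) (mirror m a) (add_mset (coord m l2 c d) S)"
        unfolding path.simps using w(4,6) by blast
      then obtain R where "path True m a (x @ l2 # s) (mirror m a) R"
        unfolding path_append[of _ _ _ x] using w(3) by blast
      ultimately have "coord m l3 (mirror m a) e' \<in># X" using e' by (rule path_mem)
      from path_memE[OF p(1) this] obtain x' l4 y' c' d'' Y' Z' where
        v': "v = x' @ l4 # y'" "coord m l3 (mirror m a) e' = coord m l4 c' d''" "path True m a x' c' Y'" "edge m c' d'' (vdeg l4)"
        by metis
      have "c' = mirror m a \<or> c' = mirror m e' \<and> d'' = a"
        using coord_eqD(2)[OF v'(2) e' v'(4)] lt by auto
      \<comment> \<open>The path of v starts at a, so no edge of nonzero degree on it leads to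
        a.\<close>
      moreover have "d'' \<noteq> a"
      proof
        assume "d'' = a"
        then have "c' = a" using path_less[OF v'(3)] edge_less[OF v'(4)] by simp
        then have "vdeg l4 = 0" using v'(4) \<open>d'' = a\<close> by (simp add: edge_refl)
        then show False using coord_eqD(1)[OF v'(2) e' v'(4)] y(3) by simp
      qed
      ultimately show ?thesis using no v'(1,3) by blast
    qed
  qed
qed

text \<open>If w reads l on the mirrored edge, its prefix up to that letter leads from a to
  \<open>mirror m a\<close>, and (III) compares the two ends of the prefix. If w reads l on the same
  edge, that letter comes first, and (II) settles the star when the edge is its own mirror
  image.\<close>

lemma good_nonzero_step:
  assumes good: "good_order TYPE('f::field) m v" "good_order TYPE('f) m w"
    and p: "path True m a v b X" "path True m a w b X"
    and v: "v = l # v1" "vdeg l \<noteq> 0" and w: "w = l' # w1" "vdeg l' \<noteq> 0"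
  shows "l' = l \<or> vind l' < vind l"
proof -
  obtain c where e: "edge m a c (vdeg l)" and k: "coord m l a c \<in># X" using p(1) v by auto
  have lt: "a < m" "c < m" "a < c" using edge_less[OF e] edge_less_iff[OF e] v by auto
  from path_memE[OF p(2) k] obtain x l2 y c2 d2 Y Z where
    w2: "w = x @ l2 # y" "coord m l a c = coord m l2 c2 d2" "path True m a x c2 Y" "edge m c2 d2 (vdeg l2)" by metis
  note D = coord_eqD[OF w2(2) e w2(4)]
  show ?thesis
  proof (cases "c2 = a \<and> d2 = c")
    case True
    then have "nz x = 0" using path_nz[OF w2(3)] by simp
    then have "x = []" using w w2(1) by (cases x) auto
    then have "l' = l2" using w w2(1) by simp
    consider "l2 = l" | "l2 = indet_star l" "c = mirror m a" using D(2) True lt by auto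
    then show ?thesis
    proof cases
      case 2
      then have "dimU TYPE('f) m (vdeg l) = 1" using dimU_1_edge[of m a "vdeg l", where ?'f = 'f] e v by simp
      then have "\<not> starred l" "\<not> starred l2"
        using good_order_single[of m "[]" l v1, where ?'f = 'f] good_order_single[of m x l2 y, where ?'f = 'f] good v w2(1) D(1) by auto
      then show ?thesis using 2 by simp
    qed (use \<open>l' = l2\<close> in simp)
  next
    case False
    then have c: "c2 = mirror m c" "d2 = mirror m a" "l2 = indet_star l" using D(2) by auto
    have "x \<noteq> []"
    proof
      assume "x = []"
      then have "a = mirror m c" using w2(3) c by simp
      then show False using False c lt by auto
    qed
    then obtain s where x: "x = l' # s" using w w2(1) by (cases x) auto
    have "edge m a (mirror m a) (wdeg (x @ [l2]))"
      using edge_trans[OF path_edge[OF w2(3)] w2(4)] c by simp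
    moreover have "wdeg (x @ [l2]) \<noteq> 0"
    proof -
      have "a < mirror m a" using edge_less_iff[OF w2(4)] path_less[OF w2(3)] D(1) v c by auto
      then show ?thesis using edge_less_iff[OF calculation] by simp
    qed
    ultimately have "dimU TYPE('f) m (wdeg (l' # s @ [l2])) = 1" using dimU_1_edge[of m a, where ?'f = 'f] x by simp
    then show ?thesis
      using good_order_segment[of m "[]" l' s l2 y, where ?'f = 'f] good w2(1) x w v D(1) c(3) by simp
  qed
qed

text \<open>The two step lemmas, applied in both directions, force the first letters to agree by
  antisymmetry; the remaining suffixes are again subject to (I) to (III).\<close>

lemma good_unique:
  assumes "good_order TYPE('f::field) m v" "good_order TYPE('f) m w"
    and "path True m a v b X" "path True m a w b X"
  shows "v = w"
  using assms
proof (induction "size X" arbitrary: a v w X)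
  case 0
  then show ?case using path_size[OF 0(4)] path_size[OF 0(5)] by simp
next
  case (Suc n)
  have "v \<noteq> []" "w \<noteq> []" using path_size[OF Suc(5)] path_size[OF Suc(6)] Suc(2) by auto
  then obtain l v1 l' w1 where vw: "v = l # v1" "w = l' # w1" by (metis list.exhaust)
  have "vdeg l = 0 \<longleftrightarrow> vdeg l' = 0"
    using good_zero_step[OF Suc(3-6)] good_zero_step[OF Suc(4,3,6,5)] vw by auto
  moreover have "l' = l \<or> vind l' < vind l" "l = l' \<or> vind l < vind l'" if "vdeg l = 0" "vdeg l' = 0"
    using good_zero_step[OF Suc(3-6)] good_zero_step[OF Suc(4,3,6,5)] vw that by auto
  moreover have "l' = l \<or> vind l' < vind l" "l = l' \<or> vind l < vind l'" if "vdeg l \<noteq> 0" "vdeg l' \<noteq> 0"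
    using good_nonzero_step[OF Suc(3-6) vw(1) that(1) vw(2) that(2)]
      good_nonzero_step[OF Suc(4,3,6,5) vw(2) that(2) vw(1) that(1)] by auto
  ultimately have "l' = l" by fastforce
  obtain c Y where v: "edge m a c (vdeg l)" "path True m c v1 b Y" "X = add_mset (coord m l a c) Y"
    using Suc(5) vw(1) by auto
  obtain c' Y' where w: "edge m a c' (vdeg l)" "path True m c' w1 b Y'" "X = add_mset (coord m l a c') Y'"
    using Suc(6) vw(2) \<open>l' = l\<close> by auto
  have "c' = c" using edge_det v(1) w(1) by blast
  then have "Y' = Y" using v(3) w(3) by simp
  have "v1 = w1"
    by (rule Suc(1)[OF _ _ _ v(2)])
      (use Suc(2-4) vw v w \<open>c' = c\<close> \<open>Y' = Y\<close> good_order_tl[of m l v1, where ?'f = 'f]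
        good_order_tl[of m l' w1, where ?'f = 'f] in auto)
  then show ?case using vw \<open>l' = l\<close> by simp
qed

section \<open>Stars at the center of good words\<close>

lemma edge_center_nonbasis:
  assumes "edge m c d g" "edge m d e h" "mirror m c = c" "g \<noteq> 0" "h \<noteq> 0"
  shows "odd m \<and> g \<in> basis_elts m \<and> h \<notin> basis_elts m"
proof -
  have lt: "c < d" "d < e" "c < m" using edge_less_iff[OF assms(1)] edge_less_iff[OF assms(2)] edge_less[OF assms(1)] assms by auto
  then have "odd m" "c = m div 2" using mirror_center_iff assms(3) by auto
  then show ?thesis using basis_elt_edge[OF _ assms(1)] basis_elt_edge[OF _ assms(2)] lt by auto
qed

lemma edge_center_nonbasis':
  assumes "edge m e d h" "edge m d c g" "mirror m c = c" "g \<noteq> 0" "h \<noteq> 0"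
  shows "odd m \<and> g \<in> basis_elts m \<and> h \<notin> basis_elts m"
proof -
  have lt: "e < d" "d < c" "c < m" using edge_less_iff[OF assms(1)] edge_less_iff[OF assms(2)] edge_less[OF assms(2)] assms by auto
  then have "odd m" "c = m div 2" using mirror_center_iff assms(3) by auto
  then show ?thesis using basis_elt_edge[OF _ assms(1)] basis_elt_edge[OF _ assms(2)] lt by auto
qed

lemma path_ConsE:
  assumes "path u m a (l # w) b X"
  obtains c Y where "edge m a c (vdeg l)" "path u m c w b Y"
  using assms by auto

text \<open>A letter read at the center falls under (V) if the path starts there, under (VI) if it
  ends there, and under (IV) otherwise. \<open>noncentral\<close> provides the second letter of
  nonzero degree which (V) and (VI) require.\<close>

lemma good_center_path:
  assumes good: "good_center m w" and p: "path False m a w b X" and nc: "noncentral m a b w" "m \<noteq> 1"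
  shows "path True m a w b X"
proof (rule path_strengthen[OF p])
  fix x l y c Y
  assume w: "w = x @ l # y" and l: "vdeg l = 0" and c: "mirror m c = c"
    and x: "path False m a x c Y" and y: "path False m c y b (X - add_mset (coord m l c c) Y)"
  have "c < m" using path_less[OF x] by simp
  then have odd: "odd m" and cm: "c = m div 2" using mirror_center_iff c by auto
  show "\<not> starred l"
  proof (cases "nz x = 0")
    case True
    then have "a = c" using path_nz[OF x] by simp
    then have "2 \<le> nz w" using nc c by (simp add: noncentral_def)
    then have n: "2 \<le> nz y" using w l True by simp
    then obtain p1 l1 y1 where 1: "y = p1 @ l1 # y1" "nz p1 = 0" "vdeg l1 \<noteq> 0" using split_first_nz[of y] by auto
    then have "nz y1 \<noteq> 0" using n by simp
    then obtain p2 l2 y2 where 2: "y1 = p2 @ l2 # y2" "nz p2 = 0" "vdeg l2 \<noteq> 0" using split_first_nz by blast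
    obtain c1 where "path False m c (l1 # p2 @ l2 # y2) b c1"
      using y path_zero[OF 1(2)] unfolding 1(1) 2(1) path_append[of _ _ _ p1] by metis
    then obtain d D where d: "edge m c d (vdeg l1)" "path False m d (p2 @ l2 # y2) b D" by (rule path_ConsE)
    then obtain D' where "path False m d (l2 # y2) b D'"
      using path_zero[OF 2(2)] unfolding path_append[of _ _ _ p2] by metis
    then obtain e where "edge m d e (vdeg l2)" by (rule path_ConsE)
    from edge_center_nonbasis[OF d(1) this c 1(3) 2(3)]
    have "unstarred (x @ l # p1)"
      by (intro good_center_start[OF good odd, of _ l1 p2 l2 y2]) (use w 1 2 l True in auto)
    then show ?thesis by (simp add: unstarred_def)
  next
    case nzx: False
    then obtain x1 l1 p1 where 1: "x = x1 @ l1 # p1" "nz p1 = 0" "vdeg l1 \<noteq> 0" using split_last_nz by blast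
    obtain d D where d: "path False m a x1 d D" "\<exists>T. path False m d (l1 # p1) c T"
      using x unfolding 1(1) path_append[of _ _ _ x1] by blast
    obtain d' T where d': "edge m d d' (vdeg l1)" "path False m d' p1 c T"
      using d(2) path_ConsE by metis
    then have e1: "edge m d c (vdeg l1)" using path_zero[OF 1(2)] by blast
    show ?thesis
    proof (cases "nz y = 0")
      case True
      then have "b = c" using path_nz[OF y] by simp
      then have "2 \<le> nz w" using nc c by (simp add: noncentral_def)
      then have "nz x1 \<noteq> 0" using w l True 1 by (auto split: if_splits)
      then obtain x2 l2 p2 where 2: "x1 = x2 @ l2 # p2" "nz p2 = 0" "vdeg l2 \<noteq> 0" using split_last_nz by blast
      obtain e where e: "\<exists>T. path False m e (l2 # p2) d T"
        using d(1) unfolding 2(1) path_append[of _ _ _ x2] by blast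
      then obtain e' T where e': "edge m e e' (vdeg l2)" "path False m e' p2 d T" using path_ConsE by metis
      then have e2: "edge m e d (vdeg l2)" using path_zero[OF 2(2)] by blast
      from edge_center_nonbasis'[OF e2 e1 c 1(3) 2(3)]
      have "unstarred (p1 @ l # y)"
        by (intro good_center_end[OF good odd, of x2 l2 p2 l1]) (use w 1 2 l True in auto)
      then show ?thesis by (simp add: unstarred_def)
    next
      case False
      then obtain p2 l2 y2 where 2: "y = p2 @ l2 # y2" "nz p2 = 0" "vdeg l2 \<noteq> 0" using split_first_nz by blast
      obtain T where "path False m c (l2 # y2) b T"
        using y path_zero[OF 2(2)] unfolding 2(1) path_append[of _ _ _ p2] by metis
      then obtain e where e2: "edge m c e (vdeg l2)" by (rule path_ConsE)
      have "vdeg l1 \<in> basis_elts m" "vdeg l2 \<in> basis_elts m"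
        using basis_elt_edge[OF odd e1] basis_elt_edge[OF odd e2] edge_less_iff[OF e1] edge_less_iff[OF e2] 1(3) 2(3) cm by auto
      then have "unstarred (p1 @ l # p2)"
        by (intro good_center_inner[OF good odd, of x1 l1 _ l2 y2]) (use w 1 2 l in auto)
      then show ?thesis by (simp add: unstarred_def)
    qed
  qed
qed


section \<open>Reduction to good words\<close>

lemma left_unst_takeWhile: "left_unst w \<longleftrightarrow> (\<forall>z \<in> set (takeWhile (\<lambda>l. vdeg l = 0) w). \<not> starred z)"
proof
  assume *: "left_unst w"
  show "\<forall>z \<in> set (takeWhile (\<lambda>l. vdeg l = 0) w). \<not> starred z"
  proof
    fix z assume z: "z \<in> set (takeWhile (\<lambda>l. vdeg l = 0) w)"
    then obtain x y where xy: "takeWhile (\<lambda>l. vdeg l = 0) w = x @ z # y" by (meson split_list)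
    then have w: "w = x @ z # (y @ dropWhile (\<lambda>l. vdeg l = 0) w)"
      using takeWhile_dropWhile_id[of "\<lambda>l. vdeg l = 0" w] by simp
    have "\<forall>l \<in> set (x @ z # y). vdeg l = 0" unfolding xy[symmetric] by (auto dest: set_takeWhileD)
    then have "nz x = 0" "vdeg z = 0" by (auto simp: nz_0_iff)
    then show "\<not> starred z" using * w unfolding left_unst_def by blast
  qed
next
  assume *: "\<forall>z \<in> set (takeWhile (\<lambda>l. vdeg l = 0) w). \<not> starred z"
  show "left_unst w"
    unfolding left_unst_def
  proof (intro allI impI)
    fix x z y assume "w = x @ z # y" "nz x = 0" "vdeg z = 0"
    then have "z \<in> set (takeWhile (\<lambda>l. vdeg l = 0) w)" by (simp add: nz_0_iff)
    then show "\<not> starred z" using * by blast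
  qed
qed

lemma nz_rev [simp]: "nz (rev w) = nz w"
  by (induction w) simp_all

lemma right_unst_rev: "right_unst w \<longleftrightarrow> left_unst (rev w)"
proof -
  have "rev w = x @ z # y \<longleftrightarrow> w = rev y @ z # rev x" for x z y
    by (metis append.assoc append_Cons append_Nil rev.simps(2) rev_append rev_rev_ident)
  then show ?thesis
    unfolding left_unst_def right_unst_def by (metis nz_rev rev_rev_ident)
qed

lemma reduced_swap:
  assumes "reduced m (x @ l # l' # y)" "vdeg l = 0" "vdeg l' = 0"
  shows "reduced m (x @ l' # l # y)"
proof -
  have *: "left_unst (x @ l' # l # y) \<longleftrightarrow> left_unst (x @ l # l' # y)" if "vdeg l = 0" "vdeg l' = 0" for x l l' y
    using that by (cases "\<forall>z \<in> set x. vdeg z = 0") (auto simp: left_unst_takeWhile takeWhile_tail)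
  have "right_unst (x @ l' # l # y) \<longleftrightarrow> right_unst (x @ l # l' # y)"
    using *[of l' l "rev y" "rev x"] assms(2,3) by (simp add: right_unst_rev)
  moreover have "special m (x @ l' # l # y) \<longleftrightarrow> special m (x @ l # l' # y)"
    by (simp add: special_def ac_simps)
  ultimately show ?thesis using assms * by (auto simp: reduced_def)
qed

text \<open>The two paths of a special word would give two edges of the degree of s, one starting
  and one ending at the center.\<close>

lemma special_no_dim_1:
  assumes "special m (x @ s @ z)" "nz s \<noteq> 0" "dimU TYPE('f::field) m (wdeg s) = 1"
  shows False
proof -
  let ?w = "x @ s @ z"
  obtain f b X a Y where p: "mirror m f = f" "f < b" "a < f" "path False m f ?w b X" "path False m a ?w f Y"
    by (rule special_paths[OF assms(1)])
  have "nz x = 0" "nz z = 0" using assms by (auto simp: special_def)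
  then have *: "wdeg ?w = wdeg s" by (simp add: wdeg_nz_0)
  have "edge m f b (wdeg s)" "edge m a f (wdeg s)"
    using path_edge[OF p(4)] path_edge[OF p(5)] unfolding * by blast+
  from dimU_1_unique[OF assms(3) this] p(3) show False by simp
qed

text \<open>Nonzero degree ranks first because (II) and (III) forbid a letter of degree 0 in front
  of certain segments; then comes the smaller index, as in (I) and (III), and finally the absence of
  a star.\<close>

definition letter_less :: "(zgrp indet \<times> zgrp indet) set" where
  "letter_less = inv_image (less_than <*lex*> less_than <*lex*> less_than)
     (\<lambda>l. (of_bool (vdeg l = 0), vind l, of_bool (starred l)))"

lemma letter_less_iff: "(l', l) \<in> letter_less \<longleftrightarrow>
    vdeg l' \<noteq> 0 \<and> vdeg l = 0 \<or> (vdeg l' = 0 \<longleftrightarrow> vdeg l = 0) \<and>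
      (vind l' < vind l \<or> vind l' = vind l \<and> \<not> starred l' \<and> starred l)"
  by (auto simp: letter_less_def)

lemma lex_letter_lessI: "(l', l) \<in> letter_less \<Longrightarrow> length t' = length t \<Longrightarrow> (x @ l' # t', x @ l # t) \<in> lex letter_less"
  by (induction x) auto

context basis_ideal
begin

text \<open>The whole word and s have the same degree. Reversing the whole and then s alone restores
  s and leaves q behind it with a star.\<close>

lemma eqv_move_zero:
  assumes "inG m (q # s)" "vdeg q = 0" "dimU TYPE('f) m (wdeg s) = 1"
  shows "eqv (q # s) (s @ [indet_star q])"
proof -
  have "eqv (q # s) (wstar s @ [indet_star q])"
    using eqv_sym[OF eqv_wstar[of "q # s"]] assms by simp
  also have "eqv (wstar s @ [indet_star q]) (s @ [indet_star q])"
    using eqv_right[OF eqv_wstar[of s], of "[indet_star q]"] assms by simp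
  finally show ?thesis .
qed

text \<open>A congruent word that is minimal in the lexicographic order is good: a violation of (I)
  to (VI) would allow a relation to produce a smaller one, and (VII) is reducedness.\<close>

lemma exists_good:
  assumes sub: "I \<subseteq> UT_identities m" and w: "reduced m w" "distinct (map vind w)"
      "fmonom w \<notin> (UT_identities m :: (zgrp, 'f) fpoly set)"
  shows "\<exists>w'. eqv w w' \<and> mset (map vind w') = mset (map vind w) \<and> inG m w' \<and> good_mono TYPE('f) m w' \<and>
    (m = 1 \<longrightarrow> unstarred w')"
proof -
  \<comment> \<open>Reducedness is built in because (VII) rests on (d), which relates four words and
    does not rewrite one word into another.\<close>
  define S where "S = {w'. eqv w w' \<and> mset (map vind w') = mset (map vind w) \<and> reduced m w'}"
  have "wf (lex letter_less)" unfolding letter_less_def by (intro wf_lex wf_inv_image wf_lex_prod wf_less_than)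
  moreover have "w \<in> S" using w by (simp add: S_def)
  ultimately obtain w0 where w0: "w0 \<in> S" "\<And>w'. (w', w0) \<in> lex letter_less \<Longrightarrow> w' \<notin> S"
    by (meson wfE_min)
  have e: "eqv w w0" and ms: "mset (map vind w0) = mset (map vind w)" and red: "reduced m w0"
    using w0(1) by (auto simp: S_def)
  have G: "inG m w0" using red by (simp add: reduced_def)
  have dist: "distinct (map vind w0)" using mset_eq_imp_distinct_iff[OF ms] w(2) by simp
  have nonid: "fmonom w0 \<notin> (UT_identities m :: (zgrp, 'f) fpoly set)"
  proof
    assume "fmonom w0 \<in> (UT_identities m :: (zgrp, 'f) fpoly set)"
    then have "(fmonom w - fmonom w0) + fmonom w0 \<in> (UT_identities m :: (zgrp, 'f) fpoly set)"
      using e sub by (intro UT_add) (auto simp: eqv_def)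
    then show False using w(3) by simp
  qed
  then obtain a b X where p: "path False m a w0 b X" using nopath_UT[OF G] by metis
  have no: False if "w0 = x @ l # t" "eqv (x @ l # t) (x @ l' # t')" "(l', l) \<in> letter_less"
    "mset (map vind (l' # t')) = mset (map vind (l # t))" "reduced m (x @ l' # t')" for x l t l' t'
  proof -
    have "length t' = length t" using arg_cong[OF that(4), of size] by simp
    then have "(x @ l' # t', w0) \<in> lex letter_less" using lex_letter_lessI that(1,3) by blast
    then have "x @ l' # t' \<notin> S" by (rule w0(2))
    moreover have "eqv w (x @ l' # t')" using eqv_trans[OF e] that(1,2) by simp
    moreover have "mset (map vind (x @ l' # t')) = mset (map vind w)" using ms that(1,4) by simp
    ultimately show False using that(5) by (simp add: S_def)
  qed
  \<comment> \<open>Only special words carry a condition on stars, and being special depends on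
    \<open>nz\<close> and \<open>wdeg\<close> alone.\<close>
  have red': "reduced m w'" if "inG m w'" "nz w' = nz w0" "wdeg w' = wdeg w0" "\<not> special m w0" for w'
    using that by (auto simp: reduced_def special_def)
  have toggled: "\<not> starred z"
    if "w0 = x @ z # t" "vdeg z = 0" "eqv (x @ z # t) (x @ indet_star z # t)" "\<not> special m w0" for x z t
  proof
    assume "starred z"
    then show False
      using no[OF that(1,3)] that red'[of "x @ indet_star z # t"] G by (auto simp: letter_less_iff)
  qed
  have zeros: "vind l < vind l'" if "w0 = x @ l # l' # z" "vdeg l = 0" "vdeg l' = 0" for x l l' z
  proof (rule ccontr)
    assume "\<not> vind l < vind l'"
    then have "vind l' < vind l" using dist that(1) by auto
    moreover have "eqv (x @ l # l' # z) (x @ l' # l # z)"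
      using eqv_context[OF eqv_comm[of "[l]" "[l']"], of x z] that G by simp
    ultimately show False
      using no[OF that(1), of l' "l # z"] that reduced_swap[of m x l l' z] red by (auto simp: letter_less_iff)
  qed
  \<comment> \<open>Serves (II) and (III) alike: a letter of degree 0 moves behind the segment,
    whose first letter of nonzero degree takes its place and makes the word smaller.\<close>
  have last_zero: False
    if w0: "w0 = x @ s @ z" and x: "x \<noteq> []" "vdeg (last x) = 0" and s: "nz s \<noteq> 0" "vdeg (hd s) \<noteq> 0"
      "dimU TYPE('f) m (wdeg s) = 1" for x s z
  proof -
    obtain x' q where x': "x = x' @ [q]" using x(1) by (metis rev_exhaust)
    obtain l s' where s': "s = l # s'" using s(1) by (cases s) auto
    have q: "vdeg q = 0" using x x' by simp
    have "eqv (x' @ (q # s) @ z) (x' @ (s @ [indet_star q]) @ z)"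
      using G w0 x' q by (intro eqv_context eqv_move_zero s) auto
    then have "eqv (x' @ q # s @ z) (x' @ l # s' @ indet_star q # z)" using s' by simp
    moreover have "\<not> special m w0" using special_no_dim_1[OF _ s(1,3)] w0 by blast
    ultimately show False
      using no[of x' q "s @ z" l "s' @ indet_star q # z"] w0 x' s' q s(2) G
        red'[of "x' @ l # s' @ indet_star q # z"] by (auto simp: letter_less_iff ac_simps)
  qed
  have "good_order TYPE('f) m w0"
    unfolding good_order_def
  proof (intro conjI allI impI; elim conjE)
    fix x l l' z assume "w0 = x @ l # l' # z" "vdeg l = 0" "vdeg l' = 0"
    then show "vind l < vind l'" by (rule zeros)
  next
    fix x l z assume *: "w0 = x @ l # z" "vdeg l \<noteq> 0" "dimU TYPE('f) m (vdeg l) = 1"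
    show "x = [] \<or> vdeg (last x) \<noteq> 0"
      using last_zero[of x "[l]" z] * by auto
    have "\<not> special m w0" using special_no_dim_1[of m x "[l]" z, where ?'f = 'f] * by auto
    moreover have "eqv (x @ l # z) (x @ indet_star l # z)"
      using eqv_context[OF eqv_sym[OF eqv_wstar[of "[l]"]], of x z] * G by simp
    ultimately show "\<not> starred l"
      using no[OF *(1), of "indet_star l" z] * red'[of "x @ indet_star l # z"] G by (auto simp: letter_less_iff)
  next
    fix x l s l' z assume *: "w0 = x @ l # s @ l' # z" "vdeg l \<noteq> 0" "vdeg l' \<noteq> 0"
      "dimU TYPE('f) m (wdeg (l # s @ [l'])) = 1"
    show "x = [] \<or> vdeg (last x) \<noteq> 0"
      using last_zero[of x "l # s @ [l']" z] * by auto
    have nsp: "\<not> special m w0" using special_no_dim_1[of m x "l # s @ [l']" z, where ?'f = 'f] * by auto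
    show "vind l < vind l'"
    proof (rule ccontr)
      assume "\<not> vind l < vind l'"
      then have "vind l' < vind l" using dist *(1) by auto
      moreover have "eqv (x @ (l # s @ [l']) @ z) (x @ wstar (l # s @ [l']) @ z)"
        using * G by (intro eqv_context eqv_sym[OF eqv_wstar]) auto
      then have "eqv (x @ l # s @ l' # z) (x @ indet_star l' # wstar s @ indet_star l # z)" by simp
      moreover have "mset (map vind (wstar s)) = mset (map vind s)"
        by (induction s) simp_all
      ultimately show False
        using no[OF *(1), of "indet_star l'" "wstar s @ indet_star l # z"] * G nsp
          red'[of "x @ indet_star l' # wstar s @ indet_star l # z"]
        by (auto simp: letter_less_iff ac_simps)
    qed
  qed
  moreover have "good_center m w0"
    unfolding good_center_def
  proof (intro conjI allI impI; elim conjE)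
    fix x l s l' z assume *: "odd m" "w0 = x @ l # s @ l' # z" "nz s = 0" "vdeg l \<in> basis_elts m" "vdeg l' \<in> basis_elts m"
    have nsp: "\<not> special m w0" using *(2,4,5) basis_elts_nonzero by (auto simp: special_def)
    show "unstarred s"
      unfolding unstarred_def
    proof
      fix q assume "q \<in> set s"
      then obtain s1 s2 where s: "s = s1 @ q # s2" by (meson split_list)
      then have z: "nz s1 = 0" "nz s2 = 0" "vdeg q = 0" using *(3) by (auto split: if_splits)
      have "eqv ((l # s1) @ [q] @ (s2 @ [l'])) ((l # s1) @ wstar [q] @ (s2 @ [l']))"
        by (rule eqv_inner) (use * s z G in \<open>auto simp: wdeg_nz_0\<close>)
      from eqv_context[OF this, of x z] have "eqv ((x @ l # s1) @ q # s2 @ l' # z) ((x @ l # s1) @ indet_star q # s2 @ l' # z)"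
        using * G by simp
      then show "\<not> starred q" using toggled[of "x @ l # s1" q "s2 @ l' # z"] * s z nsp by simp
    qed
  next
    fix s l z l' z' assume *: "odd m" "w0 = s @ l # z @ l' # z'" "nz s = 0" "nz z = 0" "vdeg l \<in> basis_elts m"
      "vdeg l' \<noteq> 0" "vdeg l' \<notin> basis_elts m"
    have l: "vdeg l \<noteq> 0" using *(5) basis_elts_nonzero by blast
    then have nsp: "\<not> special m w0" using * by (auto simp: special_def)
    obtain R T where "path False m a s a R" "path False m a (l # z @ l' # z') b T"
      using p path_zero[OF *(3)] unfolding *(2) path_append[of _ _ _ s] by metis
    then obtain d D where d: "edge m a d (vdeg l)" "path False m d (z @ l' # z') b D" by (auto elim: path_ConsE)
    then obtain D' where "path False m d (l' # z') b D'"
      using path_zero[OF *(4)] unfolding path_append[of _ _ _ z] by metis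
    then obtain c where c: "edge m d c (vdeg l')" by (rule path_ConsE)
    \<comment> \<open>The edge of degree e_i touches the center. If it ended there, the next edge
      would start there and have a degree in the basis.\<close>
    have "a = m div 2"
      using basis_elt_edge[OF *(1) d(1)] basis_elt_edge[OF *(1) c] edge_less_iff[OF c] *(5-7) by auto
    then have f: "mirror m a = a" using *(1) path_less[OF p] mirror_center_iff by blast
    show "unstarred s"
      unfolding unstarred_def
    proof
      fix q assume "q \<in> set s"
      then obtain s1 s2 where s: "s = s1 @ q # s2" by (meson split_list)
      then have z: "nz s1 = 0" "nz s2 = 0" "vdeg q = 0" using *(3) by (auto split: if_splits)
      have w0: "w0 = s1 @ q # (s2 @ l # z @ l' # z')" using *(2) s by simp
      obtain R T where 1: "path False m a s1 a R" "path False m a (q # (s2 @ l # z @ l' # z')) b T"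
        using p path_zero[OF z(1)] unfolding w0 path_append[of _ _ _ s1] by metis
      then obtain T' where "path False m a (s2 @ l # z @ l' # z') b T'"
        using z(3) by (auto simp: edge_zero)
      from toggle[OF 1(1) this f z(3)] have "eqv (s1 @ q # (s2 @ l # z @ l' # z')) (s1 @ indet_star q # (s2 @ l # z @ l' # z'))"
        using l *(6) by simp
      then show "\<not> starred q" using toggled[OF w0 z(3)] nsp by simp
    qed
  next
    fix z' l' z l s assume *: "odd m" "w0 = z' @ l' # z @ l # s" "nz s = 0" "nz z = 0" "vdeg l \<in> basis_elts m"
      "vdeg l' \<noteq> 0" "vdeg l' \<notin> basis_elts m"
    have l: "vdeg l \<noteq> 0" using *(5) basis_elts_nonzero by blast
    then have nsp: "\<not> special m w0" using * by (auto simp: special_def)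
    obtain c R T where 1: "path False m a z' c R" "path False m c (l' # z @ l # s) b T"
      using p unfolding *(2) path_append[of _ _ _ z'] by metis
    then obtain d D where d: "edge m c d (vdeg l')" "path False m d (z @ l # s) b D" by (auto elim: path_ConsE)
    then obtain D' where "path False m d (l # s) b D'"
      using path_zero[OF *(4)] unfolding path_append[of _ _ _ z] by metis
    then obtain b' D'' where "edge m d b' (vdeg l)" "path False m b' s b D''" by (rule path_ConsE)
    then have b: "edge m d b (vdeg l)" using path_zero[OF *(3)] by blast
    have "b = m div 2"
      using basis_elt_edge[OF *(1) d(1)] basis_elt_edge[OF *(1) b] edge_less_iff[OF d(1)] *(5-7) by auto
    then have f: "mirror m b = b" using *(1) path_less[OF p] mirror_center_iff by blast
    show "unstarred s"
      unfolding unstarred_def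
    proof
      fix q assume "q \<in> set s"
      then obtain s1 s2 where s: "s = s1 @ q # s2" by (meson split_list)
      then have z: "nz s1 = 0" "nz s2 = 0" "vdeg q = 0" using *(3) by (auto split: if_splits)
      let ?x = "z' @ l' # z @ l # s1"
      have w0: "w0 = ?x @ q # s2" using *(2) s by simp
      obtain c R T where 1: "path False m a ?x c R" "path False m c (q # s2) b T"
        using p unfolding w0 path_append[of _ _ _ ?x] by metis
      then obtain T' where 2: "path False m c s2 b T'" using z(3) by (auto simp: edge_zero)
      then have "c = b" using path_zero[OF z(2)] by blast
      then have "eqv (?x @ q # s2) (?x @ indet_star q # s2)"
        using toggle[of a ?x b R s2 b T' q] 1 2 f z(3) l *(6) by simp
      then show "\<not> starred q" using toggled[OF w0 z(3)] nsp by simp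
    qed
  next
    fix s l s' assume *: "odd m" "w0 = s @ l # s'" "nz s = 0" "nz s' = 0" "vdeg l \<in> basis_elts m"
    then have "special m w0" using basis_elts_nonzero by (auto simp: special_def wdeg_nz_0)
    then consider "left_unst w0" | "right_unst w0" using red by (auto simp: reduced_def)
    then show "unstarred s \<or> unstarred s'"
    proof cases
      case 1
      have "\<not> starred q" if q: "q \<in> set s" for q
      proof -
        obtain s1 s2 where s: "s = s1 @ q # s2" using q by (meson split_list)
        then have "nz s1 = 0" "vdeg q = 0" using *(3) by (auto split: if_splits)
        moreover have "w0 = s1 @ q # (s2 @ l # s')" using *(2) s by simp
        ultimately show ?thesis using 1 unfolding left_unst_def by blast
      qed
      then show ?thesis by (simp add: unstarred_def)
    next
      case 2
      have "\<not> starred q" if q: "q \<in> set s'" for q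
      proof -
        obtain s1 s2 where s: "s' = s1 @ q # s2" using q by (meson split_list)
        then have "nz s2 = 0" "vdeg q = 0" using *(4) by (auto split: if_splits)
        moreover have "w0 = (s @ l # s1) @ q # s2" using *(2) s by simp
        ultimately show ?thesis using 2 unfolding right_unst_def by blast
      qed
      then show ?thesis by (simp add: unstarred_def)
    qed
  qed
  \<comment> \<open>For m = 1 the group is trivial and the only index is the center, so every star
    can be removed.\<close>
  moreover have "unstarred w0" if "m = 1"
    unfolding unstarred_def
  proof
    fix q assume "q \<in> set w0"
    then obtain x y where w0: "w0 = x @ q # y" by (meson split_list)
    have Z: "vdeg l = 0" if "l \<in> set w0" for l
      using G that \<open>m = 1\<close> by (auto simp: inG_def Zr_def)
    then have z: "nz x = 0" "nz y = 0" "vdeg q = 0" using w0 by (auto simp: nz_0_iff)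
    have nsp: "\<not> special m w0" using z w0 by (simp add: special_def)
    obtain c R T where 1: "path False m a x c R" "path False m c (q # y) b T"
      using p unfolding w0 path_append by metis
    then obtain T' where 2: "path False m c y b T'" using z(3) by (auto simp: edge_zero)
    have "mirror m c = c" using path_less[OF 1(1)] \<open>m = 1\<close> by (simp add: mirror_def)
    then have "eqv (x @ q # y) (x @ indet_star q # y)"
      using toggle[OF 1(1) 2 _ z(3)] \<open>m = 1\<close> by simp
    then show "\<not> starred q" using toggled[OF w0 z(3)] nsp by simp
  qed
  ultimately show ?thesis using e ms G good_monoI[OF nonid] by blast
qed

lemma sum_in_I: "(\<And>i. i \<in> S \<Longrightarrow> f i \<in> I) \<Longrightarrow> sum f S \<in> I"
  by (induction S rule: infinite_finite_induct) (auto simp: I_zero I_add)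

lemma single_fmonom: "Poly_Mapping.single v c = Poly_Mapping.single 0 c * fmonom (letters v)"
  by (simp add: fmonom_def mult_single)

lemma keys_smult: "Poly_Mapping.keys (Poly_Mapping.single 0 c * q) \<subseteq> Poly_Mapping.keys q"
  using keys_mult[of "Poly_Mapping.single 0 c" q] by (auto split: if_splits)

lemma reduce_poly:
  assumes "p \<in> carrier (free_alg (Zr m))"
  shows "\<exists>q. p - q \<in> I \<and> Poly_Mapping.keys q \<subseteq> FMon ` {w. reduced m w}"
proof -
  have "\<forall>w \<in> Poly_Mapping.keys p. \<exists>q. fmonom (letters w) - q \<in> I \<and>
      Poly_Mapping.keys q \<subseteq> FMon ` {w. reduced m w}"
  proof
    fix w assume "w \<in> Poly_Mapping.keys p"
    then have "inG m (letters w)" using assms by (auto simp: carrier_free_alg_iff)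
    from reduce_word[OF this] obtain q where q: "fmonom (letters w) - q \<in> I"
      "\<And>w'. w' \<in> Poly_Mapping.keys q \<Longrightarrow> reduced m (letters w')" by blast
    have "w' \<in> FMon ` {w. reduced m w}" if "w' \<in> Poly_Mapping.keys q" for w'
      using q(2)[OF that] by (metis fmon.collapse imageI mem_Collect_eq)
    with q(1) show "\<exists>q. fmonom (letters w) - q \<in> I \<and> Poly_Mapping.keys q \<subseteq> FMon ` {w. reduced m w}" by blast
  qed
  then obtain Q where Q: "\<And>w. w \<in> Poly_Mapping.keys p \<Longrightarrow> fmonom (letters w) - Q w \<in> I"
    "\<And>w. w \<in> Poly_Mapping.keys p \<Longrightarrow> Poly_Mapping.keys (Q w) \<subseteq> FMon ` {w. reduced m w}" by metis
  let ?q = "\<Sum>w \<in> Poly_Mapping.keys p. Poly_Mapping.single 0 (Poly_Mapping.lookup p w) * Q w"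
  have "p = (\<Sum>w \<in> Poly_Mapping.keys p. Poly_Mapping.single w (Poly_Mapping.lookup p w))"
    by (simp only: sum_single_lookup)
  also have "\<dots> = (\<Sum>w \<in> Poly_Mapping.keys p. Poly_Mapping.single 0 (Poly_Mapping.lookup p w) * fmonom (letters w))"
    by (intro sum.cong refl single_fmonom)
  finally have "p - ?q = (\<Sum>w \<in> Poly_Mapping.keys p.
      Poly_Mapping.single 0 (Poly_Mapping.lookup p w) * (fmonom (letters w) - Q w))"
    by (simp add: right_diff_distrib sum_subtractf)
  also have "\<dots> \<in> I" by (intro sum_in_I I_smult Q)
  finally have "p - ?q \<in> I" .
  moreover have "Poly_Mapping.keys ?q \<subseteq> FMon ` {w. reduced m w}"
    using Q(2) keys_smult by (intro order_trans[OF Poly_Mapping.keys_sum] UN_least) blast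
  ultimately show ?thesis by blast
qed

end

text \<open>Since \<open>I\<close> consists of identities, reducing an identity modulo
  \<open>I\<close> leaves an identity, now supported on reduced words, to which the elimination
  applies.\<close>

lemma UT_subset_basis_ideal:
  fixes I :: "(zgrp, 'f::field_char_0) fpoly set"
  assumes "basis_ideal m I" and sub: "I \<subseteq> UT_identities m"
  shows "UT_identities m \<subseteq> I"
proof
  interpret basis_ideal m I by fact
  fix p :: "(zgrp, 'f) fpoly" assume p: "p \<in> UT_identities m"
  obtain q where q: "p - q \<in> I" "Poly_Mapping.keys q \<subseteq> FMon ` {w. reduced m w}"
    using reduce_poly[OF UT_carrier[OF p]] by blast
  have "p + - (p - q) \<in> UT_identities m" using q(1) sub by (intro UT_add p UT_minus) auto
  then have qT: "q \<in> UT_identities m" by simp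
  have "q \<in> I"
  proof (rule eliminate_reduced[OF m_pos I_zero I_add I_smult sub _ _ _ qT q(2)])
    fix w assume "w \<in> {w. reduced m w}" "\<nexists>a b X. path False m a w b X"
    then show "fmonom w \<in> I" by (intro nopath_I) (auto simp: reduced_def)
  next
    fix v w a b X
    assume *: "path False m a v b X" "path False m a w b X"
      "noncentral m a b v \<or> path True m a v b X \<and> path True m a w b X"
    then have "eqv v w"
      using eqv_path_toggle[OF *(1,2)] eqv_path unfolding noncentral_def by blast
    then show "fmonom v - fmonom w \<in> I" by (simp add: eqv_def)
  qed auto
  then have "(p - q) + q \<in> I" by (rule I_add[OF q(1)])
  then show "p \<in> I" by simp
qed


section \<open>Bases of quotient spaces\<close>

lemma mod_hom_quot:
  assumes V: "vectorspace K V" and W: "submodule K W V"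
  shows "mod_hom K V (quot_space V W) (\<lambda>x. W +>\<^bsub>V\<^esub> x)"
    and "\<And>x. x \<in> carrier V \<Longrightarrow> W +>\<^bsub>V\<^esub> x = \<zero>\<^bsub>quot_space V W\<^esub> \<longleftrightarrow> x \<in> W"
    and "\<And>x y. x \<in> carrier V \<Longrightarrow> y \<in> carrier V \<Longrightarrow> x \<ominus>\<^bsub>V\<^esub> y \<in> W \<Longrightarrow> W +>\<^bsub>V\<^esub> x = W +>\<^bsub>V\<^esub> y"
    and "\<And>x y. x \<in> carrier V \<Longrightarrow> y \<in> carrier V \<Longrightarrow> W +>\<^bsub>V\<^esub> x = W +>\<^bsub>V\<^esub> y \<Longrightarrow> x \<ominus>\<^bsub>V\<^esub> y \<in> W"
proof -
  interpret V: vectorspace K V by fact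
  interpret W: submodule K W V by fact
  interpret Q: vectorspace K "quot_space V W" by (rule vectorspace_quot[OF V W])
  let ?\<pi> = "\<lambda>x. W +>\<^bsub>V\<^esub> x"
  have neg: "\<ominus>\<^bsub>V\<^esub> w \<in> W" if "w \<in> W" for w
  proof -
    have "\<ominus>\<^bsub>V\<^esub> w = (\<ominus>\<^bsub>K\<^esub> \<one>\<^bsub>K\<^esub>) \<odot>\<^bsub>V\<^esub> w"
      using that W.subset V.smult_minus_1 by auto
    then show ?thesis using that by simp
  qed
  have "subgroup W (add_monoid V)"
    by (rule subgroup.intro) (use W.subset neg in \<open>auto simp: a_inv_def\<close>)
  then have "additive_subgroup W V" by (rule additive_subgroupI)
  then interpret A: abelian_subgroup W V
    by (intro abelian_subgroupI3 V.abelian_group_axioms)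
  have self: "x \<in> ?\<pi> x" if "x \<in> carrier V" for x
    using that by (auto simp: a_r_coset_def' intro!: bexI[of _ "\<zero>\<^bsub>V\<^esub>"])
  have cl: "?\<pi> x \<in> carrier (quot_space V W)" if "x \<in> carrier V" for x
    using that by (auto simp: quot_space_def A_RCOSETS_def')
  have eqI: "?\<pi> x = ?\<pi> y" if xy: "x \<in> carrier V" "y \<in> carrier V" "x \<ominus>\<^bsub>V\<^esub> y \<in> W" for x y
  proof -
    have "x = (x \<ominus>\<^bsub>V\<^esub> y) \<oplus>\<^bsub>V\<^esub> y" using xy by (simp add: a_minus_def V.a_assoc V.l_neg)
    then have "x \<in> ?\<pi> y" using xy(3) by (auto simp: a_r_coset_def')
    then show ?thesis using V.a_repr_independence[OF _ xy(2) A.a_subgroup] by simp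
  qed
  then show "\<And>x y. x \<in> carrier V \<Longrightarrow> y \<in> carrier V \<Longrightarrow> x \<ominus>\<^bsub>V\<^esub> y \<in> W \<Longrightarrow> W +>\<^bsub>V\<^esub> x = W +>\<^bsub>V\<^esub> y" .
  have eqD: "x \<ominus>\<^bsub>V\<^esub> y \<in> W" if xy: "x \<in> carrier V" "y \<in> carrier V" "?\<pi> x = ?\<pi> y" for x y
  proof -
    have "x \<in> ?\<pi> y" using self[OF xy(1)] xy(3) by simp
    then obtain w where w: "w \<in> W" "x = w \<oplus>\<^bsub>V\<^esub> y" by (auto simp: a_r_coset_def')
    then have "w \<in> carrier V" using W.subset by auto
    then have "x \<ominus>\<^bsub>V\<^esub> y = w" using w xy by (simp add: a_minus_def V.a_assoc V.r_neg)
    then show ?thesis using w by simp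
  qed
  then show "\<And>x y. x \<in> carrier V \<Longrightarrow> y \<in> carrier V \<Longrightarrow> W +>\<^bsub>V\<^esub> x = W +>\<^bsub>V\<^esub> y \<Longrightarrow> x \<ominus>\<^bsub>V\<^esub> y \<in> W" .
  have zero: "\<zero>\<^bsub>quot_space V W\<^esub> = ?\<pi> \<zero>\<^bsub>V\<^esub>"
    using W.subset by (auto simp: quot_space_def a_r_coset_def')
  show "W +>\<^bsub>V\<^esub> x = \<zero>\<^bsub>quot_space V W\<^esub> \<longleftrightarrow> x \<in> W" if x: "x \<in> carrier V" for x
  proof -
    have "\<ominus>\<^bsub>V\<^esub> \<zero>\<^bsub>V\<^esub> = \<zero>\<^bsub>V\<^esub>" by (rule V.minus_equality) simp_all
    then have "x \<ominus>\<^bsub>V\<^esub> \<zero>\<^bsub>V\<^esub> = x" using x by (simp add: a_minus_def)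
    then show ?thesis using eqI[OF x V.zero_closed] eqD[OF x V.zero_closed] by (auto simp: zero)
  qed
  have add: "?\<pi> (x \<oplus>\<^bsub>V\<^esub> y) = ?\<pi> x \<oplus>\<^bsub>quot_space V W\<^esub> ?\<pi> y" if "x \<in> carrier V" "y \<in> carrier V" for x y
    using that by (simp add: quot_space_def A.a_rcos_sum)
  have smult: "?\<pi> (c \<odot>\<^bsub>V\<^esub> x) = c \<odot>\<^bsub>quot_space V W\<^esub> ?\<pi> x" if c: "c \<in> carrier K" and x: "x \<in> carrier V" for c x
  proof -
    have "?\<pi> (c \<odot>\<^bsub>V\<^esub> y) = ?\<pi> (c \<odot>\<^bsub>V\<^esub> x)" if y: "y \<in> ?\<pi> x" for y
    proof (rule eqI)
      obtain w where w: "w \<in> W" "y = w \<oplus>\<^bsub>V\<^esub> x" using y by (auto simp: a_r_coset_def')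
      then have wV: "w \<in> carrier V" using W.subset by auto
      then show "c \<odot>\<^bsub>V\<^esub> y \<in> carrier V" "c \<odot>\<^bsub>V\<^esub> x \<in> carrier V" using w c x by simp_all
      have "c \<odot>\<^bsub>V\<^esub> y \<ominus>\<^bsub>V\<^esub> c \<odot>\<^bsub>V\<^esub> x = c \<odot>\<^bsub>V\<^esub> w"
        using w wV c x by (simp add: V.smult_r_distr a_minus_def V.a_assoc V.r_neg)
      then show "c \<odot>\<^bsub>V\<^esub> y \<ominus>\<^bsub>V\<^esub> c \<odot>\<^bsub>V\<^esub> x \<in> W" using w c by simp
    qed
    moreover have "c \<odot>\<^bsub>quot_space V W\<^esub> ?\<pi> x = (\<Union>y \<in> ?\<pi> x. ?\<pi> (c \<odot>\<^bsub>V\<^esub> y))"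
      by (simp add: quot_space_def)
    ultimately show ?thesis using self[OF x] by blast
  qed
  show "mod_hom K V (quot_space V W) ?\<pi>"
    by (intro mod_hom.intro mod_hom_axioms.intro V.module_axioms Q.module_axioms)
      (auto simp: LinearCombinations.module_hom_def cl add smult)
qed

text \<open>Spanning and independence are tested in V modulo W; injectivity on B lets coefficients
  on the cosets be read as coefficients on B.\<close>

lemma quot_basis:
  assumes V: "vectorspace K V" and W: "submodule K W V" and B: "B \<subseteq> carrier V"
    and inj: "inj_on (\<lambda>x. W +>\<^bsub>V\<^esub> x) B"
    and span: "\<And>v. v \<in> carrier V \<Longrightarrow> \<exists>a S. finite S \<and> S \<subseteq> B \<and> a \<in> S \<rightarrow> carrier K \<and>
      v \<ominus>\<^bsub>V\<^esub> module.lincomb V a S \<in> W"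
    and indep: "\<And>a S s. finite S \<Longrightarrow> S \<subseteq> B \<Longrightarrow> a \<in> S \<rightarrow> carrier K \<Longrightarrow> module.lincomb V a S \<in> W \<Longrightarrow>
      s \<in> S \<Longrightarrow> a s = \<zero>\<^bsub>K\<^esub>"
  shows "vectorspace.basis K (quot_space V W) ((\<lambda>x. W +>\<^bsub>V\<^esub> x) ` B)"
proof -
  interpret V: vectorspace K V by fact
  interpret Q: vectorspace K "quot_space V W" by (rule vectorspace_quot[OF V W])
  let ?\<pi> = "\<lambda>x. W +>\<^bsub>V\<^esub> x"
  interpret h: mod_hom K V "quot_space V W" ?\<pi> by (rule mod_hom_quot[OF V W])
  have lin: "Q.lincomb a (?\<pi> ` S) = ?\<pi> (V.lincomb (\<lambda>s. a (?\<pi> s)) S)"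
    if S: "finite S" "S \<subseteq> B" "\<And>s. s \<in> S \<Longrightarrow> a (?\<pi> s) \<in> carrier K" for a S
  proof -
    have SV: "S \<subseteq> carrier V" using S B by auto
    have "Q.lincomb a (?\<pi> ` S) = (\<Oplus>\<^bsub>quot_space V W\<^esub>s \<in> S. a (?\<pi> s) \<odot>\<^bsub>quot_space V W\<^esub> ?\<pi> s)"
      unfolding Q.lincomb_def
    proof (rule Q.finsum_reindex)
      show "(\<lambda>v. a v \<odot>\<^bsub>quot_space V W\<^esub> v) \<in> ?\<pi> ` S \<rightarrow> carrier (quot_space V W)"
        using S SV h.f_im by (auto intro!: Q.smult_closed)
      show "inj_on ?\<pi> S" using inj S(2) inj_on_subset by blast
    qed
    also have "\<dots> = (\<Oplus>\<^bsub>quot_space V W\<^esub>s \<in> S. ?\<pi> (a (?\<pi> s) \<odot>\<^bsub>V\<^esub> s))"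
      using S SV h.f_im h.f_smult by (intro Q.finsum_cong') (auto intro!: Q.smult_closed)
    also have "\<dots> = ?\<pi> (V.lincomb (\<lambda>s. a (?\<pi> s)) S)"
      unfolding V.lincomb_def using S SV by (intro h.hom_sum[symmetric]) auto
    finally show ?thesis .
  qed
  show ?thesis
    unfolding Q.basis_def
  proof (intro conjI notI)
    assume "Q.lin_dep (?\<pi> ` B)"
    then obtain A a v where A: "finite A" "A \<subseteq> ?\<pi> ` B" "a \<in> A \<rightarrow> carrier K"
      "Q.lincomb a A = \<zero>\<^bsub>quot_space V W\<^esub>" "v \<in> A" "a v \<noteq> \<zero>\<^bsub>K\<^esub>"
      by (auto simp: Q.lin_dep_def)
    obtain S where S: "S \<subseteq> B" "A = ?\<pi> ` S" using A(2) by (meson subset_imageE)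
    have fin: "finite S" using A(1) S inj inj_on_subset finite_image_iff by metis
    have a: "(\<lambda>s. a (?\<pi> s)) \<in> S \<rightarrow> carrier K" using A(3) S by auto
    have "?\<pi> (V.lincomb (\<lambda>s. a (?\<pi> s)) S) = \<zero>\<^bsub>quot_space V W\<^esub>"
      using lin[OF fin S(1), of a] A(3,4) S by auto
    moreover have "V.lincomb (\<lambda>s. a (?\<pi> s)) S \<in> carrier V"
      using S(1) B a by (intro V.lincomb_closed) auto
    ultimately have "V.lincomb (\<lambda>s. a (?\<pi> s)) S \<in> W" using mod_hom_quot(2)[OF V W] by blast
    from indep[OF fin S(1) a this] A(5,6) S(2) show False by auto
  next
    show sub: "?\<pi> ` B \<subseteq> carrier (quot_space V W)" using B h.f_im by auto
    show "Q.span (?\<pi> ` B) = carrier (quot_space V W)"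
    proof
      show "Q.span (?\<pi> ` B) \<subseteq> carrier (quot_space V W)" by (rule Q.span_is_subset2[OF sub])
      show "carrier (quot_space V W) \<subseteq> Q.span (?\<pi> ` B)"
      proof
        fix X assume "X \<in> carrier (quot_space V W)"
        then obtain v where v: "v \<in> carrier V" "X = ?\<pi> v" by (auto simp: quot_space_def A_RCOSETS_def')
        obtain a S where S: "finite S" "S \<subseteq> B" "a \<in> S \<rightarrow> carrier K" "v \<ominus>\<^bsub>V\<^esub> V.lincomb a S \<in> W"
          using span[OF v(1)] by blast
        \<comment> \<open>Well defined on the cosets of S because the quotient map is injective on
          B.\<close>
        define a' where "a' X = a (inv_into S ?\<pi> X)" for X
        have a': "a' (?\<pi> s) = a s" if "s \<in> S" for s
          unfolding a'_def using inj S(2) that by (metis inj_on_subset inv_into_f_f)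
        have "V.lincomb a S \<in> carrier V" using S B by (intro V.lincomb_closed) auto
        then have "X = ?\<pi> (V.lincomb a S)" using mod_hom_quot(3)[OF V W v(1) _ S(4)] v(2) by simp
        also have "V.lincomb a S = V.lincomb (\<lambda>s. a' (?\<pi> s)) S"
          unfolding V.lincomb_def using a' S B by (intro V.finsum_cong') (auto intro!: V.smult_closed)
        also have "?\<pi> \<dots> = Q.lincomb a' (?\<pi> ` S)"
          by (rule lin[symmetric]) (use S a' in auto)
        finally have X: "X = Q.lincomb a' (?\<pi> ` S)" .
        show "X \<in> Q.span (?\<pi> ` B)"
          unfolding Q.span_def
        proof (intro CollectI exI conjI)
          show "X = Q.lincomb a' (?\<pi> ` S)" by (rule X)
        qed (use S a' in auto)
      qed
    qed
  qed
qed

lemma finsum_plus: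
  assumes "abelian_monoid R" "add R = (+)" "zero R = 0" "f \<in> S \<rightarrow> carrier R" "finite S"
  shows "finsum R f S = sum f S"
  using assms(5,4)
proof (induction S)
  case empty
  interpret abelian_monoid R by fact
  show ?case using assms by (simp add: finsum_empty)
next
  case (insert s S)
  interpret abelian_monoid R by fact
  show ?case using insert assms(2) by (simp add: finsum_insert)
qed

text \<open>A description without a chosen permutation, visibly stable under reordering letters and
  changing stars.\<close>

lemma multilinear_monos_iff:
  "w \<in> multilinear_monos (Zr m) n \<longleftrightarrow> inG m w \<and> mset (map vind w) = mset [1..<Suc n]"
proof
  assume "w \<in> multilinear_monos (Zr m) n"
  then obtain \<sigma> g \<delta> where w: "w = map (\<lambda>i. Indet (\<sigma> i) (g i) (\<delta> i)) [1..<Suc n]"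
    "\<sigma> permutes {1..n}" "\<forall>i \<in> {1..n}. g i \<in> Zr m" by (auto simp: multilinear_monos_def)
  have s: "{1..<Suc n} = {1..n}" by auto
  have "mset (map vind w) = image_mset \<sigma> (mset [1..<Suc n])"
    unfolding w(1) by (simp add: multiset.map_comp o_def del: upt_Suc)
  also have "\<dots> = image_mset \<sigma> (mset_set {1..n})" by (simp only: mset_upt s)
  also have "\<dots> = mset_set {1..n}"
    using image_mset_mset_set[OF permutes_inj_on[OF w(2)]] permutes_image[OF w(2)] by simp
  finally have "mset (map vind w) = mset [1..<Suc n]" by (simp only: mset_upt s)
  moreover have "inG m w" using w by (auto simp: inG_def simp del: upt_Suc)
  ultimately show "inG m w \<and> mset (map vind w) = mset [1..<Suc n]" by blast
next
  assume *: "inG m w \<and> mset (map vind w) = mset [1..<Suc n]"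
  have len: "length w = n"
    using arg_cong[OF conjunct2[OF *], of size] by simp
  have "set (map vind w) = set [1..<Suc n]" using * mset_eq_setD by blast
  then have set: "vind ` set w = {1..n}" by (auto simp del: upt_Suc)
  have "distinct (map vind w)" using * mset_eq_imp_distinct_iff[of "map vind w" "[1..<Suc n]"] by simp
  then have inj: "inj_on vind (set w)" and dist: "distinct w" by (simp_all add: distinct_map)
  \<comment> \<open>Monomial positions count from 1 and list positions from 0; outside the range a
    permutation of {1..n} has to be the identity.\<close>
  define \<sigma> where "\<sigma> i = (if i \<in> {1..n} then vind (w ! (i - 1)) else i)" for i
  have "\<sigma> permutes {1..n}"
  proof (rule bij_imp_permutes)
    show "bij_betw \<sigma> {1..n} {1..n}"
      unfolding bij_betw_def
    proof
      show "inj_on \<sigma> {1..n}"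
      proof (rule inj_onI)
        fix i j assume ij: "i \<in> {1..n}" "j \<in> {1..n}" "\<sigma> i = \<sigma> j"
        then have "w ! (i - 1) = w ! (j - 1)" using inj len by (auto simp: \<sigma>_def inj_on_def)
        then have "i - 1 = j - 1" using dist len ij by (auto simp: nth_eq_iff_index_eq)
        then show "i = j" using ij by auto
      qed
      have "\<sigma> ` {1..n} = (\<lambda>i. vind (w ! i)) ` {..<n}"
      proof (intro equalityI subsetI)
        fix j assume "j \<in> (\<lambda>i. vind (w ! i)) ` {..<n}"
        then obtain i where "i < n" "j = vind (w ! i)" by auto
        then show "j \<in> \<sigma> ` {1..n}" by (intro image_eqI[of _ _ "Suc i"]) (auto simp: \<sigma>_def)
      qed (auto simp: \<sigma>_def)
      also have "\<dots> = vind ` set w" using len by (auto simp: set_conv_nth)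
      finally show "\<sigma> ` {1..n} = {1..n}" using set by simp
    qed
  qed (auto simp: \<sigma>_def)
  moreover have "w = map (\<lambda>i. Indet (\<sigma> i) (vdeg (w ! (i - 1))) (starred (w ! (i - 1)))) [1..<Suc n]"
  proof (rule nth_equalityI)
    fix i assume "i < length w"
    then show "w ! i = map (\<lambda>i. Indet (\<sigma> i) (vdeg (w ! (i - 1))) (starred (w ! (i - 1)))) [1..<Suc n] ! i"
      using len by (simp add: \<sigma>_def del: upt_Suc)
  qed (use len in simp)
  moreover have "\<forall>i \<in> {1..n}. vdeg (w ! (i - 1)) \<in> Zr m" using * len by (auto simp: inG_def)
  ultimately show "w \<in> multilinear_monos (Zr m) n"
    unfolding multilinear_monos_def
    by (intro CollectI exI[of _ \<sigma>] exI[of _ "\<lambda>i. vdeg (w ! (i - 1))"] exI[of _ "\<lambda>i. starred (w ! (i - 1))"] conjI)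
qed

lemma distinct_multilinear: "w \<in> multilinear_monos (Zr m) n \<Longrightarrow> distinct (map vind w)"
  using mset_eq_imp_distinct_iff[of "map vind w" "[1..<Suc n]"] by (simp add: multilinear_monos_iff)

lemma inj_fmonom: "fmonom v = (fmonom w :: ('g, 'f::field) fpoly) \<longleftrightarrow> v = w"
  by (auto simp: fmonom_def dest!: arg_cong[of _ _ Poly_Mapping.keys])


section \<open>The theorem\<close>

text \<open>For a special word (VII) is the required alternative between its two sides.\<close>

lemma good_reduced:
  assumes "good_center m w" "inG m w"
  shows "reduced m w"
  unfolding reduced_def
proof (intro conjI impI assms(2))
  assume sp: "special m w"
  then have "nz w = 1" by (simp add: special_def)
  then obtain s l s' where w: "w = s @ l # s'" "nz s = 0" "vdeg l \<noteq> 0" "nz s' = 0"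
    using split_first_nz[of w] by auto
  then have "vdeg l \<in> basis_elts m" using sp by (simp add: special_def wdeg_nz_0)
  with good_center_single[OF assms(1) _ w(1,2,4)] sp consider "unstarred s" | "unstarred s'"
    by (auto simp: special_def)
  then show "left_unst w \<or> right_unst w"
  proof cases
    case 1
    have "takeWhile (\<lambda>l. vdeg l = 0) w = s" using w by (simp add: takeWhile_tail nz_0_iff)
    then show ?thesis using 1 by (simp add: left_unst_takeWhile unstarred_def)
  next
    case 2
    have "takeWhile (\<lambda>l. vdeg l = 0) (rev w) = rev s'" using w by (simp add: takeWhile_tail nz_0_iff)
    then show ?thesis using 2 by (simp add: right_unst_rev left_unst_takeWhile unstarred_def)
  qed
qed

text \<open>For \<open>m = 1\<close> stars are invisible, so only the unstarred good words are kept as representatives.\<close>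

definition good_words :: "'f::field itself \<Rightarrow> nat \<Rightarrow> nat \<Rightarrow> zgrp indet list set" where
  "good_words ty m n = {w \<in> multilinear_monos (Zr m) n. good_mono TYPE('f) m w \<and> (m = 1 \<longrightarrow> unstarred w)}"

text \<open>Elimination with \<open>I = {0}\<close>. Good words sharing a path monomial are equal by
  \<open>good_unique\<close>, once their centers are known to be free of stars: by
  \<open>good_center_path\<close>, or by the choice of unstarred words for m = 1. None of them lacks
  a path, since none is an identity.\<close>

lemma good_words_independent:
  fixes p :: "(zgrp, 'f::field_char_0) fpoly"
  assumes m: "0 < m" and p: "p \<in> UT_identities m" "Poly_Mapping.keys p \<subseteq> FMon ` good_words TYPE('f) m n"
  shows "p = 0"
proof -
  have G: "inG m w" "good_order TYPE('f) m w" "good_center m w" "m = 1 \<longrightarrow> unstarred w"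
    "fmonom w \<notin> (UT_identities m :: (zgrp, 'f) fpoly set)" if "w \<in> good_words TYPE('f) m n" for w
    using that good_monoD[of m w, where ?'f = 'f] by (auto simp: good_words_def multilinear_monos_iff good_mono_def)
  have "p \<in> {0}"
  proof (rule eliminate_reduced[OF m _ _ _ _ _ _ _ p])
    fix v w a b X
    assume *: "v \<in> good_words TYPE('f) m n" "w \<in> good_words TYPE('f) m n" "path False m a v b X" "path False m a w b X"
      "noncentral m a b v \<or> path True m a v b X \<and> path True m a w b X"
    have "path True m a v b X \<and> path True m a w b X"
    proof (cases "noncentral m a b v")
      case True
      then have "noncentral m a b w" using path_nz_eq[OF *(3,4)] by (simp add: noncentral_def)
      have "path True m a u b X" if "u \<in> good_words TYPE('f) m n" "noncentral m a b u" "path False m a u b X" for u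
      proof (cases "m = 1")
        case True
        then show ?thesis
          using G(4)[OF that(1)] by (intro path_strengthen[OF that(3)]) (auto simp: unstarred_def)
      next
        case False
        then show ?thesis using good_center_path[OF G(3)[OF that(1)] that(3,2)] by blast
      qed
      then show ?thesis using *(1-4) True \<open>noncentral m a b w\<close> by blast
    qed (use *(5) in blast)
    then have "v = w" using good_unique G(2)[OF *(1)] G(2)[OF *(2)] by blast
    then show "fmonom v - fmonom w \<in> {0}" by simp
  next
    fix w assume w: "w \<in> good_words TYPE('f) m n"
    show "reduced m w" using good_reduced G[OF w] by blast
    assume "\<nexists>a b X. path False m a w b X"
    from nopath_UT[OF G(1)[OF w] this] show "fmonom w \<in> {0}" using G(5)[OF w] by blast
  qed (use UT_zero in auto)
  then show ?thesis by simp
qed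

lemma vectorspace_P_space: "vectorspace class_ring (P_space m n :: ('f::field, (zgrp, 'f) fpoly) module)"
proof -
  interpret vectorspace class_ring "free_alg (Zr m) :: ('f, (zgrp, 'f) fpoly) module"
    by (rule vectorspace_free_alg)
  show ?thesis
    unfolding P_space_def multilinear_space_def
    by (intro subspace_is_vs span_is_subspace) (auto simp: fmonom_carrier multilinear_monos_iff)
qed

lemma P_space_simps:
  "carrier (P_space m n) = multilinear_space (Zr m) n" "add (P_space m n) = (+)" "zero (P_space m n) = 0"
  "smult (P_space m n) = (\<lambda>c p. Poly_Mapping.single 0 c * p)"
  by (simp_all add: P_space_def free_alg_simps(2-))

context
  fixes m n :: nat
begin

interpretation P: vectorspace class_ring "P_space m n :: ('f::field, (zgrp, 'f) fpoly) module"
  by (rule vectorspace_P_space)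

lemma P_space_minus:
  fixes p q :: "(zgrp, 'f::field) fpoly"
  assumes "p \<in> multilinear_space (Zr m) n" "q \<in> multilinear_space (Zr m) n"
  shows "p \<ominus>\<^bsub>P_space m n\<^esub> q = p - q"
proof -
  have "p \<in> carrier (P_space m n)" "q \<in> carrier (P_space m n)"
    using assms by (simp_all add: P_space_simps(1))
  then have "p = (p \<ominus>\<^bsub>P_space m n\<^esub> q) \<oplus>\<^bsub>P_space m n\<^esub> q"
    by (simp add: a_minus_def P.a_assoc P.l_neg)
  then have "p = (p \<ominus>\<^bsub>P_space m n\<^esub> q) + q" by (simp add: P_space_simps)
  then show ?thesis by (metis add_diff_cancel_right')
qed

lemma P_space_lincomb:
  fixes S :: "(zgrp, 'f::field) fpoly set"
  assumes "finite S" "S \<subseteq> multilinear_space (Zr m) n"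
  shows "module.lincomb (P_space m n) a S = (\<Sum>b \<in> S. Poly_Mapping.single 0 (a b) * b)"
proof -
  have "P.lincomb a S = (\<Sum>b \<in> S. a b \<odot>\<^bsub>P_space m n\<^esub> b)"
    unfolding P.lincomb_def
  proof (rule finsum_plus)
    show "abelian_monoid (P_space m n :: ('f, (zgrp, 'f) fpoly) module)" by (rule P.abelian_monoid_axioms)
    have "a b \<odot>\<^bsub>P_space m n\<^esub> b \<in> carrier (P_space m n)" if "b \<in> S" for b
      using that assms by (intro P.smult_closed) (auto simp: P_space_simps(1))
    then show "(\<lambda>b. a b \<odot>\<^bsub>P_space m n\<^esub> b) \<in> S \<rightarrow> carrier (P_space m n)" by auto
  qed (simp_all add: P_space_simps assms)
  then show ?thesis by (simp add: P_space_simps)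
qed

lemma fmonom_multilinear: "w \<in> multilinear_monos (Zr m) n \<Longrightarrow> fmonom w \<in> (multilinear_space (Zr m) n :: (zgrp, 'f::field) fpoly set)"
proof -
  interpret vectorspace class_ring "free_alg (Zr m) :: ('f, (zgrp, 'f) fpoly) module"
    by (rule vectorspace_free_alg)
  have "(fmonom ` multilinear_monos (Zr m) n :: (zgrp, 'f) fpoly set) \<subseteq> multilinear_space (Zr m) n"
    unfolding multilinear_space_def by (rule in_own_span) (auto simp: fmonom_carrier multilinear_monos_iff)
  then show "w \<in> multilinear_monos (Zr m) n \<Longrightarrow> fmonom w \<in> (multilinear_space (Zr m) n :: (zgrp, 'f) fpoly set)" by blast
qed

lemma multilinear_spaceE:
  fixes p :: "(zgrp, 'f::field) fpoly"
  assumes "p \<in> multilinear_space (Zr m) n"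
  obtains a S where "finite S" "S \<subseteq> fmonom ` multilinear_monos (Zr m) n"
    "p = (\<Sum>b \<in> S. Poly_Mapping.single 0 (a b) * b)"
proof -
  interpret vectorspace class_ring "free_alg (Zr m) :: ('f, (zgrp, 'f) fpoly) module"
    by (rule vectorspace_free_alg)
  obtain a S where S: "finite S" "S \<subseteq> fmonom ` multilinear_monos (Zr m) n" "p = lincomb a S"
    using assms unfolding multilinear_space_def span_def by blast
  have "lincomb a S = (\<Sum>b \<in> S. a b \<odot>\<^bsub>free_alg (Zr m)\<^esub> b)"
    unfolding lincomb_def
  proof (rule finsum_plus)
    show "abelian_monoid (free_alg (Zr m) :: ('f, (zgrp, 'f) fpoly) module)" by (rule abelian_monoid_axioms)
    have "a b \<odot>\<^bsub>free_alg (Zr m)\<^esub> b \<in> carrier (free_alg (Zr m))" if "b \<in> S" for b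
      using that S by (intro smult_closed) (auto simp: fmonom_carrier multilinear_monos_iff)
    then show "(\<lambda>b. a b \<odot>\<^bsub>free_alg (Zr m)\<^esub> b) \<in> S \<rightarrow> carrier (free_alg (Zr m))" by auto
  qed (simp_all add: free_alg_simps(2-) S)
  then show thesis using that[OF S(1,2)] S(3) by (simp add: free_alg_simps(2-))
qed

lemma submodule_identities:
  "submodule class_ring (multilinear_identities m n) (P_space m n :: ('f::field, (zgrp, 'f) fpoly) module)"
proof (rule submodule.intro)
  show "module class_ring (P_space m n :: ('f, (zgrp, 'f) fpoly) module)" by (rule P.module_axioms)
  show "multilinear_identities m n \<subseteq> carrier (P_space m n :: ('f, (zgrp, 'f) fpoly) module)"
    by (auto simp: multilinear_identities_def P_space_simps)
  have "\<zero>\<^bsub>P_space m n\<^esub> \<in> carrier (P_space m n :: ('f, (zgrp, 'f) fpoly) module)" by (rule P.zero_closed)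
  then show "\<zero>\<^bsub>P_space m n\<^esub> \<in> (multilinear_identities m n :: (zgrp, 'f) fpoly set)"
    by (simp add: multilinear_identities_def P_space_simps UT_zero)
next
  fix p q :: "(zgrp, 'f) fpoly"
  assume "p \<in> multilinear_identities m n" "q \<in> multilinear_identities m n"
  then show "p \<oplus>\<^bsub>P_space m n\<^esub> q \<in> multilinear_identities m n"
    using P.a_closed[of p q] by (simp add: multilinear_identities_def P_space_simps UT_add)
next
  fix c and p :: "(zgrp, 'f) fpoly"
  assume p: "p \<in> multilinear_identities m n"
  have "(Poly_Mapping.single 0 c :: (zgrp, 'f) fpoly) \<in> carrier (free_alg (Zr m))" by (rule free_alg_closed)
  then have "Poly_Mapping.single 0 c * p \<in> UT_identities m"
    using ideal.I_l_closed[OF ideal_UT_identities, of p m "Poly_Mapping.single 0 c"] p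
    by (simp add: multilinear_identities_def free_alg_simps(2-))
  then show "c \<odot>\<^bsub>P_space m n\<^esub> p \<in> multilinear_identities m n"
    using P.smult_closed[of c p] p by (simp add: multilinear_identities_def P_space_simps)
qed

end

text \<open>The polynomials congruent to combinations of good words form a subspace;
  \<open>reduce_word\<close> followed by \<open>exists_good\<close> places every multilinear word in
  it.\<close>

lemma good_words_span:
  fixes v :: "(zgrp, 'f::field_char_0) fpoly"
  assumes m: "0 < m" and v: "v \<in> multilinear_space (Zr m) n"
  shows "\<exists>a S. finite S \<and> S \<subseteq> fmonom ` good_words TYPE('f) m n \<and>
    v - (\<Sum>b \<in> S. Poly_Mapping.single 0 (a b) * b) \<in> UT_identities m"
proof -
  interpret basis_ideal m "UT_identities m :: (zgrp, 'f) fpoly set" by (rule basis_ideal_UT[OF m])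
  let ?B = "fmonom ` good_words TYPE('f) m n :: (zgrp, 'f) fpoly set"
  let ?T = "UT_identities m :: (zgrp, 'f) fpoly set"
  define L where "L a S = (\<Sum>b \<in> S. Poly_Mapping.single 0 (a b) * b)" for a and S :: "(zgrp, 'f) fpoly set"
  define Q where "Q v \<longleftrightarrow> (\<exists>a S. finite S \<and> S \<subseteq> ?B \<and> v - L a S \<in> ?T)" for v
  have Q_T: "Q v" if "v \<in> ?T" for v
    unfolding Q_def by (intro exI[of _ "\<lambda>_. 0"] exI[of _ "{}"]) (use that in \<open>simp add: L_def\<close>)
  have Q_B: "Q b" if "b \<in> ?B" for b
    unfolding Q_def by (intro exI[of _ "\<lambda>_. 1"] exI[of _ "{b}"]) (use that in \<open>auto simp: L_def UT_zero\<close>)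
  have Q_add: "Q (v + w)" if vw: "Q v" "Q w" for v w
  proof -
    obtain a S where 1: "finite S" "S \<subseteq> ?B" "v - L a S \<in> ?T" using vw(1) unfolding Q_def by blast
    obtain a' S' where 2: "finite S'" "S' \<subseteq> ?B" "w - L a' S' \<in> ?T" using vw(2) unfolding Q_def by blast
    define c where "c b = (if b \<in> S then a b else 0) + (if b \<in> S' then a' b else 0)" for b
    have ext: "L (\<lambda>b. if b \<in> S then a b else 0) (S \<union> S') = L a S"
      if "finite S" "finite S'" for a and S S' :: "(zgrp, 'f) fpoly set"
      unfolding L_def by (rule sum.mono_neutral_cong_right) (use that in auto)
    have "L c (S \<union> S') = L (\<lambda>b. if b \<in> S then a b else 0) (S \<union> S') + L (\<lambda>b. if b \<in> S' then a' b else 0) (S' \<union> S)"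
      by (simp add: L_def c_def single_add distrib_right sum.distrib Un_commute)
    also have "\<dots> = L a S + L a' S'" using ext 1 2 by simp
    finally have "v + w - L c (S \<union> S') = (v - L a S) + (w - L a' S')" by simp
    also have "\<dots> \<in> ?T" by (rule UT_add[OF 1(3) 2(3)])
    finally show ?thesis unfolding Q_def using 1 2 by (intro exI[of _ c] exI[of _ "S \<union> S'"]) auto
  qed
  have Q_smult: "Q (Poly_Mapping.single 0 c * v)" if v: "Q v" for c v
  proof -
    obtain a S where 1: "finite S" "S \<subseteq> ?B" "v - L a S \<in> ?T" using v unfolding Q_def by blast
    have "Poly_Mapping.single 0 c * v - L (\<lambda>b. c * a b) S = Poly_Mapping.single 0 c * (v - L a S)"
    proof -
      have "L (\<lambda>b. c * a b) S = Poly_Mapping.single 0 c * L a S"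
        unfolding L_def sum_distrib_left
        by (intro sum.cong) (simp_all add: mult_single flip: mult.assoc)
      then show ?thesis by (simp add: right_diff_distrib)
    qed
    also have "\<dots> \<in> ?T" by (rule I_smult[OF 1(3)])
    finally show ?thesis unfolding Q_def using 1(1,2) by blast
  qed
  have Q_sum: "Q (sum f S)" if "\<And>i. i \<in> S \<Longrightarrow> Q (f i)" for f and S :: "'i set"
    using that by (induction S rule: infinite_finite_induct) (auto intro: Q_add Q_T UT_zero)
  have Q_reduced: "Q (fmonom w)" if w: "w \<in> multilinear_monos (Zr m) n" "reduced m w" for w
  proof (cases "fmonom w \<in> ?T")
    case False
    obtain w' where w': "eqv w w'" "mset (map vind w') = mset (map vind w)" "inG m w'"
      "good_mono TYPE('f) m w'" "m = 1 \<longrightarrow> unstarred w'"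
      using exists_good[OF subset_refl w(2) distinct_multilinear[OF w(1)] False] by blast
    then have "fmonom w' \<in> ?B" using w(1) by (simp add: good_words_def multilinear_monos_iff)
    from Q_add[OF Q_T[OF w'(1)[unfolded eqv_def]] Q_B[OF this]] have "Q ((fmonom w - fmonom w') + fmonom w')" .
    then show ?thesis by simp
  qed (rule Q_T)
  have Q_mono: "Q (fmonom w)" if w: "w \<in> multilinear_monos (Zr m) n" for w
  proof -
    have "inG m w" using w by (simp add: multilinear_monos_iff)
    from reduce_word[OF this] obtain q where q: "fmonom w - q \<in> ?T"
      "\<And>w'. w' \<in> Poly_Mapping.keys q \<Longrightarrow> reduced m (letters w') \<and> map vind (letters w') = map vind w" by blast
    have "Q (\<Sum>w' \<in> Poly_Mapping.keys q. Poly_Mapping.single 0 (Poly_Mapping.lookup q w') * fmonom (letters w'))"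
    proof (intro Q_sum Q_smult Q_reduced)
      fix w' assume "w' \<in> Poly_Mapping.keys q"
      from q(2)[OF this] w show "letters w' \<in> multilinear_monos (Zr m) n" "reduced m (letters w')"
        by (auto simp: multilinear_monos_iff reduced_def)
    qed
    then have "Q q" by (simp only: single_fmonom[symmetric] sum_single_lookup)
    then have "Q ((fmonom w - q) + q)" by (rule Q_add[OF Q_T[OF q(1)]])
    then show ?thesis by simp
  qed
  obtain a S where S: "finite S" "S \<subseteq> fmonom ` multilinear_monos (Zr m) n"
    "v = (\<Sum>b \<in> S. Poly_Mapping.single 0 (a b) * b)"
    by (rule multilinear_spaceE[OF v])
  have "Q v" unfolding S(3) by (intro Q_sum Q_smult) (use S(2) Q_mono in auto)
  then show ?thesis by (simp only: Q_def L_def)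
qed

lemma T_ideal_Int:
  fixes I J :: "(zgrp, 'f::field) fpoly set"
  assumes "T_ideal (Zr m) I" "T_ideal (Zr m) J"
  shows "T_ideal (Zr m) (I \<inter> J)"
  using assms ring.i_intersect[OF ring_free_alg, of I "Zr m" J] unfolding T_ideal_def by blast

lemma T_basis_UT:
  assumes "0 < m"
  shows "T_basis (Zr m) (gens m) (UT_identities m :: (zgrp, 'f::field_char_0) fpoly set)"
  unfolding T_basis_def
proof (intro conjI equalityI)
  let ?T = "UT_identities m :: (zgrp, 'f) fpoly set"
  show "gens m \<subseteq> (carrier (free_alg (Zr m)) :: (zgrp, 'f) fpoly set)"
    using gens_subset_UT UT_carrier by blast
  show "\<Inter> {I. T_ideal (Zr m) I \<and> gens m \<subseteq> I} \<subseteq> ?T"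
    using T_ideal_UT_identities gens_subset_UT by blast
  show "?T \<subseteq> \<Inter> {I. T_ideal (Zr m) I \<and> gens m \<subseteq> I}"
  proof (rule Inter_greatest)
    fix I :: "(zgrp, 'f) fpoly set" assume "I \<in> {I. T_ideal (Zr m) I \<and> gens m \<subseteq> I}"
    \<comment> \<open>The intersection with the identities is again a T-ideal containing the
      generators, and it satisfies the inclusion that \<open>UT_subset_basis_ideal\<close>
      assumes.\<close>
    then have "basis_ideal m (I \<inter> ?T)"
      using assms gens_subset_UT by (intro basis_ideal.intro T_ideal_Int T_ideal_UT_identities) auto
    from UT_subset_basis_ideal[OF this] show "?T \<subseteq> I" by blast
  qed
qed

text \<open>The basis property is proved for \<open>good_words\<close>, which differs from the set
  of good words only for m = 1. There a good word with stars has the same image as an unstarred one,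
  so the set of images is unchanged, but injectivity is claimed only from m = 2 on.\<close>

lemma good_monos_basis:
  assumes m: "0 < m"
  shows "vectorspace.basis (class_ring :: 'f::field_char_0 ring) (P_quot m n) (quot_map m n ` good_monos m n)"
    and "2 \<le> m \<Longrightarrow> inj_on (quot_map m n) (good_monos m n :: (zgrp, 'f) fpoly set)"
proof -
  let ?V = "P_space m n :: ('f, (zgrp, 'f) fpoly) module"
  let ?W = "multilinear_identities m n :: (zgrp, 'f) fpoly set"
  let ?B = "fmonom ` good_words TYPE('f) m n :: (zgrp, 'f) fpoly set"
  note V = vectorspace_P_space[of m n, where ?'f = 'f] and W = submodule_identities[of m n, where ?'f = 'f]
  interpret basis_ideal m "UT_identities m :: (zgrp, 'f) fpoly set" by (rule basis_ideal_UT[OF m])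
  have qm: "quot_map m n = (\<lambda>x. ?W +>\<^bsub>?V\<^esub> x)" by (simp add: quot_map_def fun_eq_iff)
  have BM: "?B \<subseteq> multilinear_space (Zr m) n" by (auto simp: good_words_def intro: fmonom_multilinear)
  have inj: "inj_on (\<lambda>x. ?W +>\<^bsub>?V\<^esub> x) ?B"
  proof (rule inj_onI)
    fix b b' assume b: "b \<in> ?B" "b' \<in> ?B" "?W +>\<^bsub>?V\<^esub> b = ?W +>\<^bsub>?V\<^esub> b'"
    then have bV: "b \<in> multilinear_space (Zr m) n" "b' \<in> multilinear_space (Zr m) n" using BM by auto
    have "b \<ominus>\<^bsub>?V\<^esub> b' \<in> ?W"
      by (rule mod_hom_quot(4)[OF V W _ _ b(3)]) (use bV in \<open>simp_all add: P_space_simps\<close>)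
    then have d: "b - b' \<in> UT_identities m" using bV by (simp add: P_space_minus multilinear_identities_def)
    obtain u u' where u: "u \<in> good_words TYPE('f) m n" "b = fmonom u" "u' \<in> good_words TYPE('f) m n" "b' = fmonom u'"
      using b by auto
    have "Poly_Mapping.keys (b - b') \<subseteq> FMon ` good_words TYPE('f) m n"
      using keys_diff[of b b'] u by (auto simp: fmonom_def)
    from good_words_independent[OF m d this] show "b = b'" by simp
  qed
  have basis: "vectorspace.basis class_ring (quot_space ?V ?W) ((\<lambda>x. ?W +>\<^bsub>?V\<^esub> x) ` ?B)"
  proof (rule quot_basis[OF V W _ inj])
    show "?B \<subseteq> carrier ?V" using BM by (simp add: P_space_simps)
  next
    fix v assume "v \<in> carrier ?V"
    then have v: "v \<in> multilinear_space (Zr m) n" by (simp add: P_space_simps)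
    obtain a S where S: "finite S" "S \<subseteq> ?B"
      "v - (\<Sum>b \<in> S. Poly_Mapping.single 0 (a b) * b) \<in> UT_identities m"
      using good_words_span[OF m v] by blast
    have SM: "S \<subseteq> multilinear_space (Zr m) n" using S BM by blast
    interpret P: vectorspace class_ring ?V by (rule V)
    have lc: "P.lincomb a S \<in> carrier ?V" using SM by (intro P.lincomb_closed) (auto simp: P_space_simps)
    then have "v \<ominus>\<^bsub>?V\<^esub> P.lincomb a S \<in> carrier ?V" using v by (intro P.minus_closed) (auto simp: P_space_simps)
    moreover have "v \<ominus>\<^bsub>?V\<^esub> P.lincomb a S = v - (\<Sum>b \<in> S. Poly_Mapping.single 0 (a b) * b)"
      using P_space_minus[OF v, of "P.lincomb a S"] lc P_space_lincomb[OF S(1) SM, of a] by (simp add: P_space_simps)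
    ultimately have "v \<ominus>\<^bsub>?V\<^esub> P.lincomb a S \<in> ?W"
      using S(3) by (simp add: multilinear_identities_def P_space_simps)
    then show "\<exists>a S. finite S \<and> S \<subseteq> ?B \<and> a \<in> S \<rightarrow> carrier class_ring \<and> v \<ominus>\<^bsub>?V\<^esub> P.lincomb a S \<in> ?W"
      using S(1,2) by (intro exI[of _ a] exI[of _ S]) auto
  next
    fix a :: "(zgrp, 'f) fpoly \<Rightarrow> 'f" and S s
    assume S: "finite S" "S \<subseteq> ?B" "module.lincomb ?V a S \<in> ?W" "s \<in> S"
    let ?p = "\<Sum>b \<in> S. Poly_Mapping.single 0 (a b) * b"
    have "S \<subseteq> multilinear_space (Zr m) n" using S BM by blast
    then have pT: "?p \<in> UT_identities m"
      using S(1,3) P_space_lincomb[of S m n a] by (simp add: multilinear_identities_def)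
    obtain U where U: "U \<subseteq> good_words TYPE('f) m n" "S = fmonom ` U" using S(2) by (meson subset_imageE)
    have injU: "inj_on fmonom U" by (auto simp: inj_on_def inj_fmonom)
    have fin: "finite U" using S(1) U injU finite_image_iff by blast
    have p: "?p = (\<Sum>u \<in> U. Poly_Mapping.single (FMon u) (a (fmonom u)))"
      unfolding U(2) sum.reindex[OF injU] by (simp add: fmonom_def mult_single)
    have lookup: "Poly_Mapping.lookup ?p (FMon u) = (if u \<in> U then a (fmonom u) else 0)" for u
      unfolding p using fin by (simp add: lookup_sum lookup_single when_def)
    have "Poly_Mapping.keys ?p \<subseteq> FMon ` good_words TYPE('f) m n"
    proof
      fix w assume "w \<in> Poly_Mapping.keys ?p"
      then have "letters w \<in> U" using lookup[of "letters w"] by (auto simp: in_keys_iff split: if_splits)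
      then show "w \<in> FMon ` good_words TYPE('f) m n" using U(1) by (metis fmon.collapse imageI subsetD)
    qed
    from good_words_independent[OF m pT this] have "Poly_Mapping.lookup ?p w = 0" for w by simp
    then show "a s = \<zero>\<^bsub>class_ring\<^esub>" using lookup S(4) U(2) by (metis (no_types, lifting) class_ring_simps(5) imageE)
  qed
  have sub: "?B \<subseteq> good_monos m n" by (auto simp: good_words_def good_monos_def)
  have "quot_map m n ` good_monos m n = (\<lambda>x. ?W +>\<^bsub>?V\<^esub> x) ` ?B"
  proof
    show "(\<lambda>x. ?W +>\<^bsub>?V\<^esub> x) ` ?B \<subseteq> quot_map m n ` good_monos m n" using sub by (auto simp: qm)
    show "quot_map m n ` good_monos m n \<subseteq> (\<lambda>x. ?W +>\<^bsub>?V\<^esub> x) ` ?B"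
    proof
      fix X assume "X \<in> quot_map m n ` (good_monos m n :: (zgrp, 'f) fpoly set)"
      then obtain w where w: "w \<in> multilinear_monos (Zr m) n" "good_mono TYPE('f) m w" "X = ?W +>\<^bsub>?V\<^esub> fmonom w"
        by (auto simp: good_monos_def qm)
      have "inG m w" using w(1) by (simp add: multilinear_monos_iff)
      then have "reduced m w" using good_reduced good_monoD[OF w(2)] by blast
      moreover have "fmonom w \<notin> (UT_identities m :: (zgrp, 'f) fpoly set)" using w(2) by (simp add: good_mono_def)
      ultimately obtain w' where w': "eqv w w'" "mset (map vind w') = mset (map vind w)" "inG m w'"
        "good_mono TYPE('f) m w'" "m = 1 \<longrightarrow> unstarred w'"
        using exists_good[OF subset_refl _ distinct_multilinear[OF w(1)]] by blast
      then have g: "w' \<in> good_words TYPE('f) m n" using w(1) by (simp add: good_words_def multilinear_monos_iff)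
      have ml: "fmonom w \<in> (multilinear_space (Zr m) n :: (zgrp, 'f) fpoly set)"
        "fmonom w' \<in> (multilinear_space (Zr m) n :: (zgrp, 'f) fpoly set)"
        using w(1) g by (auto simp: good_words_def intro: fmonom_multilinear)
      interpret P: vectorspace class_ring ?V by (rule V)
      have "fmonom w \<ominus>\<^bsub>?V\<^esub> fmonom w' \<in> carrier ?V" using ml by (intro P.minus_closed) (auto simp: P_space_simps)
      then have "fmonom w \<ominus>\<^bsub>?V\<^esub> fmonom w' \<in> ?W"
        using w'(1) P_space_minus[OF ml] by (simp add: multilinear_identities_def P_space_simps eqv_def)
      then have "X = ?W +>\<^bsub>?V\<^esub> fmonom w'"
        unfolding w(3) by (intro mod_hom_quot(3)[OF V W]) (use ml in \<open>simp_all add: P_space_simps\<close>)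
      then show "X \<in> (\<lambda>x. ?W +>\<^bsub>?V\<^esub> x) ` ?B" using g by blast
    qed
  qed
  then show "vectorspace.basis (class_ring :: 'f ring) (P_quot m n) (quot_map m n ` good_monos m n)"
    using basis by (simp only: P_quot_def)
  assume "2 \<le> m"
  then have "good_monos m n = ?B" by (auto simp: good_words_def good_monos_def)
  then show "inj_on (quot_map m n) (good_monos m n :: (zgrp, 'f) fpoly set)" using inj by (simp only: qm)
qed

theorem theorem2p18:
  fixes m :: nat
  assumes "0 < m"
  shows "T_basis (Zr m) (gens m) (UT_identities m :: (zgrp, 'f::field_char_0) fpoly set) \<and>
    (\<forall>n. vectorspace.basis (class_ring :: 'f ring) (P_quot m n) (quot_map m n ` good_monos m n) \<and>
         (2 \<le> m \<longrightarrow> inj_on (quot_map m n) (good_monos m n :: (zgrp, 'f) fpoly set)))"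
  using T_basis_UT[OF assms] good_monos_basis[OF assms] by blast

end
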